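(* Let $k$ be a complete non-archimedean field, let $D$ be a (closed or open) one-dimensional disc over $k$ and let $U\subset D$ be the complement of the origin. Let $f$ be an analytic function on $U$. The following are equivalent: (i) the function $f$ can be extended to a meromorphic function on $D$; i.e., $f$ has no essential singularity at the origin; (ii) the zero-locus of $f$ is of the form $Z\cap U$ for $Z$ a Zariski-closed subset of $D$; i.e., $f$ is invertible on a punctured neighborhood of the origin.
   Context: Analytic spaces are Berkovich spaces; the absolute value of $k$ may be trivial. A one-dimensional disc over $k$ is $\{\lvert T\rvert\le R\}$ (closed) or $\{\lvert T\rvert<R\}$ (open) in $\mathbf A^{1,\mathrm{an}}_k$ for some real $R>0$; its origin is the point $T=0$. A Zariski-closed subset of $D$ is the zero-locus of a coherent sheaf of ideals of $\mathscr O_D$. A punctured neighborhood of the origin is a set $V\setminus\{0\}$ with $V$ a neighborhood of the origin in $D$. The G-sheaf $\mathscr K_D$ of meromorphic functions on $D$ is the sheaf associated with the presheaf obtained by inverting regular elements of $\mathscr O_D$ (on an affinoid domain $\mathscr M(A)$ its sections are the total ring of fractions of $A$). The function $f$ extends to a meromorphic function on $D$ if there is $g\in\mathscr K_D(D)$ whose restriction to $U$ is the image of $f$ in $\mathscr K_D(U)$. The function $f$ can be written uniquely as a convergent series $f=\sum_{i\in\mathbf Z}a_iT^i$ on $U$ with $a_i\in k$; it has no essential singularity at the origin if $a_i=0$ for all sufficiently negative $i$.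
   Formalization: The reformulation of (ii) as "f is invertible on a punctured neighborhood of the origin" is stated only for f not identically zero, since it fails for f = 0, whose zero-locus is D ∩ U; all other equivalences are stated for every f. *)

theory Defs
  imports
    "HOL-Analysis.Analysis"
    "HOL-Algebra.QuotRing"
    "HOL-Computational_Algebra.Polynomial"
    "HOL-Computational_Algebra.Fraction_Field"
begin

(* The trivial absolute value is allowed. *)
definition complete_nonarch_field :: "('a::field \<Rightarrow> real) \<Rightarrow> bool" where
  "complete_nonarch_field v \<longleftrightarrow>
     (\<forall>a. 0 \<le> v a) \<and> (\<forall>a. v a = 0 \<longleftrightarrow> a = 0) \<and>
     (\<forall>a b. v (a * b) = v a * v b) \<and> (\<forall>a b. v (a + b) \<le> max (v a) (v b)) \<and>
     (\<forall>s :: nat \<Rightarrow> 'a. (\<forall>e>0. \<exists>N. \<forall>m\<ge>N. \<forall>n\<ge>N. v (s m - s n) < e)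
        \<longrightarrow> (\<exists>l. (\<lambda>n. v (s n - l)) \<longlonglongrightarrow> 0))"

text \<open>
  The analytification of the affine line: multiplicative seminorms on \<open>k[T]\<close> extending the
  absolute value \<open>v\<close> of \<open>k\<close>.  Its topology is the coarsest one for which all evaluations
  \<open>x \<mapsto> x p\<close> are continuous, that is, the topology induced by the product topology which
  the library puts on the function type.
\<close>

type_synonym 'a point = "'a poly \<Rightarrow> real"

definition affine_line :: "('a::field \<Rightarrow> real) \<Rightarrow> 'a point set" where
  "affine_line v = {x.
     (\<forall>p. 0 \<le> x p) \<and> (\<forall>c. x [:c:] = v c) \<and>
     (\<forall>p q. x (p * q) = x p * x q) \<and> (\<forall>p q. x (p + q) \<le> max (x p) (x q))}"

definition closed_disc :: "('a::field \<Rightarrow> real) \<Rightarrow> real \<Rightarrow> 'a point set" where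
  "closed_disc v R = {x \<in> affine_line v. x [:0, 1:] \<le> R}"

definition open_disc :: "('a::field \<Rightarrow> real) \<Rightarrow> real \<Rightarrow> 'a point set" where
  "open_disc v R = {x \<in> affine_line v. x [:0, 1:] < R}"

definition origin :: "('a::field \<Rightarrow> real) \<Rightarrow> 'a point" where
  "origin v = (\<lambda>p. v (poly p 0))"

text \<open>
  The completed residue field \<open>\<H>(x)\<close> is built as Cauchy sequences modulo null sequences in
  the local ring of rational functions \<open>p/q\<close> with \<open>x q \<noteq> 0\<close>, seminormed by \<open>x p / x q\<close>.
  Its separated completion is the completion of the fraction field of \<open>k[T]\<close> modulo
  the kernel of \<open>x\<close>.
\<close>

definition regular_at :: "'a::field point \<Rightarrow> 'a poly fract set" where
  "regular_at x = {Fract p q | p q. x q \<noteq> 0}"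

definition fract_seminorm :: "'a::field point \<Rightarrow> 'a poly fract \<Rightarrow> real" where
  "fract_seminorm x \<phi> = (THE c. \<exists>p q. x q \<noteq> 0 \<and> \<phi> = Fract p q \<and> c = x p / x q)"

definition cauchy_ring :: "'a::field point \<Rightarrow> (nat \<Rightarrow> 'a poly fract) ring" where
  "cauchy_ring x =
     \<lparr>carrier = {s. (\<forall>n. s n \<in> regular_at x) \<and>
        (\<forall>e>0. \<exists>N. \<forall>m\<ge>N. \<forall>n\<ge>N. fract_seminorm x (s m - s n) < e)},
      mult = (\<lambda>s t n. s n * t n), one = (\<lambda>n. 1),
      zero = (\<lambda>n. 0), add = (\<lambda>s t n. s n + t n)\<rparr>"

definition null_sequences :: "'a::field point \<Rightarrow> (nat \<Rightarrow> 'a poly fract) set" where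
  "null_sequences x =
     {s \<in> carrier (cauchy_ring x). (\<lambda>n. fract_seminorm x (s n)) \<longlonglongrightarrow> 0}"

definition residue_field :: "'a::field point \<Rightarrow> (nat \<Rightarrow> 'a poly fract) set ring" where
  "residue_field x = cauchy_ring x Quot null_sequences x"

definition residue_abs :: "'a::field point \<Rightarrow> (nat \<Rightarrow> 'a poly fract) set \<Rightarrow> real" where
  "residue_abs x A = (THE c. \<exists>s\<in>A. (\<lambda>n. fract_seminorm x (s n)) \<longlonglongrightarrow> c)"

definition fract_value :: "'a::field point \<Rightarrow> 'a poly fract \<Rightarrow> (nat \<Rightarrow> 'a poly fract) set" where
  "fract_value x \<phi> = null_sequences x +>\<^bsub>cauchy_ring x\<^esub> (\<lambda>n. \<phi>)"

text \<open>
  As affinoid domains we take the rational domains of the closed discs centred at the origin.  The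
  defining functions may be taken to be polynomials, since these are dense in \<open>k{T/r}\<close> and a
  rational domain is unchanged by a small perturbation of its defining functions.  By
  Gerritzen-Grauert every affinoid domain is a finite union of rational ones, so these domains are
  a basis of the G-topology and give rise to the same G-sheaves.
\<close>

definition affinoid :: "('a::field \<Rightarrow> real) \<Rightarrow> 'a point set \<Rightarrow> bool" where
  "affinoid v V \<longleftrightarrow> (\<exists>r g F. 0 < r \<and> finite F \<and> (\<forall>(p, c)\<in>F. 0 < c) \<and>
     (\<forall>x\<in>closed_disc v r. x g \<noteq> 0 \<or> (\<exists>(p, c)\<in>F. x p \<noteq> 0)) \<and>
     V = {x \<in> closed_disc v r. \<forall>(p, c)\<in>F. x p \<le> c * x g})"

text \<open>A G-covering of \<open>W\<close> by affinoid domains, that is, a quasi-net in the sense of Berkovich.\<close>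

definition G_covering :: "('a::field \<Rightarrow> real) \<Rightarrow> 'a point set \<Rightarrow> 'a point set set \<Rightarrow> bool" where
  "G_covering v W C \<longleftrightarrow> (\<forall>V\<in>C. affinoid v V \<and> V \<subseteq> W) \<and>
     (\<forall>x\<in>W. \<exists>F. finite F \<and> F \<subseteq> C \<and> x \<in> \<Inter>F \<and>
        (\<exists>N. open N \<and> x \<in> N \<and> N \<inter> W \<subseteq> \<Union>F))"

text \<open>
  The structure sheaf.  The disc is reduced, so a section over \<open>W\<close> is determined by its values
  in the fields \<open>\<H>(x)\<close>.  Over an affinoid domain the sections are the uniform limits of
  rational functions without poles there (the affinoid algebra of a rational domain is the
  completion of that ring for the supremum norm); over an analytic domain, such as an open
  subset of a disc, they are the families which are analytic on every affinoid domain
  contained in it.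
\<close>

type_synonym 'a sect = "'a point \<Rightarrow> (nat \<Rightarrow> 'a poly fract) set"

definition fract_limit_on :: "'a::field point set \<Rightarrow> 'a sect \<Rightarrow> bool" where
  "fract_limit_on V f \<longleftrightarrow> (\<forall>e>0. \<exists>\<phi>. \<forall>x\<in>V. \<phi> \<in> regular_at x \<and>
     residue_abs x (f x \<ominus>\<^bsub>residue_field x\<^esub> fract_value x \<phi>) < e)"

definition analytic_ring :: "('a::field \<Rightarrow> real) \<Rightarrow> 'a point set \<Rightarrow> 'a sect ring" where
  "analytic_ring v W =
     \<lparr>carrier = {f \<in> (\<Pi>\<^sub>E x\<in>W. carrier (residue_field x)).
        \<forall>V. affinoid v V \<and> V \<subseteq> W \<longrightarrow> fract_limit_on V f},
      mult = (\<lambda>f g. \<lambda>x\<in>W. f x \<otimes>\<^bsub>residue_field x\<^esub> g x),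
      one = (\<lambda>x\<in>W. \<one>\<^bsub>residue_field x\<^esub>),
      zero = (\<lambda>x\<in>W. \<zero>\<^bsub>residue_field x\<^esub>),
      add = (\<lambda>f g. \<lambda>x\<in>W. f x \<oplus>\<^bsub>residue_field x\<^esub> g x)\<rparr>"

definition zero_locus :: "'a::field point set \<Rightarrow> 'a sect \<Rightarrow> 'a point set" where
  "zero_locus W f = {x \<in> W. f x = \<zero>\<^bsub>residue_field x\<^esub>}"

text \<open>
  Sheaves of ideals, given by their sections over affinoid domains.  Coherence is Berkovich's
  definition: over the members of some G-covering \<open>J\<close> is the cokernel of a homomorphism
  of free modules of finite rank, i.e. there is a presentation with generators \<open>s\<close> and relations
  \<open>r\<close> which is exact as a sequence of G-sheaves.
\<close>

definition ideal_sheaf ::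
    "('a::field \<Rightarrow> real) \<Rightarrow> 'a point set \<Rightarrow> ('a point set \<Rightarrow> 'a sect set) \<Rightarrow> bool" where
  "ideal_sheaf v D J \<longleftrightarrow>
     (\<forall>V. affinoid v V \<and> V \<subseteq> D \<longrightarrow> ideal (J V) (analytic_ring v V)) \<and>
     (\<forall>V V' h. affinoid v V \<and> V \<subseteq> D \<and> affinoid v V' \<and> V' \<subseteq> V \<and> h \<in> J V
        \<longrightarrow> restrict h V' \<in> J V') \<and>
     (\<forall>V C h. affinoid v V \<and> V \<subseteq> D \<and> G_covering v V C \<and> h \<in> carrier (analytic_ring v V) \<and>
        (\<forall>V'\<in>C. restrict h V' \<in> J V') \<longrightarrow> h \<in> J V)"

definition lin_comb ::
    "('a::field \<Rightarrow> real) \<Rightarrow> 'a point set \<Rightarrow> nat \<Rightarrow> (nat \<Rightarrow> 'a sect) \<Rightarrow> (nat \<Rightarrow> 'a sect) \<Rightarrow> 'a sect" where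
  "lin_comb v W n c s =
     (\<Oplus>\<^bsub>analytic_ring v W\<^esub>j\<in>{..<n}. c j \<otimes>\<^bsub>analytic_ring v W\<^esub> restrict (s j) W)"

definition finitely_presented_on ::
    "('a::field \<Rightarrow> real) \<Rightarrow> 'a point set \<Rightarrow> ('a point set \<Rightarrow> 'a sect set) \<Rightarrow> bool" where
  "finitely_presented_on v V J \<longleftrightarrow> (\<exists>n s m r.
     (\<forall>j<n. s j \<in> J V) \<and>
     (\<forall>V' h. affinoid v V' \<and> V' \<subseteq> V \<and> h \<in> J V' \<longrightarrow>
        (\<exists>C. G_covering v V' C \<and> (\<forall>W\<in>C. \<exists>c. (\<forall>j<n. c j \<in> carrier (analytic_ring v W)) \<and>
           restrict h W = lin_comb v W n c s))) \<and>
     (\<forall>i<m. (\<forall>j<n. r i j \<in> carrier (analytic_ring v V)) \<and>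
        lin_comb v V n (r i) s = \<zero>\<^bsub>analytic_ring v V\<^esub>) \<and>
     (\<forall>V' c. affinoid v V' \<and> V' \<subseteq> V \<and> (\<forall>j<n. c j \<in> carrier (analytic_ring v V')) \<and>
        lin_comb v V' n c s = \<zero>\<^bsub>analytic_ring v V'\<^esub> \<longrightarrow>
        (\<exists>C. G_covering v V' C \<and> (\<forall>W\<in>C. \<exists>d. (\<forall>i<m. d i \<in> carrier (analytic_ring v W)) \<and>
           (\<forall>j<n. restrict (c j) W = lin_comb v W m d (\<lambda>i. r i j))))))"

definition coherent_ideal_sheaf ::
    "('a::field \<Rightarrow> real) \<Rightarrow> 'a point set \<Rightarrow> ('a point set \<Rightarrow> 'a sect set) \<Rightarrow> bool" where
  "coherent_ideal_sheaf v D J \<longleftrightarrow> ideal_sheaf v D J \<and>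
     (\<exists>C. G_covering v D C \<and> (\<forall>V\<in>C. finitely_presented_on v V J))"

definition zariski_closed :: "('a::field \<Rightarrow> real) \<Rightarrow> 'a point set \<Rightarrow> 'a point set \<Rightarrow> bool" where
  "zariski_closed v D Z \<longleftrightarrow> (\<exists>J. coherent_ideal_sheaf v D J \<and>
     Z = {x \<in> D. \<forall>V h. affinoid v V \<and> V \<subseteq> D \<and> x \<in> V \<and> h \<in> J V \<longrightarrow> x \<in> zero_locus V h})"

text \<open>
  The G-sheaf of meromorphic functions.  Denominators are the regular elements, i.e. those on which
  multiplication is injective on the sheaf of analytic functions.  As restriction maps between
  affinoid domains are flat, over an affinoid domain these are just the non-zero-divisors.

  A section of the associated sheaf over \<open>W\<close> is encoded as the set of all its local
  representations: \<open>(V, a, b)\<close> belongs to it iff it restricts to \<open>a/b\<close> on the affinoid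
  domain \<open>V\<close>.  Thus a section is a set of compatible fractions whose domains form a G-covering,
  and which contains every fraction compatible with it.  Equality of sections is equality of
  sets, and restriction discards the domains that are not contained in the smaller set.
\<close>

definition regular_element :: "('a::field \<Rightarrow> real) \<Rightarrow> 'a point set \<Rightarrow> 'a sect \<Rightarrow> bool" where
  "regular_element v V b \<longleftrightarrow> b \<in> carrier (analytic_ring v V) \<and>
     (\<forall>V' c. affinoid v V' \<and> V' \<subseteq> V \<and> c \<in> carrier (analytic_ring v V') \<and>
        restrict b V' \<otimes>\<^bsub>analytic_ring v V'\<^esub> c = \<zero>\<^bsub>analytic_ring v V'\<^esub>
        \<longrightarrow> c = \<zero>\<^bsub>analytic_ring v V'\<^esub>)"

type_synonym 'a fraction = "'a point set \<times> 'a sect \<times> 'a sect"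

definition fractions :: "('a::field \<Rightarrow> real) \<Rightarrow> 'a point set \<Rightarrow> 'a fraction set" where
  "fractions v W = {(V, a, b). affinoid v V \<and> V \<subseteq> W \<and>
     a \<in> carrier (analytic_ring v V) \<and> regular_element v V b}"

fun compatible :: "('a::field \<Rightarrow> real) \<Rightarrow> 'a fraction \<Rightarrow> 'a fraction \<Rightarrow> bool" where
  "compatible v (V, a, b) (V', a', b') \<longleftrightarrow>
     (\<forall>W. affinoid v W \<and> W \<subseteq> V \<inter> V' \<longrightarrow>
        restrict a W \<otimes>\<^bsub>analytic_ring v W\<^esub> restrict b' W =
        restrict a' W \<otimes>\<^bsub>analytic_ring v W\<^esub> restrict b W)"

definition meromorphic_functions ::
    "('a::field \<Rightarrow> real) \<Rightarrow> 'a point set \<Rightarrow> 'a fraction set set" where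
  "meromorphic_functions v W = {S. S \<subseteq> fractions v W \<and>
     G_covering v W (fst ` S) \<and>
     (\<forall>\<xi>\<in>S. \<forall>\<eta>\<in>S. compatible v \<xi> \<eta>) \<and>
     (\<forall>\<xi>\<in>fractions v W. (\<forall>\<eta>\<in>S. compatible v \<xi> \<eta>) \<longrightarrow> \<xi> \<in> S)}"

definition mero_restrict :: "'a::field fraction set \<Rightarrow> 'a point set \<Rightarrow> 'a fraction set" where
  "mero_restrict S W = {(V, a, b) \<in> S. V \<subseteq> W}"

definition mero_of_analytic ::
    "('a::field \<Rightarrow> real) \<Rightarrow> 'a point set \<Rightarrow> 'a sect \<Rightarrow> 'a fraction set" where
  "mero_of_analytic v W f =
     {(V, a, b) \<in> fractions v W. a = restrict f V \<otimes>\<^bsub>analytic_ring v V\<^esub> b}"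

definition extends_meromorphically ::
    "('a::field \<Rightarrow> real) \<Rightarrow> 'a point set \<Rightarrow> 'a point set \<Rightarrow> 'a sect \<Rightarrow> bool" where
  "extends_meromorphically v D U f \<longleftrightarrow>
     (\<exists>g\<in>meromorphic_functions v D. mero_restrict g U = mero_of_analytic v U f)"

definition laurent_sum :: "(int \<Rightarrow> 'a::field) \<Rightarrow> nat \<Rightarrow> 'a poly fract" where
  "laurent_sum a n =
     (\<Sum>i = - int n..int n. Fract [:a i:] 1 * Fract [:0, 1:] 1 powi i)"

(* Convergence at the Gauss points of all radii forces uniform convergence on every closed annulus. *)
definition laurent_expansion :: "'a::field point set \<Rightarrow> 'a sect \<Rightarrow> (int \<Rightarrow> 'a) \<Rightarrow> bool" where
  "laurent_expansion U f a \<longleftrightarrow> (\<forall>x\<in>U.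
     (\<lambda>n. residue_abs x (f x \<ominus>\<^bsub>residue_field x\<^esub> fract_value x (laurent_sum a n)))
        \<longlonglongrightarrow> 0)"

definition no_essential_singularity :: "'a::field point set \<Rightarrow> 'a sect \<Rightarrow> bool" where
  "no_essential_singularity U f \<longleftrightarrow>
     (\<exists>a. laurent_expansion U f a \<and> (\<exists>m. \<forall>i<m. a i = 0))"

definition invertible_near_origin ::
    "('a::field \<Rightarrow> real) \<Rightarrow> 'a point set \<Rightarrow> 'a sect \<Rightarrow> bool" where
  "invertible_near_origin v D f \<longleftrightarrow>
     (\<exists>V. openin (top_of_set D) V \<and> origin v \<in> V \<and>
        restrict f (V - {origin v}) \<in> Units (analytic_ring v (V - {origin v})))"

end

theory Submission
  imports Defs
begin

text \<open>
  Everything is read off at the Gauss points \<open>gauss v s\<close>, which tend to the origin as \<open>s\<close> tends to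
  0. An analytic function \<open>f\<close> on the punctured disc is a series \<open>\<Sum> a i T^i\<close>
  (\<open>laurent_expansion_exists\<close>), and the value of \<open>f\<close> at the Gauss point of radius \<open>s\<close> bounds every
  single term: \<open>\<bar>a i\<bar> s^i \<le> \<bar>f (gauss v s)\<bar>\<close> (\<open>laurent_coeff_le\<close>). Two consequences carry the
  proof that singularities are not essential. First, if \<open>\<bar>f (gauss v s)\<bar> s^N\<close> stays bounded, then
  \<open>a i = 0\<close> for \<open>i < -N\<close> (\<open>laurent_coeff_zero_of_growth\<close>). Second, a function \<open>b\<close> which is not
  identically zero satisfies \<open>\<bar>b (gauss v s)\<bar> \<ge> c s^n\<close> for some \<open>c > 0\<close> and \<open>n\<close>. Together: \<open>f\<close> has
  no essential singularity as soon as \<open>f b\<close> is bounded near the origin for some \<open>b\<close> different from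
  0 (\<open>no_essential_singularity_of_growth\<close>). If \<open>f\<close> extends to a meromorphic function, write it as
  \<open>a/b\<close> near the origin and take this \<open>b\<close>; if \<open>f\<close> is invertible near the origin, take \<open>b = 1/f\<close>.

  Conversely suppose that \<open>a i = 0\<close> for \<open>i < -N\<close>. Then \<open>T^N f\<close> extends to an analytic function \<open>h\<close>
  on the disc (\<open>analytic_multiple_exists\<close>). The function \<open>f = h/T^N\<close> is meromorphic, and the zero
  locus of \<open>f\<close> is that of \<open>h\<close>, hence of the sheaf of ideals of all multiples of \<open>h\<close>. Both claims
  require that \<open>T^N\<close> and \<open>h\<close> are not zero divisors, on every affinoid domain \<open>V\<close> in the disc; such
  a \<open>V\<close> need not contain a Gauss point centred at the origin. A point \<open>x\<close> of \<open>V\<close> is therefore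
  joined to such a Gauss point by the path of the points \<open>move x s\<close>, the Gauss points of radius
  \<open>s\<close> centred at \<open>x\<close>. For small \<open>s\<close> they lie in \<open>V\<close> (\<open>move_in_affinoid\<close>), and a power series that
  is not zero vanishes at none of them (\<open>poly_limit_nonzero_move\<close>). So a function killed by \<open>h\<close>
  vanishes at \<open>move x s\<close> for small \<open>s\<close>, and then it vanishes at \<open>x\<close> (\<open>An_nonzero_move\<close>,
  \<open>regular_of_poly_limit\<close>).

  Finally let the zero locus of \<open>f\<close> be the trace of a Zariski-closed set \<open>Z\<close>. Near the origin \<open>Z\<close>
  is the set of common zeros of finitely many analytic functions. If all of these are zero, then
  \<open>f\<close> vanishes near the origin, so that all its coefficients are 0 and \<open>f\<close> vanishes everywhere.
  Otherwise one of them has at most an isolated zero at the origin (\<open>isolated_zero\<close>), so \<open>f\<close> has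
  no zeros on a punctured neighbourhood of the origin, and a function without zeros is invertible
  (\<open>An_Units\<close>).

  The existence of Laurent expansions rests on the following fact. If a polynomial \<open>q\<close> has no
  zeros on a closed annulus, then \<open>1/q\<close> is a uniform limit of Laurent polynomials there. Otherwise
  the quotient seminorm modulo \<open>q\<close> on Laurent polynomials would be non-zero; a seminorm that is
  minimal below it is multiplicative (\<open>exists_mult_seminorm_below\<close>), that is, a point of the
  annulus, and \<open>q\<close> vanishes at this point (\<open>annulus_contraction\<close>). This is the argument by which
  the spectrum of a Banach ring is non-empty, carried out with polynomials only.
\<close>

section \<open>Ultrametric seminorms\<close>

text \<open>
  Quotient seminorms are only submultiplicative; the multiplicative ones, which are the points of
  Berkovich spaces, arise from them as minimal elements.
\<close>

locale ring_seminorm =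
  fixes N :: "'b::comm_ring_1 \<Rightarrow> real"
  assumes nonneg: "0 \<le> N a"
    and zero: "N 0 = 0"
    and one: "N 1 = 1"
    and add_le: "N (a + b) \<le> max (N a) (N b)"
    and mult_le: "N (a * b) \<le> N a * N b"
begin

lemma sum_le:
  assumes "0 \<le> B" "\<And>i. i \<in> A \<Longrightarrow> N (f i) \<le> B"
  shows "N (sum f A) \<le> B"
  using assms(2)
proof (induction A rule: infinite_finite_induct)
  case (insert i A)
  then have "max (N (f i)) (N (sum f A)) \<le> B"
    by simp
  then show ?case
    using add_le[of "f i" "sum f A"] insert.hyps by (simp add: sum.insert del: max.bounded_iff)
qed (use assms(1) zero in auto)

lemma power_le: "N (a ^ n) \<le> N a ^ n"
proof (induction n)
  case (Suc n)
  have "N (a ^ Suc n) \<le> N a * N (a ^ n)"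
    using mult_le[of a "a ^ n"] by simp
  also have "\<dots> \<le> N a * N a ^ n"
    using Suc nonneg by (simp add: mult_left_mono)
  finally show ?case by simp
qed (simp add: one)

lemma of_nat_le: "N (of_nat n) \<le> 1"
proof (induction n)
  case (Suc n)
  show ?case
    using add_le[of 1 "of_nat n"] Suc one by simp
qed (simp add: zero)

end

locale mult_seminorm =
  fixes N :: "'b::comm_ring_1 \<Rightarrow> real"
  assumes nonneg: "0 \<le> N a"
    and zero: "N 0 = 0"
    and one: "N 1 = 1"
    and add_le: "N (a + b) \<le> max (N a) (N b)"
    and mult: "N (a * b) = N a * N b"

sublocale mult_seminorm \<subseteq> ring_seminorm
  by unfold_locales (simp_all add: nonneg zero one add_le mult)

context mult_seminorm
begin

lemma power: "N (a ^ n) = N a ^ n"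
  by (induction n) (simp_all add: one mult)

lemma minus: "N (- a) = N a"
proof -
  have "N (-1) * N (-1) = 1"
    using mult[of "-1" "-1"] one by simp
  then have "N (-1) = 1"
    using nonneg[of "-1"] by (metis abs_of_nonneg power2_eq_square real_sqrt_abs real_sqrt_one)
  then show ?thesis
    using mult[of "-1" a] by simp
qed

lemma diff_commute: "N (a - b) = N (b - a)"
  using minus[of "a - b"] by simp

lemma diff_le: "N (a - b) \<le> max (N a) (N b)"
  using add_le[of a "- b"] minus by simp

lemma triangle: "N (a - c) \<le> max (N (a - b)) (N (b - c))"
  using add_le[of "a - b" "b - c"] by simp

lemma add_eq_left:
  assumes "N b < N a"
  shows "N (a + b) = N a"
  using add_le[of a b] diff_le[of "a + b" b] assms by (auto simp: max_def split: if_splits)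

end

subsection \<open>The Gauss norm\<close>

definition gauss :: "('b::comm_ring_1 \<Rightarrow> real) \<Rightarrow> real \<Rightarrow> 'b poly \<Rightarrow> real" where
  "gauss N s p = Max ((\<lambda>i. N (coeff p i) * s ^ i) ` {..degree p})"

context mult_seminorm
begin

context
  fixes s :: real
  assumes s: "0 < s"
begin

lemma gauss_attained:
  obtains i where "i \<le> degree p" "gauss N s p = N (coeff p i) * s ^ i"
proof -
  have "gauss N s p \<in> (\<lambda>i. N (coeff p i) * s ^ i) ` {..degree p}"
    unfolding gauss_def by (rule Max_in) auto
  then show ?thesis
    using that by auto
qed

lemma gauss_nonneg: "0 \<le> gauss N s p"
  using gauss_attained[of p] nonneg s by (metis mult_nonneg_nonneg zero_le_power less_imp_le)

lemma coeff_le_gauss: "N (coeff p i) * s ^ i \<le> gauss N s p"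
proof (cases "i \<le> degree p")
  case True
  then show ?thesis
    unfolding gauss_def by (intro Max_ge) auto
next
  case False
  then show ?thesis
    using gauss_nonneg by (simp add: coeff_eq_0 zero)
qed

lemma gauss_le:
  assumes "\<And>i. N (coeff p i) * s ^ i \<le> B"
  shows "gauss N s p \<le> B"
  using assms gauss_attained[of p] by metis

lemma gauss_const: "gauss N s [:c:] = N c"
  by (simp add: gauss_def)

lemma gauss_monom_1: "gauss N s [:c, 1:] = max (N c) s"
  by (simp add: gauss_def one max.commute atMost_Suc)

lemma gauss_add_le: "gauss N s (p + q) \<le> max (gauss N s p) (gauss N s q)"
proof (rule gauss_le)
  fix i
  have "N (coeff (p + q) i) * s ^ i \<le> max (N (coeff p i)) (N (coeff q i)) * s ^ i"
    using add_le s by (simp add: mult_right_mono)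
  also have "\<dots> = max (N (coeff p i) * s ^ i) (N (coeff q i) * s ^ i)"
    using s by (simp add: max_mult_distrib_right)
  also have "\<dots> \<le> max (gauss N s p) (gauss N s q)"
    using coeff_le_gauss by (meson max.mono)
  finally show "N (coeff (p + q) i) * s ^ i \<le> max (gauss N s p) (gauss N s q)" .
qed

lemma gauss_mult_le: "gauss N s (p * q) \<le> gauss N s p * gauss N s q"
proof (rule gauss_le)
  fix n
  have "N (coeff (p * q) n) \<le> gauss N s p * gauss N s q / s ^ n"
    unfolding coeff_mult
  proof (rule sum_le)
    fix i assume "i \<in> {..n}"
    then have n: "s ^ i * s ^ (n - i) = s ^ n"
      by (simp flip: power_add)
    have "(N (coeff p i) * s ^ i) * (N (coeff q (n - i)) * s ^ (n - i)) \<le> gauss N s p * gauss N s q"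
      using s nonneg by (intro mult_mono coeff_le_gauss gauss_nonneg) auto
    then have "N (coeff p i * coeff q (n - i)) * s ^ n \<le> gauss N s p * gauss N s q"
      by (simp add: mult mult_ac flip: n)
    then show "N (coeff p i * coeff q (n - i)) \<le> gauss N s p * gauss N s q / s ^ n"
      using s by (simp add: field_simps)
  qed (use gauss_nonneg s in auto)
  then show "N (coeff (p * q) n) * s ^ n \<le> gauss N s p * gauss N s q"
    using s by (simp add: field_simps)
qed

lemma gauss_least_attained:
  obtains i where "N (coeff p i) * s ^ i = gauss N s p"
    and "\<And>j. j < i \<Longrightarrow> N (coeff p j) * s ^ j < gauss N s p"
proof -
  define i where "i = (LEAST i. N (coeff p i) * s ^ i = gauss N s p)"
  have "\<exists>i. N (coeff p i) * s ^ i = gauss N s p"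
    using gauss_attained[of p] by metis
  then have "N (coeff p i) * s ^ i = gauss N s p"
    unfolding i_def by (rule LeastI_ex)
  moreover have "N (coeff p j) * s ^ j < gauss N s p" if "j < i" for j
    using not_less_Least[of j "\<lambda>i. N (coeff p i) * s ^ i = gauss N s p"] that coeff_le_gauss[of p j]
    by (auto simp: i_def)
  ultimately show ?thesis
    using that by blast
qed

text \<open>
  Gauss's lemma: among the coefficients at which the maximum is attained take those of least
  index, \<open>i\<close> for \<open>p\<close> and \<open>k\<close> for \<open>q\<close>. In the coefficient of \<open>p q\<close> of index \<open>i + k\<close> their product
  strictly dominates all other terms.
\<close>

lemma gauss_mult: "gauss N s (p * q) = gauss N s p * gauss N s q"
proof (rule antisym[OF gauss_mult_le])
  obtain i where i: "N (coeff p i) * s ^ i = gauss N s p"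
    "\<And>j. j < i \<Longrightarrow> N (coeff p j) * s ^ j < gauss N s p"
    using gauss_least_attained[of p] by blast
  obtain k where k: "N (coeff q k) * s ^ k = gauss N s q"
    "\<And>j. j < k \<Longrightarrow> N (coeff q j) * s ^ j < gauss N s q"
    using gauss_least_attained[of q] by blast
  let ?G = "gauss N s p * gauss N s q"
  show "?G \<le> gauss N s (p * q)"
  proof (cases "?G = 0")
    case True
    then show ?thesis using gauss_nonneg[of "p * q"] by argo
  next
    case False
    then have pos: "0 < gauss N s p" "0 < gauss N s q"
      using gauss_nonneg by (auto simp: less_le)
    let ?n = "i + k"
    let ?t = "\<lambda>j. coeff p j * coeff q (?n - j)"
    have sn: "s ^ j * s ^ (?n - j) = s ^ ?n" if "j \<le> ?n" for j
      using that by (simp flip: power_add)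
    have Nt: "N (?t j) * s ^ ?n = (N (coeff p j) * s ^ j) * (N (coeff q (?n - j)) * s ^ (?n - j))"
      if "j \<le> ?n" for j
      using that by (simp add: mult mult_ac flip: sn)
    have main: "N (?t i) * s ^ ?n = ?G"
      using Nt[of i] i k by simp
    have less: "N (?t j) * s ^ ?n < ?G" if j: "j \<le> ?n" "j \<noteq> i" for j
    proof (cases "j < i")
      case True
      have "(N (coeff p j) * s ^ j) * (N (coeff q (?n - j)) * s ^ (?n - j))
          \<le> (N (coeff p j) * s ^ j) * gauss N s q"
        using s nonneg by (intro mult_left_mono coeff_le_gauss) auto
      also have "\<dots> < ?G"
        using i(2)[OF True] pos by simp
      finally show ?thesis
        using Nt j by simp
    next
      case False
      then have jk: "?n - j < k"
        using j by linarith
      have "(N (coeff p j) * s ^ j) * (N (coeff q (?n - j)) * s ^ (?n - j))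
          \<le> gauss N s p * (N (coeff q (?n - j)) * s ^ (?n - j))"
        using s nonneg by (intro mult_right_mono coeff_le_gauss) auto
      also have "\<dots> < ?G"
        using k(2)[OF jk] pos by simp
      finally show ?thesis
        using Nt j by simp
    qed
    define R where "R = sum ?t ({..?n} - {i})"
    have R: "N R < N (?t i)"
    proof (cases "{..?n} - {i} = {}")
      case True
      then have "N R = 0" unfolding R_def by (simp only: sum.empty zero)
      moreover have "N (?t i) * s ^ ?n > 0" using main pos by simp
      ultimately show ?thesis
        using s by (simp add: zero_less_mult_iff)
    next
      case False
      define M where "M = Max ((\<lambda>j. N (?t j)) ` ({..?n} - {i}))"
      have "M \<in> (\<lambda>j. N (?t j)) ` ({..?n} - {i})"
        unfolding M_def using False by (intro Max_in) auto
      then obtain j where j: "j \<le> ?n" "j \<noteq> i" "M = N (?t j)"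
        by auto
      have "N (?t j) * s ^ ?n < N (?t i) * s ^ ?n"
        using less j main by simp
      then have "M < N (?t i)"
        using s j by simp
      moreover have "N R \<le> M"
        unfolding R_def
      proof (rule sum_le)
        show "0 \<le> M" using j nonneg by simp
      qed (auto simp: M_def)
      ultimately show ?thesis by simp
    qed
    have "coeff (p * q) ?n = ?t i + R"
      unfolding coeff_mult R_def by (subst sum.remove[of _ i]) auto
    then have "N (coeff (p * q) ?n) = N (?t i)"
      using add_eq_left[OF R] by simp
    then have "?G = N (coeff (p * q) ?n) * s ^ ?n"
      using main by simp
    also have "\<dots> \<le> gauss N s (p * q)"
      by (rule coeff_le_gauss)
    finally show ?thesis .
  qed
qed

lemma mult_seminorm_gauss: "mult_seminorm (gauss N s)"
proof
  show "gauss N s 1 = 1"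
    using gauss_const[of 1] one by (simp add: one_pCons)
qed (simp_all add: gauss_nonneg gauss_add_le gauss_mult, simp add: gauss_def zero)

text \<open>
  Translations of the disc of radius \<open>s\<close> are isometries. Since the inverse of a translation is a
  translation, one inequality suffices.
\<close>

lemma gauss_pcompose_le:
  assumes "N c \<le> s"
  shows "gauss N s (pcompose P [:c, 1:]) \<le> gauss N s P"
proof -
  interpret G: mult_seminorm "gauss N s"
    by (rule mult_seminorm_gauss)
  have "pcompose P [:c, 1:] = (\<Sum>i\<le>degree (map_poly (\<lambda>a. [:a:]) P). coeff (map_poly (\<lambda>a. [:a:]) P) i * [:c, 1:] ^ i)"
    by (simp add: pcompose_altdef poly_altdef)
  also have "gauss N s \<dots> \<le> gauss N s P"
  proof (rule G.sum_le[OF G.nonneg])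
    fix i
    have "gauss N s (coeff (map_poly (\<lambda>a. [:a:]) P) i * [:c, 1:] ^ i) = N (coeff P i) * s ^ i"
      unfolding G.mult using assms by (simp add: G.power coeff_map_poly gauss_const gauss_monom_1 max_def)
    then show "gauss N s (coeff (map_poly (\<lambda>a. [:a:]) P) i * [:c, 1:] ^ i) \<le> gauss N s P"
      by (simp add: coeff_le_gauss)
  qed
  finally show ?thesis .
qed

end

end

subsection \<open>Multiplicative seminorms below a given seminorm\<close>

lemma le_mult_if_le_above:
  fixes a b c :: real
  assumes "\<And>s t. a < s \<Longrightarrow> b < t \<Longrightarrow> c \<le> s * t" "0 \<le> a" "0 \<le> b"
  shows "c \<le> a * b"
proof -
  have 1: "c \<le> a * t" if t: "b < t" for t
  proof -
    have "c / t \<le> a"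
    proof (rule dense_ge)
      fix s assume "a < s"
      then show "c / t \<le> s"
        using assms(1)[of s t] t assms(3) by (simp add: field_simps)
    qed
    then show ?thesis
      using t assms(3) by (simp add: field_simps)
  qed
  show ?thesis
  proof (cases "a = 0")
    case True
    then show ?thesis using 1[of "b + 1"] by simp
  next
    case False
    then have "0 < a" using assms by simp
    have "c / a \<le> b"
    proof (rule dense_ge)
      fix t assume "b < t"
      then show "c / a \<le> t"
        using 1[of t] \<open>0 < a\<close> by (simp add: field_simps)
    qed
    then show ?thesis
      using \<open>0 < a\<close> by (simp add: field_simps)
  qed
qed

lemma Inf_less_obtain:
  fixes X :: "real set"
  assumes "Inf X < s" "X \<noteq> {}" "\<And>x. x \<in> X \<Longrightarrow> 0 \<le> x"
  obtains x where "x \<in> X" "x < s"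
  using assms cInf_less_iff[of X s] by (auto simp: bdd_below_def)

lemma Inf_le_nonneg:
  fixes X :: "real set"
  assumes "x \<in> X" "\<And>x. x \<in> X \<Longrightarrow> 0 \<le> x"
  shows "Inf X \<le> x"
  using assms by (intro cInf_lower) (auto simp: bdd_below_def)

text \<open>
  The limit of the numbers \<open>N (a ^ i)\<close> to the power \<open>1/i\<close>. As the infimum of all exponential
  growth rates of \<open>N (a ^ i)\<close> it can be handled without roots.
\<close>

definition spectral :: "('b::comm_ring_1 \<Rightarrow> real) \<Rightarrow> 'b \<Rightarrow> real" where
  "spectral N a = Inf {s. 0 < s \<and> (\<exists>C>0. \<forall>i. N (a ^ i) \<le> C * s ^ i)}"

context ring_seminorm
begin

lemma spectral_le_self: "spectral N a \<le> N a"
proof (rule dense_ge)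
  fix s assume s: "N a < s"
  then have "0 < s" using nonneg[of a] by simp
  have "N (a ^ i) \<le> 1 * s ^ i" for i
    using power_le[of a i] power_mono[of "N a" s i] s nonneg[of a] by simp
  then have "s \<in> {s. 0 < s \<and> (\<exists>C>0. \<forall>i. N (a ^ i) \<le> C * s ^ i)}"
    using \<open>0 < s\<close> zero_less_one by blast
  then show "spectral N a \<le> s"
    unfolding spectral_def by (rule Inf_le_nonneg) auto
qed

lemma spectral_bound:
  assumes "spectral N a < s"
  obtains C where "0 < C" "0 < s" "\<And>i. N (a ^ i) \<le> C * s ^ i"
proof -
  let ?X = "{s. 0 < s \<and> (\<exists>C>0. \<forall>i. N (a ^ i) \<le> C * s ^ i)}"
  have "N a + 1 \<in> ?X"
  proof -
    have "N (a ^ i) \<le> 1 * (N a + 1) ^ i" for i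
      using power_le[of a i] power_mono[of "N a" "N a + 1" i] nonneg[of a] by simp
    then show ?thesis
      using nonneg[of a] zero_less_one by (force intro!: exI[of _ 1])
  qed
  then have "?X \<noteq> {}" by blast
  with assms obtain t where t: "t \<in> ?X" "t < s"
    unfolding spectral_def by (rule Inf_less_obtain) auto
  then obtain C where C: "0 < t" "0 < C" "\<And>i. N (a ^ i) \<le> C * t ^ i"
    by auto
  have "N (a ^ i) \<le> C * s ^ i" for i
  proof -
    have "C * t ^ i \<le> C * s ^ i"
      using C t by (intro mult_left_mono power_mono) auto
    then show ?thesis
      using C(3)[of i] by simp
  qed
  then show ?thesis
    using that C t by force
qed

lemma spectral_le:
  assumes "0 < s" "0 < C" "\<And>i. N (a ^ i) \<le> C * s ^ i"
  shows "spectral N a \<le> s"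
  unfolding spectral_def using assms by (intro Inf_le_nonneg) auto

lemma spectral_nonneg: "0 \<le> spectral N a"
proof (rule ccontr)
  assume "\<not> ?thesis"
  then obtain C :: real where "0 < C" "(0::real) < 0"
    using spectral_bound[of a 0] by force
  then show False by simp
qed

text \<open>
  If \<open>a^2\<close> has growth rate \<open>s\<close>, then \<open>a\<close> has growth rate \<open>sqrt s\<close>; the odd powers of \<open>a\<close> cost one
  more factor \<open>N a\<close>, which goes into the constant.
\<close>

lemma spectral_square_le: "spectral N a ^ 2 \<le> spectral N (a ^ 2)"
proof (rule dense_ge)
  fix s assume "spectral N (a ^ 2) < s"
  then obtain C where C: "0 < C" "0 < s" "\<And>i. N ((a ^ 2) ^ i) \<le> C * s ^ i"
    using spectral_bound by blast
  \<comment> \<open>even powers need the constant \<open>C\<close>, odd powers the constant \<open>N a * C / sqrt s\<close>\<close>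
  define K where "K = max C (N a * C / sqrt s)"
  have K: "C \<le> K" "N a * C / sqrt s \<le> K" "0 < K"
    using C by (auto simp: K_def)
  then have K': "N a * C \<le> K * sqrt s"
    using C by (simp add: field_simps)
  have "spectral N a \<le> sqrt s"
  proof (rule spectral_le)
    fix i :: nat
    have s_pow: "sqrt s ^ (2 * j) = s ^ j" for j
      using C by (simp add: power_mult)
    show "N (a ^ i) \<le> K * sqrt s ^ i"
    proof (cases "even i")
      case True
      then obtain j where j: "i = 2 * j" by blast
      have "N (a ^ i) \<le> C * s ^ j"
        using C(3)[of j] by (simp add: j power_mult)
      also have "\<dots> \<le> K * sqrt s ^ i"
        unfolding j s_pow using K C by (intro mult_right_mono) auto
      finally show ?thesis .
    next
      case False
      then obtain j where j: "i = Suc (2 * j)" by (metis oddE Suc_eq_plus1)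
      have "N (a ^ i) \<le> N a * N ((a ^ 2) ^ j)"
        using mult_le[of a "a ^ (2 * j)"] by (simp add: j power_mult)
      also have "\<dots> \<le> N a * (C * s ^ j)"
        using C(3) nonneg by (intro mult_left_mono) auto
      also have "\<dots> = (N a * C) * s ^ j"
        by simp
      also have "\<dots> \<le> (K * sqrt s) * s ^ j"
        using K' C by (intro mult_right_mono) auto
      also have "\<dots> = K * sqrt s ^ i"
        by (simp add: j s_pow)
      finally show ?thesis .
    qed
  qed (use C K in auto)
  then have "spectral N a ^ 2 \<le> sqrt s ^ 2"
    using spectral_nonneg by (intro power_mono) auto
  then show "spectral N a ^ 2 \<le> s"
    using C by simp
qed

lemma ring_seminorm_spectral: "ring_seminorm (spectral N)"
proof
  show "spectral N 0 = 0"
    using spectral_le_self[of 0] spectral_nonneg[of 0] zero by simp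
  show "spectral N 1 = 1"
  proof (rule antisym)
    show "spectral N 1 \<le> 1"
      using spectral_le_self[of 1] one by simp
    show "1 \<le> spectral N 1"
    proof (rule ccontr)
      assume "\<not> ?thesis"
      then obtain s where s: "spectral N 1 < s" "s < 1"
        using dense by (metis not_le)
      then obtain C where C: "0 < C" "0 < s" "\<And>i. N (1 ^ i) \<le> C * s ^ i"
        using spectral_bound by blast
      have "(\<lambda>i. C * s ^ i) \<longlonglongrightarrow> C * 0"
        using s C by (intro tendsto_intros LIMSEQ_power_zero) auto
      then have "eventually (\<lambda>i. C * s ^ i < 1) sequentially"
        by (intro order_tendstoD) auto
      then obtain i where "C * s ^ i < 1"
        using eventually_happens'[OF sequentially_bot] by blast
      then show False
        using C(3)[of i] one by simp
    qed
  qed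
  fix a b
  show "0 \<le> spectral N a"
    by (rule spectral_nonneg)
  show "spectral N (a + b) \<le> max (spectral N a) (spectral N b)"
  proof (rule dense_ge)
    fix s assume "max (spectral N a) (spectral N b) < s"
    then have "spectral N a < s" "spectral N b < s" by auto
    then obtain C C' where C: "0 < C" "0 < s" "\<And>i. N (a ^ i) \<le> C * s ^ i"
      and C': "0 < C'" "\<And>i. N (b ^ i) \<le> C' * s ^ i"
      using spectral_bound by metis
    show "spectral N (a + b) \<le> s"
    proof (rule spectral_le)
      fix n :: nat
      show "N ((a + b) ^ n) \<le> C * C' * s ^ n"
        unfolding binomial_ring
      proof (rule sum_le)
        fix i assume i: "i \<in> {..n}"
        have "N (of_nat (n choose i) * a ^ i * b ^ (n - i)) \<le> N (of_nat (n choose i) * a ^ i) * N (b ^ (n - i))"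
          by (rule mult_le)
        also have "\<dots> \<le> (1 * (C * s ^ i)) * (C' * s ^ (n - i))"
          using C C' nonneg
          by (intro mult_mono order_trans[OF mult_le] mult_mono of_nat_le) auto
        also have "\<dots> = C * C' * (s ^ i * s ^ (n - i))"
          by simp
        also have "s ^ i * s ^ (n - i) = s ^ n"
          using i by (simp flip: power_add)
        finally show "N (of_nat (n choose i) * a ^ i * b ^ (n - i)) \<le> C * C' * s ^ n" .
      qed (use C C' in auto)
    qed (use C C' in auto)
  qed
  show "spectral N (a * b) \<le> spectral N a * spectral N b"
  proof (rule le_mult_if_le_above)
    fix s t assume "spectral N a < s" "spectral N b < t"
    then obtain C C' where C: "0 < C" "0 < s" "\<And>i. N (a ^ i) \<le> C * s ^ i"
      and C': "0 < C'" "0 < t" "\<And>i. N (b ^ i) \<le> C' * t ^ i"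
      using spectral_bound by metis
    show "spectral N (a * b) \<le> s * t"
    proof (rule spectral_le)
      fix i
      have "N ((a * b) ^ i) \<le> N (a ^ i) * N (b ^ i)"
        by (simp add: power_mult_distrib mult_le)
      also have "\<dots> \<le> (C * s ^ i) * (C' * t ^ i)"
        using C C' nonneg by (intro mult_mono) auto
      finally show "N ((a * b) ^ i) \<le> C * C' * (s * t) ^ i"
        by (simp add: power_mult_distrib mult_ac)
    qed (use C C' in auto)
  qed (rule spectral_nonneg)+
qed

text \<open>
  A lower bound for the multiplication by \<open>t\<close> replaces the bound for the inverse of \<open>t\<close>, so that
  no localisation at \<open>t\<close> is needed to speak of seminorms on Laurent polynomials.
\<close>

lemma spectral_scale:
  assumes "0 < \<rho>" "\<And>a. \<rho> * N a \<le> N (t * a)"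
  shows "\<rho> * spectral N a \<le> spectral N (t * a)"
proof (rule dense_ge)
  fix s assume "spectral N (t * a) < s"
  then obtain C where C: "0 < C" "0 < s" "\<And>i. N ((t * a) ^ i) \<le> C * s ^ i"
    using spectral_bound by metis
  have iter: "\<rho> ^ i * N b \<le> N (t ^ i * b)" for i b
  proof (induction i)
    case (Suc i)
    have "\<rho> ^ Suc i * N b \<le> \<rho> * N (t ^ i * b)"
      using Suc assms(1) by simp
    also have "\<dots> \<le> N (t * (t ^ i * b))"
      by (rule assms)
    finally show ?case by (simp add: mult_ac)
  qed simp
  have "spectral N a \<le> s / \<rho>"
  proof (rule spectral_le)
    fix i
    have "\<rho> ^ i * N (a ^ i) \<le> C * s ^ i"
      using iter[of i "a ^ i"] C(3)[of i] by (simp add: power_mult_distrib)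
    then show "N (a ^ i) \<le> C * (s / \<rho>) ^ i"
      using assms(1) by (simp add: power_divide field_simps)
  qed (use C assms in auto)
  then show "\<rho> * spectral N a \<le> s"
    using assms(1) by (simp add: field_simps)
qed

end

text \<open>
  The quotients decrease with \<open>k\<close>, so the infimum is their limit. The smoothing lies below \<open>N\<close>,
  and multiplication by \<open>f\<close> scales it by exactly \<open>N f\<close> if \<open>N\<close> is multiplicative on the powers of
  \<open>f\<close>; a seminorm equal to all its smoothings is multiplicative.
\<close>

definition smoothing :: "('b::comm_ring_1 \<Rightarrow> real) \<Rightarrow> 'b \<Rightarrow> 'b \<Rightarrow> real" where
  "smoothing N f a = Inf (range (\<lambda>k. N (a * f ^ k) / N f ^ k))"

context ring_seminorm
begin

context
  fixes f
  assumes pos: "0 < N f" and power: "\<And>k. N (f ^ k) = N f ^ k"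
begin

lemma smoothing_le: "smoothing N f a \<le> N (a * f ^ k) / N f ^ k"
  unfolding smoothing_def using pos nonneg by (intro Inf_le_nonneg) auto

lemma smoothing_bound:
  assumes "smoothing N f a < s"
  obtains k where "\<And>j. k \<le> j \<Longrightarrow> N (a * f ^ j) / N f ^ j < s"
proof -
  obtain k where k: "N (a * f ^ k) / N f ^ k < s"
    using Inf_less_obtain[OF assms[unfolded smoothing_def]] pos nonneg
    by (metis (no_types, lifting) UNIV_not_empty empty_is_image rangeE zero_le_divide_iff zero_le_power less_imp_le)
  have "N (a * f ^ j) / N f ^ j < s" if "k \<le> j" for j
    using that
  proof (induction j rule: dec_induct)
    case base
    show ?case by (fact k)
  next
    case (step j)
    have "N (a * f ^ Suc j) \<le> N (a * f ^ j) * N f"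
      using mult_le[of "a * f ^ j" f] by (simp add: mult_ac)
    then have "N (a * f ^ Suc j) / N f ^ Suc j \<le> N (a * f ^ j) / N f ^ j"
      using pos by (simp add: field_simps)
    then show ?case using step by simp
  qed
  then show ?thesis using that by blast
qed

lemma smoothing_nonneg: "0 \<le> smoothing N f a"
  unfolding smoothing_def using pos nonneg by (intro cInf_greatest) auto

lemma ring_seminorm_smoothing: "ring_seminorm (smoothing N f)"
proof
  show "smoothing N f 0 = 0"
    by (simp add: smoothing_def zero)
  show "smoothing N f 1 = 1"
    using pos by (simp add: smoothing_def power)
  fix a b
  show "0 \<le> smoothing N f a"
    by (rule smoothing_nonneg)
  show "smoothing N f (a + b) \<le> max (smoothing N f a) (smoothing N f b)"
  proof (rule dense_ge)
    fix s assume "max (smoothing N f a) (smoothing N f b) < s"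
    then have "smoothing N f a < s" "smoothing N f b < s" by auto
    then obtain k l where kl: "\<And>j. k \<le> j \<Longrightarrow> N (a * f ^ j) / N f ^ j < s"
      "\<And>j. l \<le> j \<Longrightarrow> N (b * f ^ j) / N f ^ j < s"
      using smoothing_bound by metis
    let ?j = "max k l"
    have "N ((a + b) * f ^ ?j) \<le> max (N (a * f ^ ?j)) (N (b * f ^ ?j))"
      using add_le by (simp add: distrib_right)
    also have "\<dots> \<le> s * N f ^ ?j"
      using kl(1)[of ?j] kl(2)[of ?j] pos by (simp add: field_simps)
    finally have "N ((a + b) * f ^ ?j) / N f ^ ?j \<le> s"
      using pos by (simp add: field_simps)
    then show "smoothing N f (a + b) \<le> s"
      using smoothing_le[of "a + b" ?j] by simp
  qed
  show "smoothing N f (a * b) \<le> smoothing N f a * smoothing N f b"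
  proof (rule le_mult_if_le_above)
    fix s t assume "smoothing N f a < s" "smoothing N f b < t"
    then obtain k l where kl: "N (a * f ^ k) / N f ^ k < s" "N (b * f ^ l) / N f ^ l < t"
      using smoothing_bound by (metis order_refl)
    have "smoothing N f (a * b) \<le> N (a * b * f ^ (k + l)) / N f ^ (k + l)"
      by (rule smoothing_le)
    also have "\<dots> \<le> (N (a * f ^ k) * N (b * f ^ l)) / N f ^ (k + l)"
      using mult_le[of "a * f ^ k" "b * f ^ l"] pos
      by (intro divide_right_mono) (auto simp: power_add mult_ac)
    also have "\<dots> = (N (a * f ^ k) / N f ^ k) * (N (b * f ^ l) / N f ^ l)"
      by (simp add: power_add)
    also have "\<dots> \<le> s * t"
    proof (rule mult_mono)
      show "0 \<le> s" "0 \<le> N (b * f ^ l) / N f ^ l"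
        using kl nonneg pos by (auto intro: order_trans[OF divide_nonneg_nonneg less_imp_le[OF kl(1)]])
    qed (use kl in auto)
    finally show "smoothing N f (a * b) \<le> s * t" .
  qed (rule smoothing_nonneg)+
qed

lemma smoothing_scale:
  assumes "0 < \<rho>" "\<And>a. \<rho> * N a \<le> N (t * a)"
  shows "\<rho> * smoothing N f a \<le> smoothing N f (t * a)"
proof (rule dense_ge)
  fix s assume "smoothing N f (t * a) < s"
  then obtain k where k: "N (t * a * f ^ k) / N f ^ k < s"
    using smoothing_bound by (metis order_refl)
  have "\<rho> * smoothing N f a \<le> \<rho> * (N (a * f ^ k) / N f ^ k)"
    using smoothing_le assms(1) by (intro mult_left_mono) auto
  also have "\<dots> \<le> N (t * (a * f ^ k)) / N f ^ k"
    using assms(2)[of "a * f ^ k"] pos by (simp add: field_simps)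
  finally show "\<rho> * smoothing N f a \<le> s"
    using k by (simp add: mult_ac)
qed

end

text \<open>
  The seminorms below \<open>N\<close> with the same lower bound for the multiplication by \<open>t\<close> have a minimal
  element, by Zorn's lemma. It equals its spectral seminorm, so it is power-multiplicative; hence
  its smoothings are seminorms, and it equals these as well, which makes it multiplicative.
\<close>

lemma exists_mult_seminorm_below:
  assumes \<rho>: "0 < \<rho>" "\<And>a. \<rho> * N a \<le> N (t * a)"
  obtains x where "mult_seminorm x" "\<And>a. x a \<le> N a" "\<And>a. \<rho> * x a \<le> x (t * a)"
proof -
  define S where "S = {M. ring_seminorm M \<and> (\<forall>a. M a \<le> N a) \<and> (\<forall>a. \<rho> * M a \<le> M (t * a))}"
  define P where "P = (\<lambda>(M :: 'b \<Rightarrow> real) M'. M' \<le> M)"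
  have "\<exists>M\<in>S. \<forall>M'\<in>S. P M M' \<longrightarrow> M' = M"
  proof (rule predicate_Zorn)
    show "partial_order_on S (relation_of P S)"
      by (rule partial_order_on_relation_ofI) (auto simp: P_def)
    fix C assume "C \<in> Chains (relation_of P S)"
    then have C: "C \<subseteq> S" and chain: "\<And>M M'. M \<in> C \<Longrightarrow> M' \<in> C \<Longrightarrow> M \<le> M' \<or> M' \<le> M"
      by (auto simp: Chains_def relation_of_def P_def)
    show "\<exists>u\<in>S. \<forall>M\<in>C. P M u"
    proof (cases "C = {}")
      case True
      have "N \<in> S"
        using \<rho> ring_seminorm_axioms by (auto simp: S_def)
      then show ?thesis using True by auto
    next
      case False
      \<comment> \<open>the infimum of a chain of seminorms is a seminorm, as finitely many strict upper bounds
        are shared by one member\<close>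
      define u where "u = (\<lambda>a. Inf ((\<lambda>M. M a) ` C))"
      have SC: "ring_seminorm M" "M a \<le> N a" "\<rho> * M a \<le> M (t * a)" if "M \<in> C" for M a
        using C that by (auto simp: S_def)
      have nn: "0 \<le> M a" if "M \<in> C" for M a
        using SC(1)[OF that] by (rule ring_seminorm.nonneg)
      have u_le: "u a \<le> M a" if "M \<in> C" for M a
        unfolding u_def using that nn by (intro Inf_le_nonneg) auto
      have u_obtain: "\<exists>M\<in>C. M a < s" if "u a < s" for a s
        using Inf_less_obtain[OF that[unfolded u_def]] False nn by blast
      have u_nonneg: "0 \<le> u a" for a
        unfolding u_def using False nn by (intro cInf_greatest) auto
      have u_const: "u a = c" if "\<And>M. M \<in> C \<Longrightarrow> M a = c" for a c
      proof -
        have "(\<lambda>M. M a) ` C = {c}"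
          using False that by auto
        then show ?thesis by (simp add: u_def)
      qed
      have common: "\<exists>M\<in>C. M a < s \<and> M b < s'" if ab: "u a < s" "u b < s'" for a b s s'
      proof -
        obtain M M' where M: "M \<in> C" "M a < s" "M' \<in> C" "M' b < s'"
          using ab u_obtain by blast
        then consider "M \<le> M'" | "M' \<le> M" using chain by blast
        then show ?thesis
          using M by cases (meson le_funD order_le_less_trans)+
      qed
      have "ring_seminorm u"
      proof
        show "u 0 = 0" "u 1 = 1"
          using SC(1) by (auto intro!: u_const simp: ring_seminorm.zero ring_seminorm.one)
        fix a b
        show "0 \<le> u a" by (rule u_nonneg)
        show "u (a + b) \<le> max (u a) (u b)"
        proof (rule dense_ge)
          fix s assume "max (u a) (u b) < s"
          then obtain M where M: "M \<in> C" "M a < s" "M b < s"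
            using common[of a s b s] by auto
          then have "M (a + b) \<le> s"
            using ring_seminorm.add_le[OF SC(1)[OF M(1)], of a b] by simp
          then show "u (a + b) \<le> s"
            using u_le[OF M(1), of "a + b"] by simp
        qed
        show "u (a * b) \<le> u a * u b"
        proof (rule le_mult_if_le_above)
          fix s s' assume "u a < s" "u b < s'"
          then obtain M where M: "M \<in> C" "M a < s" "M b < s'"
            using common by blast
          have "M (a * b) \<le> M a * M b"
            using ring_seminorm.mult_le[OF SC(1)[OF M(1)]] by simp
          also have "\<dots> \<le> s * s'"
            using M nn[OF M(1), of a] nn[OF M(1), of b] by (intro mult_mono) auto
          finally show "u (a * b) \<le> s * s'"
            using u_le[OF M(1), of "a * b"] by simp
        qed (rule u_nonneg)+
      qed
      moreover have "u a \<le> N a" for a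
        using False SC(2) u_le by (meson all_not_in_conv order_trans)
      moreover have "\<rho> * u a \<le> u (t * a)" for a
      proof (rule dense_ge)
        fix s assume "u (t * a) < s"
        then obtain M where M: "M \<in> C" "M (t * a) < s"
          using u_obtain by blast
        have "\<rho> * u a \<le> \<rho> * M a"
          using u_le M \<rho> by (simp add: mult_left_mono)
        then show "\<rho> * u a \<le> s"
          using SC(3)[OF M(1), of a] M by simp
      qed
      ultimately have "u \<in> S" by (simp add: S_def)
      then show ?thesis
        using u_le by (auto simp: P_def le_fun_def)
    qed
  qed
  then obtain x where x: "x \<in> S" and minimal: "\<And>M. M \<in> S \<Longrightarrow> M \<le> x \<Longrightarrow> M = x"
    by (auto simp: P_def)
  interpret x: ring_seminorm x
    using x by (simp add: S_def)
  have x_le: "x a \<le> N a" and x_scale: "\<rho> * x a \<le> x (t * a)" for a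
    using x by (auto simp: S_def)
  have "spectral x \<in> S"
    using x.ring_seminorm_spectral x.spectral_scale[OF \<rho>(1) x_scale] x.spectral_le_self x_le
    by (auto simp: S_def intro: order_trans)
  then have spec: "spectral x = x"
    using minimal x.spectral_le_self by (auto simp: le_fun_def)
  have square: "x a ^ 2 = x (a ^ 2)" for a
    using x.spectral_square_le[of a] x.power_le[of a 2] spec by simp
  have pow2: "x (a ^ (2 ^ k)) = x a ^ (2 ^ k)" for a k
  proof (induction k)
    case (Suc k)
    have "x (a ^ (2 ^ Suc k)) = x ((a ^ (2 ^ k)) ^ 2)"
      by (simp add: power_mult mult.commute flip: power_mult)
    also have "\<dots> = (x a ^ (2 ^ k)) ^ 2"
      by (simp add: Suc flip: square)
    also have "\<dots> = x a ^ (2 ^ Suc k)"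
      by (simp add: mult.commute flip: power_mult)
    finally show ?case .
  qed simp
  \<comment> \<open>between two powers of 2 divide by the missing factor\<close>
  have power: "x (a ^ k) = x a ^ k" if pos: "0 < x a" for a k
  proof (rule antisym[OF x.power_le])
    have k: "k \<le> 2 ^ k"
      by (simp add: less_imp_le)
    have "x a ^ (k + (2 ^ k - k)) = x (a ^ (k + (2 ^ k - k)))"
      using pow2[of a k] k by simp
    also have "\<dots> \<le> x (a ^ k) * x (a ^ (2 ^ k - k))"
      unfolding power_add by (rule x.mult_le)
    also have "\<dots> \<le> x (a ^ k) * x a ^ (2 ^ k - k)"
      using x.power_le x.nonneg by (intro mult_left_mono) auto
    finally have "x a ^ k * x a ^ (2 ^ k - k) \<le> x (a ^ k) * x a ^ (2 ^ k - k)"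
      by (simp only: power_add)
    then show "x a ^ k \<le> x (a ^ k)"
      using pos by (simp add: mult_right_le_imp_le)
  qed
  have smooth: "smoothing x f = x" if pos: "0 < x f" for f
  proof -
    have le: "smoothing x f a \<le> x a" for a
      using x.smoothing_le[OF pos power[OF pos], of a 0] by simp
    then have "smoothing x f \<in> S"
      using x.ring_seminorm_smoothing[OF pos power[OF pos]]
        x.smoothing_scale[OF pos power[OF pos] \<rho>(1) x_scale] x_le
      by (auto simp: S_def intro: order_trans)
    then show ?thesis
      using minimal le by (auto simp: le_fun_def)
  qed
  have "mult_seminorm x"
  proof
    fix a b
    show "x (a * b) = x a * x b"
    proof (rule antisym[OF x.mult_le])
      show "x a * x b \<le> x (a * b)"
      proof (cases "x b = 0")
        case True
        then show ?thesis by (simp add: x.nonneg)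
      next
        case False
        then have pos: "0 < x b" using x.nonneg[of b] by simp
        have "x a \<le> x (a * b ^ 1) / x b ^ 1"
          using x.smoothing_le[OF pos power[OF pos], of a 1] smooth[OF pos] by simp
        then show ?thesis
          using pos by (simp add: field_simps)
      qed
    qed
  qed (simp_all add: x.nonneg x.zero x.one x.add_le)
  then show ?thesis
    using that x_le x_scale by blast
qed

end

section \<open>Points of the affine line\<close>

text \<open>
  The expansion of \<open>p (T + U)\<close> as a polynomial in \<open>U\<close> with coefficients in polynomials in \<open>T\<close>: its
  coefficients are the divided derivatives of \<open>p\<close>, which make sense in every characteristic.
\<close>

definition taylor :: "'b::comm_ring_1 poly \<Rightarrow> 'b poly poly" where
  "taylor p = pcompose (map_poly (\<lambda>c. [:c:]) p) [:[:0, 1:], 1:]"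

lemma map_poly_const_add: "map_poly (\<lambda>c. [:c:]) (p + q :: 'b::comm_ring_1 poly) = map_poly (\<lambda>c. [:c:]) p + map_poly (\<lambda>c. [:c:]) q"
  by (rule poly_eqI) (simp add: coeff_map_poly)

lemma map_poly_const_mult:
  "map_poly (\<lambda>c. [:c:]) (p * q) = map_poly (\<lambda>c. [:c:]) p * map_poly (\<lambda>c. [:c:]) (q :: 'b::comm_ring_1 poly)"
proof (rule poly_eqI)
  have sum: "[:sum f A:] = (\<Sum>i\<in>A. [:f i:])" for f :: "nat \<Rightarrow> 'b" and A
  proof (induction A rule: infinite_finite_induct)
    case (insert i A)
    have "[:sum f (insert i A):] = [:f i:] + [:sum f A:]"
      using insert.hyps by simp
    then show ?case
      using insert by simp
  qed auto
  fix n
  show "coeff (map_poly (\<lambda>c. [:c:]) (p * q)) n = coeff (map_poly (\<lambda>c. [:c:]) p * map_poly (\<lambda>c. [:c:]) q) n"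
    by (simp add: coeff_map_poly coeff_mult sum mult.commute)
qed

lemma taylor_add: "taylor (p + q) = taylor p + taylor q"
  by (simp add: taylor_def map_poly_const_add pcompose_add)

lemma taylor_mult: "taylor (p * q) = taylor p * taylor q"
  by (simp add: taylor_def map_poly_const_mult pcompose_mult)

lemma taylor_const: "taylor [:c:] = [:[:c:]:]"
  by (simp add: taylor_def map_poly_pCons)

lemma taylor_0 [simp]: "taylor 0 = 0"
  by (simp add: taylor_def)

lemma taylor_T: "taylor [:0, 1:] = [:[:0, 1:], 1:]"
  by (simp add: taylor_def map_poly_pCons pcompose_pCons)

lemma degree_taylor: "degree (taylor p) \<le> degree p"
proof -
  have "degree (map_poly (\<lambda>c. [:c:]) p) \<le> degree p"
    by (subst degree_map_poly) auto
  moreover have "degree (taylor p) \<le> degree (map_poly (\<lambda>c. [:c:]) p) * degree [:[:0, 1:], 1 :: 'a poly:]"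
    unfolding taylor_def by (rule degree_pcompose_le)
  ultimately show ?thesis by simp
qed

lemma coeff_taylor_0: "coeff (taylor p) 0 = p"
proof -
  have "poly (map_poly (\<lambda>c. [:c:]) p) [:0, 1:] = p"
    by (induction p) (simp_all add: map_poly_pCons)
  then show ?thesis
    by (simp add: taylor_def poly_pcompose flip: poly_0_coeff_0)
qed

lemma taylor_inverse: "pcompose (taylor p) [:- [:0, 1:], 1:] = map_poly (\<lambda>c. [:c:]) p"
  unfolding taylor_def pcompose_assoc[symmetric] by (simp add: pcompose_pCons pcompose_idR)

locale valued_field =
  fixes v :: "'a::field \<Rightarrow> real"
  assumes complete_nonarch: "complete_nonarch_field v"
begin

sublocale mult_seminorm v
proof
  fix a b
  show "0 \<le> v a" "v 0 = 0" "v (a * b) = v a * v b" "v (a + b) \<le> max (v a) (v b)"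
    using complete_nonarch unfolding complete_nonarch_field_def by auto
  have "v 1 * v 1 = v (1 * 1)" "v 1 \<noteq> 0"
    using complete_nonarch unfolding complete_nonarch_field_def by (metis, metis one_neq_zero)
  then show "v 1 = 1" by simp
qed

lemma v_eq_0_iff: "v a = 0 \<longleftrightarrow> a = 0"
  using complete_nonarch by (simp add: complete_nonarch_field_def)

lemma v_pos_iff: "0 < v a \<longleftrightarrow> a \<noteq> 0"
  using v_eq_0_iff[of a] nonneg[of a] by auto

lemma v_inverse: "v (inverse a) = inverse (v a)"
proof (cases "a = 0")
  case False
  then have "v a * v (inverse a) = 1"
    by (simp add: one flip: mult)
  then show ?thesis
    by (metis inverse_unique)
qed (simp add: zero)

lemma v_complete:
  assumes "\<And>e. 0 < e \<Longrightarrow> \<exists>N. \<forall>m\<ge>N. \<forall>n\<ge>N. v (s m - s n) < e"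
  obtains l where "(\<lambda>n. v (s n - l)) \<longlonglongrightarrow> 0"
proof -
  have "\<forall>s :: nat \<Rightarrow> 'a. (\<forall>e>0. \<exists>N. \<forall>m\<ge>N. \<forall>n\<ge>N. v (s m - s n) < e) \<longrightarrow> (\<exists>l. (\<lambda>n. v (s n - l)) \<longlonglongrightarrow> 0)"
    using complete_nonarch unfolding complete_nonarch_field_def by blast
  then have "\<exists>l. (\<lambda>n. v (s n - l)) \<longlonglongrightarrow> 0"
    using assms by simp
  then show ?thesis using that by blast
qed

abbreviation "T \<equiv> [:0, 1:] :: 'a poly"

lemma affine_lineI:
  assumes "mult_seminorm x" "\<And>c. x [:c:] = v c"
  shows "x \<in> affine_line v"
proof -
  interpret mult_seminorm x by fact
  show ?thesis
    using assms nonneg mult add_le by (simp add: affine_line_def)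
qed

lemma affine_line_const: "x \<in> affine_line v \<Longrightarrow> x [:c:] = v c"
  by (simp add: affine_line_def)

lemma affine_line_seminorm: "x \<in> affine_line v \<Longrightarrow> mult_seminorm x"
  by unfold_locales
    (auto simp: affine_line_def one_pCons, metis pCons_0_0 zero, metis one one_pCons)

lemma origin_in_affine_line: "origin v \<in> affine_line v"
  by (simp add: affine_line_def origin_def nonneg mult add_le)

lemma poly_bound:
  assumes x: "x \<in> affine_line v" and B: "0 \<le> B" "\<And>i. v (coeff p i) * x T ^ i \<le> B"
  shows "x p \<le> B"
proof -
  interpret x: mult_seminorm x
    using x by (rule affine_line_seminorm)
  have "p = (\<Sum>i\<le>degree p. monom (coeff p i) i)"
    by (simp add: poly_as_sum_of_monoms)
  moreover have "x (\<Sum>i\<le>degree p. monom (coeff p i) i) \<le> B"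
  proof (rule x.sum_le[OF B(1)])
    fix i
    have "monom (coeff p i) i = [:coeff p i:] * T ^ i"
      by (simp add: monom_altdef)
    then have "x (monom (coeff p i) i) = v (coeff p i) * x T ^ i"
      by (simp only: x.mult x.power affine_line_const[OF x])
    then show "x (monom (coeff p i) i) \<le> B"
      using B(2) by simp
  qed
  ultimately show ?thesis by simp
qed

lemma poly_le_gauss:
  assumes x: "x \<in> affine_line v" and s: "0 < s" "x T \<le> s"
  shows "x p \<le> gauss v s p"
proof (rule poly_bound[OF x gauss_nonneg[OF s(1)]])
  fix i
  have "0 \<le> x T"
    using x by (simp add: affine_line_def)
  then have "v (coeff p i) * x T ^ i \<le> v (coeff p i) * s ^ i"
    using s nonneg by (intro mult_left_mono power_mono) auto
  then show "v (coeff p i) * x T ^ i \<le> gauss v s p"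
    using coeff_le_gauss[OF s(1), of p i] by simp
qed

lemma gauss_in_affine_line: "0 < s \<Longrightarrow> gauss v s \<in> affine_line v"
  by (intro affine_lineI mult_seminorm_gauss gauss_const)

lemma gauss_T: "0 < s \<Longrightarrow> gauss v s T = s"
  using gauss_monom_1[of s 0] by (simp add: zero)

text \<open>
  The Gauss point of radius \<open>s\<close> centred at \<open>x\<close>: the value is the maximum of the norms of the terms
  of the Taylor expansion at \<open>x\<close>. As \<open>s\<close> grows from 0 these points form the path that leads from
  \<open>x\<close> towards the Gauss points centred at the origin.
\<close>

definition move :: "'a point \<Rightarrow> real \<Rightarrow> 'a point" where
  "move x s p = gauss x s (taylor p)"

context
  fixes x :: "'a point" and s :: real
  assumes x: "x \<in> affine_line v" and s: "0 < s"
begin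

interpretation x: mult_seminorm x
  using x by (rule affine_line_seminorm)

interpretation g: mult_seminorm "gauss x s"
  using s by (rule x.mult_seminorm_gauss)

lemma move_in_affine_line: "move x s \<in> affine_line v"
proof (rule affine_lineI)
  show "mult_seminorm (move x s)"
  proof
    show "move x s 1 = 1"
    proof -
      have "move x s [:1:] = 1"
        unfolding move_def taylor_const x.gauss_const[OF s] affine_line_const[OF x] by (rule one)
      then show ?thesis by (simp only: one_pCons)
    qed
  qed (auto simp: move_def g.nonneg g.zero taylor_add g.add_le taylor_mult g.mult)
qed (simp add: move_def taylor_const x.gauss_const[OF s] affine_line_const[OF x])

lemma move_T: "move x s T = max (x T) s"
  by (simp add: move_def taylor_T x.gauss_monom_1[OF s])

lemma move_ge: "x p \<le> move x s p"
  using x.coeff_le_gauss[OF s, of "taylor p" 0] by (simp add: move_def coeff_taylor_0)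

text \<open>
  A disc of radius \<open>s\<close> around \<open>x\<close> which contains the origin is the disc of radius \<open>s\<close> around the
  origin.
\<close>

lemma move_max:
  assumes "x T \<le> s"
  shows "move x s = gauss v s"
proof
  fix p
  show "move x s p = gauss v s p"
  proof (rule antisym)
    show "move x s p \<le> gauss v s p"
      using assms by (intro poly_le_gauss move_in_affine_line s) (simp add: move_T)
    \<comment> \<open>the Taylor expansion followed by the translation by \<open>-T\<close> returns \<open>p\<close>, and \<open>T\<close> has norm at
      most \<open>s\<close> at \<open>x\<close>\<close>
    have "gauss v s p \<le> gauss x s (map_poly (\<lambda>c. [:c:]) p)"
    proof (rule gauss_le[OF s])
      fix i
      show "v (coeff p i) * s ^ i \<le> gauss x s (map_poly (\<lambda>c. [:c:]) p)"
        using x.coeff_le_gauss[OF s, of "map_poly (\<lambda>c. [:c:]) p" i]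
        by (simp add: coeff_map_poly affine_line_const[OF x])
    qed
    also have "\<dots> \<le> move x s p"
      unfolding move_def taylor_inverse[symmetric]
      using assms by (intro x.gauss_pcompose_le s) (simp only: x.minus)
    finally show "gauss v s p \<le> move x s p" .
  qed
qed

end

text \<open>
  Only the terms of positive degree of the Taylor expansion involve \<open>s\<close>; they are finitely many
  and tend to 0 with \<open>s\<close>.
\<close>

lemma move_small:
  assumes x: "x \<in> affine_line v" and B: "0 < B" "x p \<le> B"
  shows "\<exists>s0>0. \<forall>s. 0 < s \<and> s \<le> s0 \<longrightarrow> move x s p \<le> B"
proof -
  interpret x: mult_seminorm x
    using x by (rule affine_line_seminorm)
  have "\<exists>s0>0. \<forall>s. 0 < s \<and> s \<le> s0 \<longrightarrow> x (coeff (taylor p) i) * s ^ i \<le> B" for i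
  proof (cases "i = 0")
    case True
    then show ?thesis
      using B by (intro exI[of _ 1]) (simp add: coeff_taylor_0)
  next
    case False
    have "((\<lambda>s. x (coeff (taylor p) i) * s ^ i) \<longlongrightarrow> x (coeff (taylor p) i) * 0 ^ i) (at_right 0)"
      by (intro tendsto_intros)
    moreover have "x (coeff (taylor p) i) * 0 ^ i < B"
      using False B by (simp add: zero_power)
    ultimately have "\<forall>\<^sub>F s in at_right 0. x (coeff (taylor p) i) * s ^ i < B"
      by (rule order_tendstoD)
    then obtain b where b: "0 < b" "\<And>s. 0 < s \<Longrightarrow> s < b \<Longrightarrow> x (coeff (taylor p) i) * s ^ i < B"
      unfolding eventually_at_right_field by blast
    then show ?thesis
      by (intro exI[of _ "b / 2"]) (auto intro!: less_imp_le)
  qed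
  then obtain s0 where s0: "\<And>i. 0 < s0 i"
    "\<And>i s. 0 < s \<Longrightarrow> s \<le> s0 i \<Longrightarrow> x (coeff (taylor p) i) * s ^ i \<le> B"
    by metis
  define m where "m = Min (s0 ` {..degree (taylor p)})"
  have "0 < m"
    unfolding m_def using s0(1) by (subst Min_gr_iff) auto
  moreover have "move x s p \<le> B" if s: "0 < s" "s \<le> m" for s
  proof -
    obtain i where i: "i \<le> degree (taylor p)" "gauss x s (taylor p) = x (coeff (taylor p) i) * s ^ i"
      using x.gauss_attained[OF s(1)] by metis
    have "m \<le> s0 i"
      unfolding m_def using i by (intro Min_le) auto
    then show ?thesis
      using s0(2)[of s i] s i by (simp add: move_def)
  qed
  ultimately show ?thesis by blast
qed

lemma move_small_eq:
  assumes x: "x \<in> affine_line v" and p: "x p \<noteq> 0"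
  shows "\<exists>s0>0. \<forall>s. 0 < s \<and> s \<le> s0 \<longrightarrow> move x s p = x p"
proof -
  have "0 \<le> x p"
    using x by (simp add: affine_line_def)
  then obtain s0 where "0 < s0" "\<And>s. 0 < s \<Longrightarrow> s \<le> s0 \<Longrightarrow> move x s p \<le> x p"
    using move_small[OF x, of "x p" p] p by force
  then show ?thesis
    using move_ge[OF x] by (intro exI[of _ s0]) (auto intro: antisym)
qed

text \<open>
  At radius \<open>r\<close> the maximum is attained by a Taylor term of index at most \<open>m\<close>, because the terms
  of larger index belong to \<open>p - q\<close>, which is too small. When the radius shrinks from \<open>r\<close> to \<open>s\<close>,
  this term loses at most the factor \<open>(s/r)^m\<close>. The bound depends on \<open>p\<close> only through its norm and
  the degree of an approximation, so it passes to power series.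
\<close>

lemma move_lower_bound:
  assumes x: "x \<in> affine_line v" and s: "0 < s" "s \<le> r" and r: "x T \<le> r"
    and close: "gauss v r (p - q) < gauss v r p" and q: "degree q \<le> m"
  shows "gauss v r p * (s / r) ^ m \<le> move x s p"
proof -
  interpret x: mult_seminorm x
    using x by (rule affine_line_seminorm)
  have r0: "0 < r" using s by simp
  obtain i where i: "gauss x r (taylor p) = x (coeff (taylor p) i) * r ^ i"
    using x.gauss_attained[OF r0] by metis
  have eq: "gauss x r (taylor p') = gauss v r p'" for p'
    using move_max[OF x r0 r] by (metis move_def)
  have "i \<le> m"
  proof (rule ccontr)
    assume "\<not> i \<le> m"
    then have "coeff (taylor q) i = 0"
      using degree_taylor[of q] q by (intro coeff_eq_0) simp
    then have "coeff (taylor (p - q)) i = coeff (taylor p) i"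
      using taylor_add[of "p - q" q] by simp
    then have "gauss v r p \<le> gauss v r (p - q)"
      using x.coeff_le_gauss[OF r0, of "taylor (p - q)" i] i by (simp add: eq)
    then show False using close by simp
  qed
  have "gauss v r p * (s / r) ^ m \<le> gauss v r p * (s / r) ^ i"
    using \<open>i \<le> m\<close> s r0 gauss_nonneg[OF r0] by (intro mult_left_mono power_decreasing) auto
  also have "\<dots> = x (coeff (taylor p) i) * s ^ i"
    using i r0 by (simp add: eq power_divide)
  also have "\<dots> \<le> move x s p"
    unfolding move_def by (rule x.coeff_le_gauss[OF s(1)])
  finally show ?thesis .
qed

section \<open>Discs and affinoid domains\<close>

lemma closed_disc_mono: "r \<le> r' \<Longrightarrow> closed_disc v r \<subseteq> closed_disc v r'"
  by (auto simp: closed_disc_def)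

lemma closed_disc_affine: "closed_disc v r \<subseteq> affine_line v"
  by (auto simp: closed_disc_def)

lemma affinoid_subset_affine: "affinoid v V \<Longrightarrow> V \<subseteq> affine_line v"
  by (auto simp: affinoid_def closed_disc_def)

lemma continuous_on_eval: "continuous_on A (\<lambda>x :: 'a point. x p)"
  by (rule continuous_on_subset[OF continuous_on_product_coordinates]) auto

lemma closed_affine_line: "closed (affine_line v)"
proof -
  have eq: "affine_line v =
      (\<Inter>p. {x. 0 \<le> x p}) \<inter> (\<Inter>c. {x. x [:c:] = v c}) \<inter>
      (\<Inter>p. \<Inter>q. {x. x (p * q) = x p * x q}) \<inter> (\<Inter>p. \<Inter>q. {x. x (p + q) \<le> max (x p) (x q)})"
    by (auto simp: affine_line_def)
  show ?thesis
    unfolding eq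
    by (intro closed_Int closed_INT ballI closed_Collect_le closed_Collect_eq continuous_intros
        continuous_on_eval)
qed

text \<open>
  The bound by the Gauss norm embeds the disc as a closed subset of a product of compact
  intervals.
\<close>

lemma compact_closed_disc:
  assumes "0 < r"
  shows "compact (closed_disc v r)"
proof -
  let ?K = "\<Pi>\<^sub>E p\<in>UNIV. {0..gauss v r p}"
  have "compactin (product_topology (\<lambda>_. euclidean) UNIV) ?K"
    by (subst compactin_PiE) auto
  then have "compact ?K"
    by (simp add: euclidean_product_topology)
  moreover have "closed (closed_disc v r)"
  proof -
    have "closed_disc v r = affine_line v \<inter> {x. x T \<le> r}"
      by (auto simp: closed_disc_def)
    then show ?thesis
      by (auto intro!: closed_Int closed_affine_line closed_Collect_le continuous_intros continuous_on_eval)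
  qed
  moreover have "closed_disc v r \<subseteq> ?K"
    using poly_le_gauss[OF _ assms] by (auto simp: closed_disc_def affine_line_def)
  ultimately show ?thesis
    using compact_Int_closed[of ?K "closed_disc v r"] by (simp add: Int_absorb1)
qed

lemma compact_affinoid:
  assumes "affinoid v V"
  shows "compact V"
proof -
  obtain r g F where V: "0 < r" "finite F" "V = {x \<in> closed_disc v r. \<forall>(p, c)\<in>F. x p \<le> c * x g}"
    using assms unfolding affinoid_def by blast
  have "V = closed_disc v r \<inter> (\<Inter>(p, c)\<in>F. {x. x p \<le> c * x g})"
    using V by auto
  moreover have "closed (\<Inter>(p, c)\<in>F. {x. x p \<le> c * x g})"
    by (auto intro!: closed_INT closed_Collect_le continuous_intros continuous_on_eval split: prod.split)
  ultimately show ?thesis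
    using compact_Int_closed[OF compact_closed_disc[OF V(1)]] by simp
qed

lemma affinoid_closed_disc: "0 < r \<Longrightarrow> affinoid v (closed_disc v r)"
  unfolding affinoid_def
  by (intro exI[of _ r] exI[of _ 1] exI[of _ "{}"])
    (auto simp: mult_seminorm.one affine_line_seminorm closed_disc_def)

text \<open>
  The conditions \<open>\<bar>p\<bar> \<le> c \<bar>g\<bar>\<close> and \<open>\<bar>p'\<bar> \<le> c' \<bar>g'\<bar>\<close> have a common denominator \<open>g g'\<close>. With
  \<open>(g, 1)\<close> and \<open>(g', 1)\<close> added to the two families, the products of their members define the
  intersection and have no common zero.
\<close>

lemma affinoid_Int:
  assumes "affinoid v V" "affinoid v V'"
  shows "affinoid v (V \<inter> V')"
proof -
  obtain r g F where V: "0 < r" "finite F" "\<And>p c. (p, c) \<in> F \<Longrightarrow> 0 < c"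
    "\<And>x. x \<in> closed_disc v r \<Longrightarrow> x g \<noteq> 0 \<or> (\<exists>p c. (p, c) \<in> F \<and> x p \<noteq> 0)"
    "V = {x \<in> closed_disc v r. \<forall>(p, c)\<in>F. x p \<le> c * x g}"
    using assms(1) unfolding affinoid_def by fast
  obtain r' g' F' where V': "0 < r'" "finite F'" "\<And>p c. (p, c) \<in> F' \<Longrightarrow> 0 < c"
    "\<And>x. x \<in> closed_disc v r' \<Longrightarrow> x g' \<noteq> 0 \<or> (\<exists>p c. (p, c) \<in> F' \<and> x p \<noteq> 0)"
    "V' = {x \<in> closed_disc v r'. \<forall>(p, c)\<in>F'. x p \<le> c * x g'}"
    using assms(2) unfolding affinoid_def by fast
  define A where "A = insert (g, 1) F"
  define B where "B = insert (g', 1) F'"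
  define H where "H = (\<lambda>(a, b). (fst a * fst b, snd a * snd b)) ` (A \<times> B)"
  let ?r = "min r r'"
  have sub: "closed_disc v ?r \<subseteq> closed_disc v r" "closed_disc v ?r \<subseteq> closed_disc v r'"
    by (auto intro!: closed_disc_mono)
  have H: "(p * p', c * c') \<in> H" if "(p, c) \<in> A" "(p', c') \<in> B" for p c p' c'
    unfolding H_def using imageI[OF SigmaI[OF that], of "\<lambda>(a, b). (fst a * fst b, snd a * snd b)"] by simp
  have HE: "\<exists>p c p' c'. (p, c) \<in> A \<and> (p', c') \<in> B \<and> h = (p * p', c * c')" if "h \<in> H" for h
    using that unfolding H_def by fastforce
  have nonzero: "\<exists>q d. (q, d) \<in> H \<and> x q \<noteq> 0" if x: "x \<in> closed_disc v ?r" for x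
  proof -
    interpret x: mult_seminorm x
      using x by (simp add: affine_line_seminorm closed_disc_def)
    have "x \<in> closed_disc v r" "x \<in> closed_disc v r'"
      using x sub by auto
    then obtain p c p' c' where "(p, c) \<in> A" "x p \<noteq> 0" "(p', c') \<in> B" "x p' \<noteq> 0"
      using V(4)[of x] V'(4)[of x] by (auto simp: A_def B_def)
    then show ?thesis
      using H[of p c p' c'] by (auto simp: x.mult)
  qed
  have iff: "x \<in> V \<inter> V' \<longleftrightarrow> (\<forall>(q, d)\<in>H. x q \<le> d * x (g * g'))" if x: "x \<in> closed_disc v ?r" for x
  proof -
    interpret x: mult_seminorm x
      using x by (simp add: affine_line_seminorm closed_disc_def)
    have xr: "x \<in> closed_disc v r" "x \<in> closed_disc v r'"
      using x sub by auto
    show ?thesis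
    proof
      assume L: "x \<in> V \<inter> V'"
      show "\<forall>(q, d)\<in>H. x q \<le> d * x (g * g')"
      proof (intro ballI, clarify)
        fix q d assume "(q, d) \<in> H"
        then obtain p c p' c' where h: "(p, c) \<in> A" "(p', c') \<in> B"
          "q = p * p'" "d = c * c'"
          using HE by blast
        have "x p \<le> c * x g" "x p' \<le> c' * x g'" "0 < c" "0 < c'"
          using h L V V' by (auto simp: A_def B_def)
        then have "x p * x p' \<le> (c * x g) * (c' * x g')"
          by (intro mult_mono) (auto simp: x.nonneg)
        then show "x q \<le> d * x (g * g')"
          by (simp add: h x.mult mult_ac)
      qed
    next
      assume R: "\<forall>(q, d)\<in>H. x q \<le> d * x (g * g')"
      have "x (g * g') \<noteq> 0"
      proof
        assume 0: "x (g * g') = 0"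
        obtain q d where "(q, d) \<in> H" "x q \<noteq> 0"
          using nonzero[OF x] by blast
        then show False
          using R 0 x.nonneg[of q] by force
      qed
      then have pos: "0 < x g" "0 < x g'"
        using x.nonneg[of g] x.nonneg[of g'] by (auto simp: x.mult)
      have "x p \<le> c * x g" if "(p, c) \<in> F" for p c
      proof -
        have "(p * g', c * 1) \<in> H"
          using that by (intro H) (auto simp: A_def B_def)
        then have "x (p * g') \<le> c * 1 * x (g * g')"
          using R by blast
        then show ?thesis
          using pos by (simp add: x.mult mult.assoc[symmetric])
      qed
      moreover have "x p \<le> c * x g'" if "(p, c) \<in> F'" for p c
      proof -
        have "(g * p, 1 * c) \<in> H"
          using that by (intro H) (auto simp: A_def B_def)
        then have "x (g * p) \<le> 1 * c * x (g * g')"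
          using R by blast
        then show ?thesis
          using pos by (simp add: x.mult mult.left_commute)
      qed
      ultimately show "x \<in> V \<inter> V'"
        using xr V(5) V'(5) by auto
    qed
  qed
  have "finite H" "\<forall>(q, d)\<in>H. 0 < d"
    using V V' unfolding H_def A_def B_def by auto
  moreover have "V \<inter> V' = {x \<in> closed_disc v ?r. \<forall>(q, d)\<in>H. x q \<le> d * x (g * g')}"
  proof -
    have "V \<inter> V' \<subseteq> closed_disc v ?r"
      using V(5) V'(5) by (auto simp: closed_disc_def)
    then show ?thesis using iff by blast
  qed
  ultimately show ?thesis
    unfolding affinoid_def using V(1) V'(1) nonzero
    by (intro exI[of _ ?r] exI[of _ "g * g'"] exI[of _ H]) fastforce
qed

definition annulus :: "real \<Rightarrow> real \<Rightarrow> 'a point set" where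
  "annulus r1 r2 = {x \<in> affine_line v. r1 \<le> x T \<and> x T \<le> r2}"

lemma affinoid_annulus:
  assumes "0 < r1" "0 < r2"
  shows "affinoid v (annulus r1 r2)"
  unfolding affinoid_def
proof (intro exI conjI)
  show "annulus r1 r2 = {x \<in> closed_disc v r2. \<forall>(p, c)\<in>{(1, 1 / r1)}. x p \<le> c * x T}"
    using assms by (auto simp: annulus_def closed_disc_def mult_seminorm.one affine_line_seminorm field_simps)
  show "\<forall>x\<in>closed_disc v r2. x T \<noteq> 0 \<or> (\<exists>(p, c)\<in>{(1, 1 / r1)}. x p \<noteq> 0)"
    by (auto simp: closed_disc_def mult_seminorm.one affine_line_seminorm)
qed (use assms in auto)

text \<open>
  An inequality \<open>\<bar>p\<bar> \<le> c \<bar>g\<bar>\<close> survives for small \<open>s\<close>: \<open>g\<close> does not vanish at \<open>x\<close>, so its value is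
  constant for small \<open>s\<close>; the same holds for \<open>p\<close> unless \<open>p\<close> vanishes at \<open>x\<close>, and then the
  inequality is strict at \<open>x\<close>.
\<close>

lemma move_in_affinoid:
  assumes V: "affinoid v V" and x: "x \<in> V"
  shows "\<exists>s0>0. \<forall>s. 0 < s \<and> s \<le> s0 \<longrightarrow> move x s \<in> V"
proof -
  obtain r g F where F: "0 < r" "finite F" "\<And>p c. (p, c) \<in> F \<Longrightarrow> 0 < c"
    "\<And>x. x \<in> closed_disc v r \<Longrightarrow> x g \<noteq> 0 \<or> (\<exists>p c. (p, c) \<in> F \<and> x p \<noteq> 0)"
    "V = {x \<in> closed_disc v r. \<forall>(p, c)\<in>F. x p \<le> c * x g}"
    using V unfolding affinoid_def by fast
  have xa: "x \<in> affine_line v" and xr: "x \<in> closed_disc v r"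
    using x F(5) by (auto simp: closed_disc_def)
  interpret x: mult_seminorm x
    using xa by (rule affine_line_seminorm)
  have xg: "x g \<noteq> 0"
  proof
    assume 0: "x g = 0"
    then obtain p c where "(p, c) \<in> F" "x p \<noteq> 0"
      using F(4)[OF xr] by blast
    then show False
      using x 0 F(5) x.nonneg[of p] by force
  qed
  obtain sg where sg: "0 < sg" "\<And>s. 0 < s \<Longrightarrow> s \<le> sg \<Longrightarrow> move x s g = x g"
    using move_small_eq[OF xa xg] by blast
  have "\<exists>s0>0. \<forall>s. 0 < s \<and> s \<le> s0 \<longrightarrow> move x s p \<le> c * x g" if pc: "(p, c) \<in> F" for p c
  proof (cases "x p = 0")
    case True
    moreover have "0 < c * x g"
      using xg x.nonneg[of g] F(3)[OF pc] by simp
    ultimately show ?thesis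
      using move_small[OF xa, of "c * x g" p] by simp
  next
    case False
    then show ?thesis
      using move_small_eq[OF xa False] pc x F(5) by force
  qed
  then have "\<exists>s0>0. \<forall>s. 0 < s \<and> s \<le> s0 \<longrightarrow> move x s (fst h) \<le> snd h * x g" if "h \<in> F" for h
    using that by (cases h) auto
  then obtain t where t: "\<And>h. h \<in> F \<Longrightarrow> 0 < t h"
    "\<And>h s. h \<in> F \<Longrightarrow> 0 < s \<Longrightarrow> s \<le> t h \<Longrightarrow> move x s (fst h) \<le> snd h * x g"
    by metis
  define m where "m = Min (insert r (insert sg (t ` F)))"
  have "0 < m"
    unfolding m_def using t(1) F sg by (subst Min_gr_iff) auto
  moreover have "move x s \<in> V" if s: "0 < s" "s \<le> m" for s
  proof -
    have m: "m \<le> r" "m \<le> sg" "\<And>h. h \<in> F \<Longrightarrow> m \<le> t h"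
      unfolding m_def using F(2) by (auto simp del: Min_insert intro!: Min_le)
    have "move x s T \<le> r"
      using s m xr by (simp add: move_T[OF xa] closed_disc_def)
    then have "move x s \<in> closed_disc v r"
      using move_in_affine_line[OF xa s(1)] by (simp add: closed_disc_def)
    moreover have "move x s (fst h) \<le> snd h * move x s g" if "h \<in> F" for h
      using t(2)[OF that s(1)] m(3)[OF that] s m(2) sg(2)[OF s(1)] by simp
    ultimately show ?thesis
      unfolding F(5) by auto
  qed
  ultimately show ?thesis by blast
qed

lemma origin_T: "origin v T = 0"
  by (simp add: origin_def zero)

lemma eq_origin_iff:
  assumes x: "x \<in> affine_line v"
  shows "x = origin v \<longleftrightarrow> x T = 0"
proof
  interpret x: mult_seminorm x
    using x by (rule affine_line_seminorm)
  assume T: "x T = 0"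
  show "x = origin v"
  proof
    fix p :: "'a poly"
    obtain c q where p: "p = pCons c q" by (cases p)
    have *: "p = [:c:] + T * q"
      by (simp add: p)
    have Tq: "x (T * q) = 0"
      by (simp only: x.mult T mult_zero_left)
    have "x p = v c"
    proof (cases "c = 0")
      case True
      then show ?thesis
        using Tq by (simp add: p zero)
    next
      case False
      then have "x (T * q) < x [:c:]"
        using Tq v_pos_iff affine_line_const[OF x] by simp
      then show ?thesis
        using x.add_eq_left * affine_line_const[OF x] by metis
    qed
    then show "x p = origin v p"
      by (simp add: origin_def p)
  qed
qed (simp add: origin_T)

text \<open>
  \<open>p - p(0)\<close> is a multiple of \<open>T\<close>, and the cofactor is bounded on the unit disc.
\<close>

lemma near_origin:
  assumes "0 < \<delta>"
  obtains e where "0 < e" "\<And>y. y \<in> closed_disc v e \<Longrightarrow> y (p - [:poly p 0:]) < \<delta>"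
proof -
  obtain c q where p: "p = pCons c q" by (cases p)
  have Tq: "p - [:poly p 0:] = T * q"
    by (simp add: p)
  have g: "0 \<le> gauss v 1 q"
    by (rule gauss_nonneg) simp
  define e where "e = min 1 (\<delta> / (2 * (gauss v 1 q + 1)))"
  have e: "0 < e" "e \<le> 1" "e * gauss v 1 q < \<delta>"
  proof -
    show "0 < e" "e \<le> 1" using assms g by (auto simp: e_def)
    have "e * gauss v 1 q \<le> \<delta> / (2 * (gauss v 1 q + 1)) * gauss v 1 q"
      using g by (intro mult_right_mono) (auto simp: e_def)
    also have "\<dots> < \<delta>"
      using assms g by (simp add: field_simps add_pos_nonneg)
    finally show "e * gauss v 1 q < \<delta>" .
  qed
  have "y (p - [:poly p 0:]) < \<delta>" if y: "y \<in> closed_disc v e" for y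
  proof -
    have ya: "y \<in> affine_line v" "y T \<le> e"
      using y by (auto simp: closed_disc_def)
    interpret y: mult_seminorm y
      using ya(1) by (rule affine_line_seminorm)
    have "y q \<le> gauss v 1 q"
      using ya e by (intro poly_le_gauss) auto
    then have "y T * y q \<le> e * gauss v 1 q"
      using ya e by (intro mult_mono) (auto simp: y.nonneg)
    then show ?thesis
      using e(3) unfolding Tq y.mult by simp
  qed
  then show ?thesis using that e(1) by blast
qed

lemma near_origin_eq:
  assumes "poly p 0 \<noteq> 0"
  obtains e where "0 < e" "\<And>y. y \<in> closed_disc v e \<Longrightarrow> y p = v (poly p 0)"
proof -
  obtain e where e: "0 < e" "\<And>y. y \<in> closed_disc v e \<Longrightarrow> y (p - [:poly p 0:]) < v (poly p 0)"
    using near_origin[of "v (poly p 0)" p] assms v_pos_iff by blast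
  have "y p = v (poly p 0)" if y: "y \<in> closed_disc v e" for y
  proof -
    have ya: "y \<in> affine_line v"
      using y by (auto simp: closed_disc_def)
    interpret y: mult_seminorm y
      using ya by (rule affine_line_seminorm)
    show ?thesis
      using y.add_eq_left[of "p - [:poly p 0:]" "[:poly p 0:]"] e(2)[OF y]
      by (simp add: affine_line_const[OF ya])
  qed
  then show ?thesis using that e(1) by blast
qed

text \<open>
  Points \<open>y n\<close> of discs whose radii tend to 0 converge to the origin in the topology of pointwise
  convergence.
\<close>

lemma open_contains_disc:
  assumes O: "open O'" "origin v \<in> O'"
  shows "\<exists>e>0. closed_disc v e \<subseteq> O'"
proof (rule ccontr)
  assume "\<not> ?thesis"
  then have "\<exists>x. x \<in> closed_disc v (1 / Suc n) \<and> x \<notin> O'" for n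
    by (metis divide_pos_pos of_nat_0_less_iff subsetI zero_less_Suc zero_less_one)
  then obtain y where y: "\<And>n. y n \<in> closed_disc v (1 / Suc n)" "\<And>n. y n \<notin> O'"
    by metis
  have small: "\<forall>\<^sub>F n in sequentially. y n \<in> closed_disc v e" if "0 < e" for e
  proof -
    have "\<forall>\<^sub>F n in sequentially. 1 / real (Suc n) < e"
      using LIMSEQ_Suc[OF lim_1_over_n] that by (rule order_tendstoD)
    then show ?thesis
      by eventually_elim (use y(1) closed_disc_mono in \<open>meson less_imp_le subsetD\<close>)
  qed
  have "(\<lambda>n. y n p) \<longlonglongrightarrow> origin v p" for p
  proof (cases "poly p 0 = 0")
    case False
    then obtain e where e: "0 < e" "\<And>y. y \<in> closed_disc v e \<Longrightarrow> y p = v (poly p 0)"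
      using near_origin_eq by blast
    have "\<forall>\<^sub>F n in sequentially. y n p = origin v p"
      using small[OF e(1)] by eventually_elim (simp add: e(2) origin_def)
    then show ?thesis
      by (rule tendsto_eventually)
  next
    case True
    show ?thesis
    proof (rule order_tendstoI)
      fix a assume "a < origin v p"
      then have "a < 0" using True by (simp add: origin_def zero)
      moreover have "0 \<le> y n p" for n
        using y(1)[of n] by (simp add: closed_disc_def affine_line_def)
      ultimately show "\<forall>\<^sub>F n in sequentially. a < y n p"
        by (simp add: less_le_trans)
    next
      fix a assume "origin v p < a"
      then have "0 < a" using True by (simp add: origin_def zero)
      then obtain e where e: "0 < e" "\<And>y. y \<in> closed_disc v e \<Longrightarrow> y (p - [:poly p 0:]) < a"
        using near_origin by blast
      show "\<forall>\<^sub>F n in sequentially. y n p < a"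
        using small[OF e(1)] by eventually_elim (use e(2) True in force)
    qed
  qed
  then have "limitin (product_topology (\<lambda>_. euclidean) UNIV) y (origin v) sequentially"
    by (subst limitin_componentwise) auto
  then have "y \<longlonglongrightarrow> origin v"
    by (simp add: euclidean_product_topology)
  then have "\<forall>\<^sub>F n in sequentially. y n \<in> O'"
    using O by (rule topological_tendstoD)
  then show False
    using y(2) by (simp add: eventually_sequentially)
qed

text \<open>
  An affinoid domain need not be a neighbourhood of each of its points, but the origin causes no
  trouble: each defining inequality is strict there, or both of its sides are constant near the
  origin.
\<close>

lemma affinoid_contains_disc:
  assumes V: "affinoid v V" and 0: "origin v \<in> V"
  shows "\<exists>e>0. closed_disc v e \<subseteq> V"
proof -
  obtain r g F where F: "0 < r" "finite F" "\<And>p c. (p, c) \<in> F \<Longrightarrow> 0 < c"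
    "\<And>x. x \<in> closed_disc v r \<Longrightarrow> x g \<noteq> 0 \<or> (\<exists>p c. (p, c) \<in> F \<and> x p \<noteq> 0)"
    "V = {x \<in> closed_disc v r. \<forall>(p, c)\<in>F. x p \<le> c * x g}"
    using V unfolding affinoid_def by fast
  have pg: "v (poly p 0) \<le> c * v (poly g 0)" if "(p, c) \<in> F" for p c
    using 0 that F(5) by (force simp: origin_def)
  have g0: "poly g 0 \<noteq> 0"
  proof
    assume g0: "poly g 0 = 0"
    then obtain p c where "(p, c) \<in> F" "origin v p \<noteq> 0"
      using F(4)[of "origin v"] 0 F(5) by (auto simp: origin_def zero)
    then show False
      using pg[of p c] nonneg[of "poly p 0"] by (simp add: g0 zero origin_def)
  qed
  then obtain eg where eg: "0 < eg" "\<And>y. y \<in> closed_disc v eg \<Longrightarrow> y g = v (poly g 0)"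
    using near_origin_eq by blast
  have "\<exists>e>0. \<forall>y\<in>closed_disc v e. y p \<le> c * v (poly g 0)" if pc: "(p, c) \<in> F" for p c
  proof (cases "poly p 0 = 0")
    case True
    have "0 < c * v (poly g 0)"
      using g0 F(3)[OF pc] by (simp add: v_pos_iff)
    then obtain e where "0 < e" "\<And>y. y \<in> closed_disc v e \<Longrightarrow> y (p - [:poly p 0:]) < c * v (poly g 0)"
      using near_origin by blast
    then show ?thesis
      using True by (intro exI[of _ e]) (auto simp: less_imp_le)
  next
    case False
    then obtain e where "0 < e" "\<And>y. y \<in> closed_disc v e \<Longrightarrow> y p = v (poly p 0)"
      using near_origin_eq by blast
    then show ?thesis
      using pg[OF pc] by (intro exI[of _ e]) auto
  qed
  then have "\<exists>e>0. \<forall>y\<in>closed_disc v e. y (fst h) \<le> snd h * v (poly g 0)" if "h \<in> F" for h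
    using that by (cases h) auto
  then obtain t where t: "\<And>h. h \<in> F \<Longrightarrow> 0 < t h"
    "\<And>h y. h \<in> F \<Longrightarrow> y \<in> closed_disc v (t h) \<Longrightarrow> y (fst h) \<le> snd h * v (poly g 0)"
    by metis
  define m where "m = Min (insert r (insert eg (t ` F)))"
  have "0 < m"
    unfolding m_def using t(1) F eg by (subst Min_gr_iff) auto
  moreover have "y \<in> V" if y: "y \<in> closed_disc v m" for y
  proof -
    have m: "m \<le> r" "m \<le> eg" "\<And>h. h \<in> F \<Longrightarrow> m \<le> t h"
      unfolding m_def using F(2) by (auto simp del: Min_insert intro!: Min_le)
    have "y \<in> closed_disc v eg"
      using y closed_disc_mono[OF m(2)] by blast
    moreover have "y \<in> closed_disc v (t h)" if "h \<in> F" for h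
      using y closed_disc_mono[OF m(3)[OF that]] by blast
    ultimately have "y (fst h) \<le> snd h * y g" if "h \<in> F" for h
      using t(2)[OF that, of y] eg(2)[of y] that by simp
    moreover have "y \<in> closed_disc v r"
      using y closed_disc_mono[OF m(1)] by blast
    ultimately show ?thesis
      unfolding F(5) by auto
  qed
  ultimately show ?thesis by blast
qed

end

section \<open>Completed residue fields\<close>

locale point = mult_seminorm x for x :: "'a::field point"
begin

abbreviation nrm where "nrm \<equiv> fract_seminorm x"

lemma nonzero: "x q \<noteq> 0 \<Longrightarrow> q \<noteq> 0"
  using zero by auto

lemma fract_seminorm_Fract:
  assumes "x q \<noteq> 0"
  shows "nrm (Fract p q) = x p / x q"
  unfolding fract_seminorm_def
proof (rule the_equality)
  show "\<exists>p' q'. x q' \<noteq> 0 \<and> Fract p q = Fract p' q' \<and> x p / x q = x p' / x q'"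
    using assms by blast
  fix c assume "\<exists>p' q'. x q' \<noteq> 0 \<and> Fract p q = Fract p' q' \<and> c = x p' / x q'"
  then obtain p' q' where *: "x q' \<noteq> 0" "Fract p q = Fract p' q'" "c = x p' / x q'" by blast
  then have "p * q' = p' * q"
    using assms nonzero by (simp add: eq_fract)
  then have "x p * x q' = x p' * x q"
    by (metis mult)
  then show "c = x p / x q"
    using * assms by (simp add: frac_eq_eq)
qed

lemma Fract_regular: "x q \<noteq> 0 \<Longrightarrow> Fract p q \<in> regular_at x"
  by (auto simp: regular_at_def)

lemma regularE:
  assumes "\<phi> \<in> regular_at x"
  obtains p q where "x q \<noteq> 0" "\<phi> = Fract p q" "nrm \<phi> = x p / x q"
  using assms fract_seminorm_Fract unfolding regular_at_def by blast

lemma regular_0: "0 \<in> regular_at x" and nrm_0: "nrm 0 = 0"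
  unfolding Zero_fract_def using fract_seminorm_Fract[of 1 0] Fract_regular[of 1 0] one zero
  by simp_all

lemma regular_1: "1 \<in> regular_at x" and nrm_1: "nrm 1 = 1"
  unfolding One_fract_def using fract_seminorm_Fract[of 1 1] Fract_regular[of 1 1] one
  by simp_all

lemma
  assumes "\<phi> \<in> regular_at x" "\<psi> \<in> regular_at x"
  shows regular_mult: "\<phi> * \<psi> \<in> regular_at x"
    and nrm_mult: "nrm (\<phi> * \<psi>) = nrm \<phi> * nrm \<psi>"
    and regular_add: "\<phi> + \<psi> \<in> regular_at x"
    and nrm_add_le: "nrm (\<phi> + \<psi>) \<le> max (nrm \<phi>) (nrm \<psi>)"
proof -
  obtain p q where \<phi>: "x q \<noteq> 0" "\<phi> = Fract p q" "nrm \<phi> = x p / x q"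
    using assms(1) by (rule regularE)
  obtain p' q' where \<psi>: "x q' \<noteq> 0" "\<psi> = Fract p' q'" "nrm \<psi> = x p' / x q'"
    using assms(2) by (rule regularE)
  have qq: "x (q * q') \<noteq> 0"
    using \<phi> \<psi> by (simp add: mult)
  have add: "\<phi> + \<psi> = Fract (p * q' + p' * q) (q * q')" and mul: "\<phi> * \<psi> = Fract (p * p') (q * q')"
    using \<phi> \<psi> nonzero by simp_all
  show "\<phi> * \<psi> \<in> regular_at x" "\<phi> + \<psi> \<in> regular_at x"
    unfolding add mul using qq by (auto intro: Fract_regular)
  show "nrm (\<phi> * \<psi>) = nrm \<phi> * nrm \<psi>"
    unfolding mul by (simp add: fract_seminorm_Fract[OF qq] \<phi>(3) \<psi>(3) mult)
  have pos: "0 < x q" "0 < x q'"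
    using \<phi> \<psi> nonneg by (simp_all add: less_le)
  have "nrm (\<phi> + \<psi>) \<le> max (x (p * q')) (x (p' * q)) / x (q * q')"
    unfolding add fract_seminorm_Fract[OF qq] by (intro divide_right_mono add_le nonneg)
  also have "\<dots> = max (nrm \<phi>) (nrm \<psi>)"
    using pos by (simp add: max_divide_distrib_right \<phi>(3) \<psi>(3) mult)
  finally show "nrm (\<phi> + \<psi>) \<le> max (nrm \<phi>) (nrm \<psi>)" .
qed

lemma
  assumes "\<phi> \<in> regular_at x"
  shows regular_minus: "- \<phi> \<in> regular_at x" and nrm_minus: "nrm (- \<phi>) = nrm \<phi>" and nrm_nonneg: "0 \<le> nrm \<phi>"
proof -
  obtain p q where \<phi>: "x q \<noteq> 0" "\<phi> = Fract p q" "nrm \<phi> = x p / x q"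
    using assms(1) by (rule regularE)
  then show "- \<phi> \<in> regular_at x" "nrm (- \<phi>) = nrm \<phi>" "0 \<le> nrm \<phi>"
    using fract_seminorm_Fract[OF \<phi>(1), of "- p"] by (simp_all add: minus Fract_regular nonneg)
qed

lemma regular_diff: "\<phi> \<in> regular_at x \<Longrightarrow> \<psi> \<in> regular_at x \<Longrightarrow> \<phi> - \<psi> \<in> regular_at x"
  unfolding diff_conv_add_uminus by (intro regular_add regular_minus)

lemma nrm_diff_le:
  "\<phi> \<in> regular_at x \<Longrightarrow> \<psi> \<in> regular_at x \<Longrightarrow> nrm (\<phi> - \<psi>) \<le> max (nrm \<phi>) (nrm \<psi>)"
  using nrm_add_le[of \<phi> "- \<psi>"] regular_minus[of \<psi>] nrm_minus[of \<psi>] by simp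

lemma nrm_diff_commute:
  "\<phi> \<in> regular_at x \<Longrightarrow> \<psi> \<in> regular_at x \<Longrightarrow> nrm (\<phi> - \<psi>) = nrm (\<psi> - \<phi>)"
  using nrm_minus[of "\<phi> - \<psi>"] regular_diff[of \<phi> \<psi>] by simp

lemma nrm_abs_diff_le:
  assumes "\<phi> \<in> regular_at x" "\<psi> \<in> regular_at x"
  shows "\<bar>nrm \<phi> - nrm \<psi>\<bar> \<le> nrm (\<phi> - \<psi>)"
proof -
  have nn: "0 \<le> nrm \<phi>" "0 \<le> nrm \<psi>" "0 \<le> nrm (\<phi> - \<psi>)"
    using assms nrm_nonneg regular_diff by blast+
  have "nrm \<phi> \<le> max (nrm (\<phi> - \<psi>)) (nrm \<psi>)" "nrm \<psi> \<le> max (nrm (\<phi> - \<psi>)) (nrm \<phi>)"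
    using nrm_add_le[of "\<phi> - \<psi>" \<psi>] nrm_add_le[of "\<psi> - \<phi>" \<phi>] nrm_diff_commute assms
    by (simp_all add: regular_diff)
  then show ?thesis using nn by linarith
qed

lemma
  assumes "\<phi> \<in> regular_at x" "nrm \<phi> \<noteq> 0"
  shows regular_inverse: "inverse \<phi> \<in> regular_at x"
    and nrm_inverse: "nrm (inverse \<phi>) = inverse (nrm \<phi>)"
    and regular_nonzero: "\<phi> \<noteq> 0"
proof -
  obtain p q where \<phi>: "x q \<noteq> 0" "\<phi> = Fract p q" "nrm \<phi> = x p / x q"
    using assms(1) by (rule regularE)
  then have "x p \<noteq> 0" using assms by simp
  then show "inverse \<phi> \<in> regular_at x" "nrm (inverse \<phi>) = inverse (nrm \<phi>)"
    using \<phi> by (simp_all add: Fract_regular fract_seminorm_Fract)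
  show "\<phi> \<noteq> 0" using assms nrm_0 by auto
qed

lemma regular_sum: "(\<And>i. i \<in> A \<Longrightarrow> f i \<in> regular_at x) \<Longrightarrow> sum f A \<in> regular_at x"
  by (induction A rule: infinite_finite_induct) (auto simp: regular_0 regular_add)

lemma nrm_sum_le:
  assumes "\<And>i. i \<in> A \<Longrightarrow> f i \<in> regular_at x" "0 \<le> B" "\<And>i. i \<in> A \<Longrightarrow> nrm (f i) \<le> B"
  shows "nrm (sum f A) \<le> B"
  using assms(1,3)
proof (induction A rule: infinite_finite_induct)
  case (insert i A)
  have "nrm (f i + sum f A) \<le> max (nrm (f i)) (nrm (sum f A))"
    using insert.prems by (intro nrm_add_le regular_sum) auto
  also have "\<dots> \<le> B"
    using insert by simp
  finally show ?case
    using insert.hyps by simp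
qed (use assms(2) nrm_0 in auto)

lemma regular_power: "\<phi> \<in> regular_at x \<Longrightarrow> \<phi> ^ n \<in> regular_at x"
  by (induction n) (auto simp: regular_1 regular_mult)

lemma nrm_power: "\<phi> \<in> regular_at x \<Longrightarrow> nrm (\<phi> ^ n) = nrm \<phi> ^ n"
  by (induction n) (auto simp: nrm_1 nrm_mult regular_power)

subsection \<open>Cauchy sequences\<close>

abbreviation "CS \<equiv> carrier (cauchy_ring x)"

lemma CS_iff: "s \<in> CS \<longleftrightarrow> (\<forall>n. s n \<in> regular_at x) \<and> (\<forall>e>0. \<exists>N. \<forall>m\<ge>N. \<forall>n\<ge>N. nrm (s m - s n) < e)"
  by (simp add: cauchy_ring_def)

lemma CS_regular: "s \<in> CS \<Longrightarrow> s n \<in> regular_at x"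
  by (simp add: CS_iff)

lemma CS_cauchy: "s \<in> CS \<Longrightarrow> 0 < e \<Longrightarrow> \<exists>N. \<forall>m\<ge>N. \<forall>n\<ge>N. nrm (s m - s n) < e"
  by (simp add: CS_iff)

lemma CS_const: "\<phi> \<in> regular_at x \<Longrightarrow> (\<lambda>n. \<phi>) \<in> CS"
  by (simp add: CS_iff nrm_0)

lemma CS_convergent:
  assumes "s \<in> CS"
  shows "convergent (\<lambda>n. nrm (s n))"
proof (rule Cauchy_convergent, rule metric_CauchyI)
  fix e :: real assume "0 < e"
  then obtain N where N: "\<forall>m\<ge>N. \<forall>n\<ge>N. nrm (s m - s n) < e"
    using CS_cauchy assms by blast
  have "dist (nrm (s m)) (nrm (s n)) < e" if "m \<ge> N" "n \<ge> N" for m n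
    using nrm_abs_diff_le[of "s m" "s n"] N that CS_regular[OF assms] by (force simp: dist_real_def)
  then show "\<exists>M. \<forall>m\<ge>M. \<forall>n\<ge>M. dist (nrm (s m)) (nrm (s n)) < e"
    by blast
qed

definition cnorm where "cnorm s = lim (\<lambda>n. nrm (s n))"

lemma cnorm_lim: "s \<in> CS \<Longrightarrow> (\<lambda>n. nrm (s n)) \<longlonglongrightarrow> cnorm s"
  unfolding cnorm_def using CS_convergent convergent_LIMSEQ_iff by blast

lemma CS_bounded:
  assumes "s \<in> CS"
  obtains B where "0 < B" "\<And>n. nrm (s n) \<le> B"
proof -
  have "Bseq (\<lambda>n. nrm (s n))"
    using CS_convergent[OF assms] by (rule convergent_imp_Bseq)
  then obtain B where "0 < B" "\<And>n. norm (nrm (s n)) \<le> B"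
    by (auto elim: BseqE)
  then show ?thesis
    using that by (metis abs_le_D1 real_norm_def)
qed

lemma CS_add: "s \<in> CS \<Longrightarrow> t \<in> CS \<Longrightarrow> (\<lambda>n. s n + t n) \<in> CS"
  unfolding CS_iff
proof (intro conjI allI impI; elim conjE)
  fix e :: real
  assume s: "\<forall>n. s n \<in> regular_at x" and t: "\<forall>n. t n \<in> regular_at x" and e: "0 < e"
  assume "\<forall>e>0. \<exists>N. \<forall>m\<ge>N. \<forall>n\<ge>N. nrm (s m - s n) < e" "\<forall>e>0. \<exists>N. \<forall>m\<ge>N. \<forall>n\<ge>N. nrm (t m - t n) < e"
  then obtain N M where NM: "\<forall>m\<ge>N. \<forall>n\<ge>N. nrm (s m - s n) < e" "\<forall>m\<ge>M. \<forall>n\<ge>M. nrm (t m - t n) < e"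
    using e by metis
  have "nrm ((s m + t m) - (s n + t n)) < e" if "m \<ge> max N M" "n \<ge> max N M" for m n
  proof -
    have "nrm ((s m - s n) + (t m - t n)) \<le> max (nrm (s m - s n)) (nrm (t m - t n))"
      using s t by (intro nrm_add_le regular_diff) auto
    also have "\<dots> < e" using NM that by simp
    finally show ?thesis by (simp add: algebra_simps)
  qed
  then show "\<exists>N. \<forall>m\<ge>N. \<forall>n\<ge>N. nrm ((s m + t m) - (s n + t n)) < e" by blast
qed (simp add: regular_add)

lemma CS_minus: "s \<in> CS \<Longrightarrow> (\<lambda>n. - s n) \<in> CS"
  unfolding CS_iff using nrm_diff_commute by (simp add: regular_minus)

lemma CS_mult:
  assumes s: "s \<in> CS" and t: "t \<in> CS"
  shows "(\<lambda>n. s n * t n) \<in> CS"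
  unfolding CS_iff
proof (intro conjI allI impI)
  fix e :: real assume e: "0 < e"
  obtain A B where A: "0 < A" "\<And>n. nrm (s n) \<le> A" and B: "0 < B" "\<And>n. nrm (t n) \<le> B"
    using CS_bounded s t by metis
  obtain N M where NM: "\<forall>m\<ge>N. \<forall>n\<ge>N. nrm (s m - s n) < e / B" "\<forall>m\<ge>M. \<forall>n\<ge>M. nrm (t m - t n) < e / A"
    using CS_cauchy[OF s, of "e / B"] CS_cauchy[OF t, of "e / A"] e A B by auto
  have reg: "s n \<in> regular_at x" "t n \<in> regular_at x" for n
    using s t CS_regular by auto
  have "nrm (s m * t m - s n * t n) < e" if mn: "m \<ge> max N M" "n \<ge> max N M" for m n
  proof -
    have "s m * t m - s n * t n = (s m - s n) * t m + s n * (t m - t n)"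
      by (simp add: algebra_simps)
    then have "nrm (s m * t m - s n * t n) \<le> max (nrm ((s m - s n) * t m)) (nrm (s n * (t m - t n)))"
      using reg by (simp only: nrm_add_le regular_mult regular_diff)
    also have "\<dots> < e"
      unfolding max_less_iff_conj
    proof
      have "nrm ((s m - s n) * t m) = nrm (s m - s n) * nrm (t m)"
        using reg by (intro nrm_mult regular_diff)
      also have "\<dots> \<le> nrm (s m - s n) * B"
        using B reg by (intro mult_left_mono nrm_nonneg regular_diff) auto
      also have "\<dots> < e / B * B"
        using NM mn B by (intro mult_strict_right_mono) auto
      finally show "nrm ((s m - s n) * t m) < e" using B by simp
      have "nrm (s n * (t m - t n)) = nrm (s n) * nrm (t m - t n)"
        using reg by (intro nrm_mult regular_diff)
      also have "\<dots> \<le> A * nrm (t m - t n)"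
        using A reg by (intro mult_right_mono nrm_nonneg regular_diff) auto
      also have "\<dots> < A * (e / A)"
        using NM mn A by (intro mult_strict_left_mono) auto
      finally show "nrm (s n * (t m - t n)) < e" using A by simp
    qed
    finally show ?thesis .
  qed
  then show "\<exists>N. \<forall>m\<ge>N. \<forall>n\<ge>N. nrm (s m * t m - s n * t n) < e" by blast
next
  fix n show "s n * t n \<in> regular_at x"
    using s t by (intro regular_mult CS_regular)
qed

lemma cring_cauchy_ring: "cring (cauchy_ring x)"
proof (rule cringI)
  show "abelian_group (cauchy_ring x)"
  proof (rule abelian_groupI)
    fix s assume s: "s \<in> CS"
    show "\<exists>t\<in>CS. t \<oplus>\<^bsub>cauchy_ring x\<^esub> s = \<zero>\<^bsub>cauchy_ring x\<^esub>"
      using CS_minus[OF s] by (intro bexI[of _ "\<lambda>n. - s n"]) (auto simp: cauchy_ring_def)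
  qed (use CS_add CS_const[OF regular_0] in \<open>auto simp: cauchy_ring_def algebra_simps\<close>)
  show "comm_monoid (cauchy_ring x)"
    by (rule comm_monoidI) (use CS_mult CS_const[OF regular_1] in \<open>auto simp: cauchy_ring_def algebra_simps\<close>)
qed (auto simp: cauchy_ring_def algebra_simps)

sublocale C: cring "cauchy_ring x"
  by (rule cring_cauchy_ring)

lemma C_simps:
  "s \<oplus>\<^bsub>cauchy_ring x\<^esub> t = (\<lambda>n. s n + t n)" "s \<otimes>\<^bsub>cauchy_ring x\<^esub> t = (\<lambda>n. s n * t n)"
  "\<zero>\<^bsub>cauchy_ring x\<^esub> = (\<lambda>n. 0)" "\<one>\<^bsub>cauchy_ring x\<^esub> = (\<lambda>n. 1)"
  by (simp_all add: cauchy_ring_def)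

lemma C_minus: "s \<in> CS \<Longrightarrow> \<ominus>\<^bsub>cauchy_ring x\<^esub> s = (\<lambda>n. - s n)"
  by (rule C.minus_equality) (auto simp: C_simps CS_minus)

lemma null_iff: "s \<in> null_sequences x \<longleftrightarrow> s \<in> CS \<and> (\<lambda>n. nrm (s n)) \<longlonglongrightarrow> 0"
  by (simp add: null_sequences_def)

lemma null_CS: "s \<in> null_sequences x \<Longrightarrow> s \<in> CS"
  by (simp add: null_iff)

lemma nrm_CS_nonneg: "s \<in> CS \<Longrightarrow> 0 \<le> nrm (s n)"
  using CS_regular nrm_nonneg by blast

lemma cnorm_nonneg: "s \<in> CS \<Longrightarrow> 0 \<le> cnorm s"
  using cnorm_lim[of s] nrm_CS_nonneg by (intro LIMSEQ_le_const[of _ "cnorm s"]) auto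

lemma cnorm_mult: "s \<in> CS \<Longrightarrow> t \<in> CS \<Longrightarrow> cnorm (\<lambda>n. s n * t n) = cnorm s * cnorm t"
  using tendsto_mult[OF cnorm_lim[of s] cnorm_lim[of t]] cnorm_lim[OF CS_mult[of s t]]
  by (intro LIMSEQ_unique[of "\<lambda>n. nrm (s n * t n)"]) (simp_all add: nrm_mult CS_regular)

lemma cnorm_add_le:
  assumes "s \<in> CS" "t \<in> CS"
  shows "cnorm (\<lambda>n. s n + t n) \<le> max (cnorm s) (cnorm t)"
proof (rule LIMSEQ_le)
  show "(\<lambda>n. nrm (s n + t n)) \<longlonglongrightarrow> cnorm (\<lambda>n. s n + t n)"
    using cnorm_lim[OF CS_add[OF assms]] by simp
  show "(\<lambda>n. max (nrm (s n)) (nrm (t n))) \<longlonglongrightarrow> max (cnorm s) (cnorm t)"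
    using assms by (intro tendsto_max cnorm_lim)
  show "\<exists>N. \<forall>n\<ge>N. nrm (s n + t n) \<le> max (nrm (s n)) (nrm (t n))"
    using assms nrm_add_le CS_regular by blast
qed

lemma cnorm_minus: "s \<in> CS \<Longrightarrow> cnorm (\<lambda>n. - s n) = cnorm s"
  using cnorm_lim[OF CS_minus[of s]] cnorm_lim[of s]
  by (intro LIMSEQ_unique[of "\<lambda>n. nrm (- s n)"]) (simp_all add: nrm_minus CS_regular)

lemma cnorm_const: "cnorm (\<lambda>n. \<phi>) = nrm \<phi>"
  by (simp add: cnorm_def)

lemma null_iff_cnorm: "s \<in> null_sequences x \<longleftrightarrow> s \<in> CS \<and> cnorm s = 0"
  using cnorm_lim[of s] LIMSEQ_unique[of "\<lambda>n. nrm (s n)" 0 "cnorm s"] by (auto simp: null_iff)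

lemma ideal_null: "ideal (null_sequences x) (cauchy_ring x)"
proof (rule idealI[OF C.ring_axioms])
  show "subgroup (null_sequences x) (add_monoid (cauchy_ring x))"
  proof (rule group.subgroupI)
    show "group (add_monoid (cauchy_ring x))"
      by (rule C.a_group)
    show "null_sequences x \<noteq> {}"
      using CS_const[OF regular_0] cnorm_const[of 0] nrm_0 null_iff_cnorm by auto
    show "inv\<^bsub>add_monoid (cauchy_ring x)\<^esub> a \<in> null_sequences x" if "a \<in> null_sequences x" for a
      using that C_minus[of a] cnorm_minus[of a] CS_minus[of a] by (auto simp: null_iff_cnorm a_inv_def)
    show "a \<otimes>\<^bsub>add_monoid (cauchy_ring x)\<^esub> b \<in> null_sequences x"
      if "a \<in> null_sequences x" "b \<in> null_sequences x" for a b
      using that CS_add[of a b] cnorm_add_le[of a b] cnorm_nonneg[OF CS_add[of a b]]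
      by (auto simp: null_iff_cnorm C_simps)
  qed (auto simp: null_iff)
  fix a s assume a: "a \<in> null_sequences x" and s: "s \<in> CS"
  have a': "a \<in> CS" "cnorm a = 0"
    using a by (simp_all add: null_iff_cnorm)
  show "s \<otimes>\<^bsub>cauchy_ring x\<^esub> a \<in> null_sequences x" "a \<otimes>\<^bsub>cauchy_ring x\<^esub> s \<in> null_sequences x"
    unfolding null_iff_cnorm C_simps cnorm_mult[OF s a'(1)] cnorm_mult[OF a'(1) s]
    using CS_mult[OF s a'(1)] CS_mult[OF a'(1) s] a'(2) by simp_all
qed

sublocale N: ideal "null_sequences x" "cauchy_ring x"
  by (rule ideal_null)

subsection \<open>The residue field\<close>

abbreviation "H \<equiv> residue_field x"

definition cls where "cls s = null_sequences x +>\<^bsub>cauchy_ring x\<^esub> s"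

lemma cring_residue_field: "cring H"
  unfolding residue_field_def by (rule N.quotient_is_cring[OF cring_cauchy_ring])

sublocale H: cring "residue_field x"
  by (rule cring_residue_field)

lemma cls_hom: "ring_hom_ring (cauchy_ring x) H cls"
  using N.rcos_ring_hom_ring by (simp add: residue_field_def cls_def[abs_def])

sublocale cls: ring_hom_ring "cauchy_ring x" "residue_field x" cls
  by (rule cls_hom)

lemma residue_cases:
  assumes "a \<in> carrier H"
  obtains s where "s \<in> CS" "a = cls s"
  using assms by (auto simp: residue_field_def FactRing_def A_RCOSETS_def' cls_def)

text \<open>
  Two representatives of a class differ by a null sequence, so their norms have the same limit.
\<close>

lemma residue_abs_cls:
  assumes s: "s \<in> CS"
  shows "residue_abs x (cls s) = cnorm s"
  unfolding residue_abs_def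
proof (rule the_equality)
  have "s \<in> cls s"
    unfolding cls_def using s by (rule N.a_rcos_self)
  then show "\<exists>t\<in>cls s. (\<lambda>n. nrm (t n)) \<longlonglongrightarrow> cnorm s"
    using cnorm_lim[OF s] by blast
  fix c assume "\<exists>t\<in>cls s. (\<lambda>n. nrm (t n)) \<longlonglongrightarrow> c"
  then obtain t where t: "t \<in> cls s" "(\<lambda>n. nrm (t n)) \<longlonglongrightarrow> c" by blast
  then obtain h where h: "h \<in> null_sequences x" "t = (\<lambda>n. h n + s n)"
    by (auto simp: cls_def a_r_coset_def' C_simps)
  have "(\<lambda>n. nrm (t n) - nrm (s n)) \<longlonglongrightarrow> 0"
  proof (rule tendsto_rabs_zero_cancel,
      rule tendsto_sandwich[where f = "\<lambda>_. 0" and h = "\<lambda>n. nrm (h n)"])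
    show "\<forall>\<^sub>F n in sequentially. \<bar>nrm (t n) - nrm (s n)\<bar> \<le> nrm (h n)"
    proof (rule always_eventually, rule allI)
      fix n
      show "\<bar>nrm (t n) - nrm (s n)\<bar> \<le> nrm (h n)"
        using nrm_abs_diff_le[of "t n" "s n"] h s by (simp add: CS_regular null_CS regular_add)
    qed
    show "(\<lambda>n. nrm (h n)) \<longlonglongrightarrow> 0"
      using h by (simp add: null_iff)
  qed auto
  moreover have "(\<lambda>n. nrm (t n) - nrm (s n)) \<longlonglongrightarrow> c - cnorm s"
    using t(2) cnorm_lim[OF s] by (rule tendsto_diff)
  ultimately show "c = cnorm s"
    using LIMSEQ_unique by fastforce
qed

lemma cls_eq_zero_iff: "s \<in> CS \<Longrightarrow> cls s = \<zero>\<^bsub>H\<^esub> \<longleftrightarrow> cnorm s = 0"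
proof -
  assume s: "s \<in> CS"
  have "cls s = \<zero>\<^bsub>H\<^esub> \<longleftrightarrow> s \<in> null_sequences x"
    unfolding cls_def residue_field_def FactRing_def
    using s N.a_rcos_const N.a_rcos_self by auto
  then show ?thesis using s by (simp add: null_iff_cnorm)
qed

abbreviation "absH \<equiv> residue_abs x"
abbreviation "val \<equiv> fract_value x"

lemma val_cls: "val \<phi> = cls (\<lambda>n. \<phi>)"
  by (simp add: fract_value_def cls_def)

lemma absH_nonneg: "a \<in> carrier H \<Longrightarrow> 0 \<le> absH a"
  by (elim residue_cases) (simp add: residue_abs_cls cnorm_nonneg)

lemma absH_eq_0_iff: "a \<in> carrier H \<Longrightarrow> absH a = 0 \<longleftrightarrow> a = \<zero>\<^bsub>H\<^esub>"
  by (elim residue_cases) (simp add: residue_abs_cls cls_eq_zero_iff)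

lemma absH_mult: "a \<in> carrier H \<Longrightarrow> b \<in> carrier H \<Longrightarrow> absH (a \<otimes>\<^bsub>H\<^esub> b) = absH a * absH b"
  by (elim residue_cases)
    (simp add: residue_abs_cls C_simps cnorm_mult CS_mult flip: cls.hom_mult)

lemma absH_add_le: "a \<in> carrier H \<Longrightarrow> b \<in> carrier H \<Longrightarrow> absH (a \<oplus>\<^bsub>H\<^esub> b) \<le> max (absH a) (absH b)"
  by (elim residue_cases)
    (simp add: residue_abs_cls C_simps cnorm_add_le CS_add flip: cls.hom_add)

lemma absH_minus: "a \<in> carrier H \<Longrightarrow> absH (\<ominus>\<^bsub>H\<^esub> a) = absH a"
  by (elim residue_cases)
    (simp add: residue_abs_cls C_minus cnorm_minus CS_minus flip: cls.hom_a_inv)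

lemma val_closed: "\<phi> \<in> regular_at x \<Longrightarrow> val \<phi> \<in> carrier H"
  by (simp add: val_cls CS_const)

lemma absH_val: "\<phi> \<in> regular_at x \<Longrightarrow> absH (val \<phi>) = nrm \<phi>"
  by (simp add: val_cls residue_abs_cls CS_const cnorm_const)

lemma val_add: "\<phi> \<in> regular_at x \<Longrightarrow> \<psi> \<in> regular_at x \<Longrightarrow> val (\<phi> + \<psi>) = val \<phi> \<oplus>\<^bsub>H\<^esub> val \<psi>"
  using cls.hom_add[of "\<lambda>n. \<phi>" "\<lambda>n. \<psi>"] by (simp add: val_cls CS_const C_simps)

lemma val_mult: "\<phi> \<in> regular_at x \<Longrightarrow> \<psi> \<in> regular_at x \<Longrightarrow> val (\<phi> * \<psi>) = val \<phi> \<otimes>\<^bsub>H\<^esub> val \<psi>"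
  using cls.hom_mult[of "\<lambda>n. \<phi>" "\<lambda>n. \<psi>"] by (simp add: val_cls CS_const C_simps)

lemma val_minus: "\<phi> \<in> regular_at x \<Longrightarrow> val (- \<phi>) = \<ominus>\<^bsub>H\<^esub> val \<phi>"
  using cls.hom_a_inv[of "\<lambda>n. \<phi>"] by (simp add: val_cls CS_const C_minus)

lemma val_diff: "\<phi> \<in> regular_at x \<Longrightarrow> \<psi> \<in> regular_at x \<Longrightarrow> val (\<phi> - \<psi>) = val \<phi> \<ominus>\<^bsub>H\<^esub> val \<psi>"
  using val_add[of \<phi> "- \<psi>"] by (simp add: regular_minus val_minus a_minus_def)

lemma val_0: "val 0 = \<zero>\<^bsub>H\<^esub>"
  using cls.hom_zero by (simp add: val_cls C_simps)

lemma val_1: "val 1 = \<one>\<^bsub>H\<^esub>"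
  using cls.hom_one by (simp add: val_cls C_simps)

lemma absH_0: "absH \<zero>\<^bsub>H\<^esub> = 0"
  using absH_eq_0_iff by blast

lemma absH_1: "absH \<one>\<^bsub>H\<^esub> = 1"
  using absH_val[OF regular_1] by (simp add: val_1 nrm_1)

lemma one_neq_zero_H: "\<one>\<^bsub>H\<^esub> \<noteq> \<zero>\<^bsub>H\<^esub>"
  using absH_0 absH_1 by auto

lemma absH_diff_commute:
  assumes "a \<in> carrier H" "b \<in> carrier H"
  shows "absH (a \<ominus>\<^bsub>H\<^esub> b) = absH (b \<ominus>\<^bsub>H\<^esub> a)"
proof -
  have "b \<ominus>\<^bsub>H\<^esub> a = \<ominus>\<^bsub>H\<^esub> (a \<ominus>\<^bsub>H\<^esub> b)"
    using assms by (simp add: a_minus_def H.minus_add H.a_comm)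
  then show ?thesis
    using assms absH_minus by simp
qed

lemma absH_triangle:
  assumes "a \<in> carrier H" "b \<in> carrier H" "c \<in> carrier H"
  shows "absH (a \<ominus>\<^bsub>H\<^esub> c) \<le> max (absH (a \<ominus>\<^bsub>H\<^esub> b)) (absH (b \<ominus>\<^bsub>H\<^esub> c))"
proof -
  have "a \<ominus>\<^bsub>H\<^esub> c = (a \<ominus>\<^bsub>H\<^esub> b) \<oplus>\<^bsub>H\<^esub> (b \<ominus>\<^bsub>H\<^esub> c)"
    using assms by (simp add: a_minus_def H.a_assoc H.r_neg1)
  then show ?thesis
    using assms absH_add_le by simp
qed

lemma H_diff_eq_0_iff:
  assumes "a \<in> carrier H" "b \<in> carrier H"
  shows "a \<ominus>\<^bsub>H\<^esub> b = \<zero>\<^bsub>H\<^esub> \<longleftrightarrow> a = b"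
proof
  assume 0: "a \<ominus>\<^bsub>H\<^esub> b = \<zero>\<^bsub>H\<^esub>"
  have "a = (a \<ominus>\<^bsub>H\<^esub> b) \<oplus>\<^bsub>H\<^esub> b"
    using assms by (simp add: a_minus_def H.a_assoc H.l_neg)
  then show "a = b" using 0 assms by simp
qed (use assms in \<open>simp add: a_minus_def H.r_neg\<close>)

lemma absH_le_max_diff:
  assumes "a \<in> carrier H" "b \<in> carrier H"
  shows "absH a \<le> max (absH (a \<ominus>\<^bsub>H\<^esub> b)) (absH b)"
proof -
  have "a = (a \<ominus>\<^bsub>H\<^esub> b) \<oplus>\<^bsub>H\<^esub> b"
    using assms by (simp add: a_minus_def H.a_assoc H.l_neg)
  then show ?thesis
    using assms absH_add_le[of "a \<ominus>\<^bsub>H\<^esub> b" b] by simp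
qed

lemma absH_abs_diff_le:
  assumes "a \<in> carrier H" "b \<in> carrier H"
  shows "\<bar>absH a - absH b\<bar> \<le> absH (a \<ominus>\<^bsub>H\<^esub> b)"
  using absH_le_max_diff[OF assms] absH_le_max_diff[OF assms(2,1)] absH_diff_commute[OF assms]
    absH_nonneg[of a] absH_nonneg[of b] absH_nonneg[of "a \<ominus>\<^bsub>H\<^esub> b"] assms
  by (auto simp: max_def split: if_splits)

lemma absH_eq_of_diff_less:
  assumes "a \<in> carrier H" "b \<in> carrier H" "absH (a \<ominus>\<^bsub>H\<^esub> b) < absH a"
  shows "absH b = absH a"
  using absH_le_max_diff[OF assms(1,2)] absH_le_max_diff[OF assms(2,1)] absH_diff_commute[OF assms(1,2)] assms(3)
  by (auto simp: max_def split: if_splits)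

lemma absH_eq_of_diff_less':
  assumes "a \<in> carrier H" "b \<in> carrier H" "absH (a \<ominus>\<^bsub>H\<^esub> b) < absH b"
  shows "absH a = absH b"
  using absH_eq_of_diff_less[of b a] absH_diff_commute[of a b] assms by simp

lemma absH_mult_diff_le:
  assumes "a \<in> carrier H" "b \<in> carrier H" "c \<in> carrier H" "d \<in> carrier H"
  shows "absH (a \<otimes>\<^bsub>H\<^esub> b \<ominus>\<^bsub>H\<^esub> c \<otimes>\<^bsub>H\<^esub> d)
    \<le> max (absH a * absH (b \<ominus>\<^bsub>H\<^esub> d)) (absH (a \<ominus>\<^bsub>H\<^esub> c) * absH d)"
proof -
  have "absH (a \<otimes>\<^bsub>H\<^esub> b \<ominus>\<^bsub>H\<^esub> c \<otimes>\<^bsub>H\<^esub> d)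
      \<le> max (absH (a \<otimes>\<^bsub>H\<^esub> b \<ominus>\<^bsub>H\<^esub> a \<otimes>\<^bsub>H\<^esub> d)) (absH (a \<otimes>\<^bsub>H\<^esub> d \<ominus>\<^bsub>H\<^esub> c \<otimes>\<^bsub>H\<^esub> d))"
    using assms by (intro absH_triangle) auto
  also have "a \<otimes>\<^bsub>H\<^esub> b \<ominus>\<^bsub>H\<^esub> a \<otimes>\<^bsub>H\<^esub> d = a \<otimes>\<^bsub>H\<^esub> (b \<ominus>\<^bsub>H\<^esub> d)"
    using assms by (simp add: a_minus_def H.r_distr H.r_minus)
  also have "a \<otimes>\<^bsub>H\<^esub> d \<ominus>\<^bsub>H\<^esub> c \<otimes>\<^bsub>H\<^esub> d = (a \<ominus>\<^bsub>H\<^esub> c) \<otimes>\<^bsub>H\<^esub> d"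
    using assms by (simp add: a_minus_def H.l_distr H.l_minus)
  finally show ?thesis
    using assms by (simp add: absH_mult)
qed

lemma absH_add_diff_le:
  assumes "a \<in> carrier H" "b \<in> carrier H" "c \<in> carrier H" "d \<in> carrier H"
  shows "absH ((a \<oplus>\<^bsub>H\<^esub> b) \<ominus>\<^bsub>H\<^esub> (c \<oplus>\<^bsub>H\<^esub> d)) \<le> max (absH (a \<ominus>\<^bsub>H\<^esub> c)) (absH (b \<ominus>\<^bsub>H\<^esub> d))"
proof -
  have "(a \<oplus>\<^bsub>H\<^esub> b) \<ominus>\<^bsub>H\<^esub> (c \<oplus>\<^bsub>H\<^esub> d) = (a \<ominus>\<^bsub>H\<^esub> c) \<oplus>\<^bsub>H\<^esub> (b \<ominus>\<^bsub>H\<^esub> d)"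
    using assms by (simp add: a_minus_def H.minus_add H.a_ac)
  then show ?thesis
    using assms absH_add_le by simp
qed

lemma absH_minus_diff:
  assumes "a \<in> carrier H" "b \<in> carrier H"
  shows "absH (\<ominus>\<^bsub>H\<^esub> a \<ominus>\<^bsub>H\<^esub> \<ominus>\<^bsub>H\<^esub> b) = absH (a \<ominus>\<^bsub>H\<^esub> b)"
proof -
  have "\<ominus>\<^bsub>H\<^esub> a \<ominus>\<^bsub>H\<^esub> \<ominus>\<^bsub>H\<^esub> b = \<ominus>\<^bsub>H\<^esub> (a \<ominus>\<^bsub>H\<^esub> b)"
    using assms by (simp add: a_minus_def H.minus_add)
  then show ?thesis
    using assms absH_minus by simp
qed

lemma mult_eq_zero_iff_H:
  "a \<in> carrier H \<Longrightarrow> b \<in> carrier H \<Longrightarrow> a \<otimes>\<^bsub>H\<^esub> b = \<zero>\<^bsub>H\<^esub> \<longleftrightarrow> a = \<zero>\<^bsub>H\<^esub> \<or> b = \<zero>\<^bsub>H\<^esub>"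
  using absH_eq_0_iff[of "a \<otimes>\<^bsub>H\<^esub> b"] absH_eq_0_iff[of a] absH_eq_0_iff[of b] by (simp add: absH_mult)

text \<open>
  An estimate for almost all terms of a Cauchy sequence is an estimate for its class.
\<close>

lemma cls_limit:
  assumes s: "s \<in> CS" and e: "\<And>m. N \<le> m \<Longrightarrow> nrm (s m - \<phi>) \<le> e" and \<phi>: "\<phi> \<in> regular_at x"
  shows "absH (cls s \<ominus>\<^bsub>H\<^esub> val \<phi>) \<le> e"
proof -
  have CS: "(\<lambda>m. s m - \<phi>) \<in> CS"
    using CS_add[OF s CS_minus[OF CS_const[OF \<phi>]]] by simp
  have "cls s \<ominus>\<^bsub>H\<^esub> val \<phi> = cls (\<lambda>m. s m - \<phi>)"
    using cls.hom_add[OF s CS_minus[OF CS_const[OF \<phi>]]] cls.hom_a_inv[OF CS_const[OF \<phi>]]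
    by (simp add: a_minus_def val_cls C_minus[OF CS_const[OF \<phi>]] C_simps)
  then have "absH (cls s \<ominus>\<^bsub>H\<^esub> val \<phi>) = cnorm (\<lambda>m. s m - \<phi>)"
    using residue_abs_cls[OF CS] by simp
  also have "\<dots> \<le> e"
    using cnorm_lim[OF CS] e by (intro LIMSEQ_le_const2) auto
  finally show ?thesis .
qed

lemma H_inverse:
  assumes a: "a \<in> carrier H" "a \<noteq> \<zero>\<^bsub>H\<^esub>"
  shows "\<exists>b\<in>carrier H. a \<otimes>\<^bsub>H\<^esub> b = \<one>\<^bsub>H\<^esub>"
proof -
  obtain s where s: "s \<in> CS" "a = cls s"
    using a(1) by (rule residue_cases)
  have pos: "0 < cnorm s"
    using a cls_eq_zero_iff[OF s(1)] cnorm_nonneg[OF s(1)] s(2) by simp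
  let ?\<delta> = "cnorm s / 2"
  have "\<forall>\<^sub>F n in sequentially. ?\<delta> < nrm (s n)"
    using cnorm_lim[OF s(1)] pos by (intro order_tendstoD(1)) auto
  then obtain K where K: "\<And>n. K \<le> n \<Longrightarrow> ?\<delta> < nrm (s n)"
    by (auto simp: eventually_sequentially)
  \<comment> \<open>finitely many terms of a Cauchy sequence may be changed; those which may be 0 are replaced by
    1\<close>
  define t where "t = (\<lambda>n. if ?\<delta> < nrm (s n) then inverse (s n) else 1)"
  have nz: "nrm (s n) \<noteq> 0" if "?\<delta> < nrm (s n)" for n
    using that pos by linarith
  have reg: "s n \<in> regular_at x" for n
    using s CS_regular by blast
  have tK: "t n = inverse (s n)" "t n \<in> regular_at x" "s n \<noteq> 0" "nrm (t n) \<le> 1 / ?\<delta>" if "K \<le> n" for n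
  proof -
    note inv = regular_inverse[OF reg nz[OF K[OF that]]] nrm_inverse[OF reg nz[OF K[OF that]]]
    show t: "t n = inverse (s n)" using K that by (simp add: t_def)
    show "t n \<in> regular_at x" "s n \<noteq> 0"
      using inv regular_nonzero[OF reg nz[OF K[OF that]]] unfolding t by blast+
    have "inverse (nrm (s n)) \<le> inverse ?\<delta>"
      using K[OF that] pos by (intro le_imp_inverse_le) auto
    then show "nrm (t n) \<le> 1 / ?\<delta>"
      using inv by (simp only: t inverse_eq_divide)
  qed
  have "t \<in> CS"
    unfolding CS_iff
  proof (intro conjI allI impI)
    fix n show "t n \<in> regular_at x"
      using regular_inverse[OF reg nz] by (simp add: t_def regular_1)
  next
    fix e :: real assume e: "0 < e"
    obtain M where M: "\<forall>m\<ge>M. \<forall>n\<ge>M. nrm (s m - s n) < e * ?\<delta> * ?\<delta>"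
      using CS_cauchy[OF s(1), of "e * ?\<delta> * ?\<delta>"] e pos by auto
    have "nrm (t m - t n) < e" if mn: "m \<ge> max M K" "n \<ge> max M K" for m n
    proof -
      have mK: "K \<le> m" "K \<le> n" using mn by auto
      have "t m - t n = (t m * t n) * (s n - s m)"
        using tK(1,3)[OF mK(1)] tK(1,3)[OF mK(2)] by (simp add: field_simps)
      then have "nrm (t m - t n) = nrm (t m) * nrm (t n) * nrm (s n - s m)"
        using tK(2)[OF mK(1)] tK(2)[OF mK(2)] reg by (simp only: nrm_mult regular_mult regular_diff)
      also have "\<dots> \<le> (1 / ?\<delta>) * (1 / ?\<delta>) * nrm (s n - s m)"
        using tK[OF mK(1)] tK[OF mK(2)] reg pos
        by (intro mult_mono nrm_nonneg regular_diff mult_nonneg_nonneg) auto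
      also have "\<dots> < (1 / ?\<delta>) * (1 / ?\<delta>) * (e * ?\<delta> * ?\<delta>)"
        using M mn pos by (intro mult_strict_left_mono) auto
      also have "\<dots> = e" using pos by simp
      finally show ?thesis .
    qed
    then show "\<exists>N. \<forall>m\<ge>N. \<forall>n\<ge>N. nrm (t m - t n) < e" by blast
  qed
  moreover have "cls s \<otimes>\<^bsub>H\<^esub> cls t = \<one>\<^bsub>H\<^esub>"
  proof -
    have st: "(\<lambda>n. s n * t n) \<in> CS"
      using s(1) \<open>t \<in> CS\<close> by (rule CS_mult)
    have "cls s \<otimes>\<^bsub>H\<^esub> cls t = cls (\<lambda>n. s n * t n)"
      using s(1) \<open>t \<in> CS\<close> by (simp add: C_simps flip: cls.hom_mult)
    moreover have "absH (cls (\<lambda>n. s n * t n) \<ominus>\<^bsub>H\<^esub> val 1) \<le> 0"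
      using tK by (intro cls_limit[OF st, of K] regular_1) (simp add: nrm_0)
    ultimately have le: "absH (cls s \<otimes>\<^bsub>H\<^esub> cls t \<ominus>\<^bsub>H\<^esub> \<one>\<^bsub>H\<^esub>) \<le> 0"
      by (simp add: val_1)
    have cl: "cls s \<otimes>\<^bsub>H\<^esub> cls t \<in> carrier H"
      using s(1) \<open>t \<in> CS\<close> by simp
    then have "absH (cls s \<otimes>\<^bsub>H\<^esub> cls t \<ominus>\<^bsub>H\<^esub> \<one>\<^bsub>H\<^esub>) = 0"
      using le by (intro antisym absH_nonneg H.minus_closed H.one_closed)
    then show ?thesis
      using absH_eq_0_iff[OF H.minus_closed[OF cl H.one_closed]] H_diff_eq_0_iff[OF cl H.one_closed] by blast
  qed
  ultimately show ?thesis
    using s by (intro bexI[of _ "cls t"]) auto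
qed

end

section \<open>Analytic functions\<close>

context valued_field
begin

lemma point: "x \<in> affine_line v \<Longrightarrow> point x"
  unfolding point_def by (rule affine_line_seminorm)

abbreviation An where "An \<equiv> analytic_ring v"

lemma An_simps:
  "f \<oplus>\<^bsub>An W\<^esub> g = (\<lambda>x\<in>W. f x \<oplus>\<^bsub>residue_field x\<^esub> g x)"
  "f \<otimes>\<^bsub>An W\<^esub> g = (\<lambda>x\<in>W. f x \<otimes>\<^bsub>residue_field x\<^esub> g x)"
  "\<zero>\<^bsub>An W\<^esub> = (\<lambda>x\<in>W. \<zero>\<^bsub>residue_field x\<^esub>)"
  "\<one>\<^bsub>An W\<^esub> = (\<lambda>x\<in>W. \<one>\<^bsub>residue_field x\<^esub>)"
  by (simp_all add: analytic_ring_def)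

lemma An_carrier:
  "f \<in> carrier (An W) \<longleftrightarrow> f \<in> (\<Pi>\<^sub>E x\<in>W. carrier (residue_field x)) \<and>
    (\<forall>V. affinoid v V \<and> V \<subseteq> W \<longrightarrow> fract_limit_on V f)"
  by (simp add: analytic_ring_def)

lemma An_value: "f \<in> carrier (An W) \<Longrightarrow> x \<in> W \<Longrightarrow> f x \<in> carrier (residue_field x)"
  by (auto simp: An_carrier)

lemma An_limit: "f \<in> carrier (An W) \<Longrightarrow> affinoid v V \<Longrightarrow> V \<subseteq> W \<Longrightarrow> fract_limit_on V f"
  by (simp add: An_carrier)

lemma An_extensional: "f \<in> carrier (An W) \<Longrightarrow> restrict f W = f"
  by (auto simp: An_carrier PiE_def extensional_restrict)

lemma An_eqI:
  assumes "f \<in> carrier (An W)" "g \<in> carrier (An W)" "\<And>x. x \<in> W \<Longrightarrow> f x = g x"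
  shows "f = g"
  using assms unfolding An_carrier by (metis PiE_ext)

lemma fract_limit_on_cong: "(\<And>x. x \<in> V \<Longrightarrow> f x = g x) \<Longrightarrow> fract_limit_on V f = fract_limit_on V g"
  by (simp add: fract_limit_on_def)

lemma fract_limit_onD:
  assumes "fract_limit_on V f" "0 < e"
  obtains \<phi> where "\<And>x. x \<in> V \<Longrightarrow> \<phi> \<in> regular_at x"
    "\<And>x. x \<in> V \<Longrightarrow> residue_abs x (f x \<ominus>\<^bsub>residue_field x\<^esub> fract_value x \<phi>) < e"
  using assms unfolding fract_limit_on_def by metis

lemma An_restrict:
  assumes "f \<in> carrier (An W)" "V \<subseteq> W"
  shows "restrict f V \<in> carrier (An V)"
  unfolding An_carrier
proof (intro conjI allI impI; (elim conjE)?)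
  show "restrict f V \<in> (\<Pi>\<^sub>E x\<in>V. carrier (residue_field x))"
    using assms by (auto simp: An_value)
  fix V' assume V': "affinoid v V'" "V' \<subseteq> V"
  have "fract_limit_on V' (restrict f V) = fract_limit_on V' f"
    using V' by (intro fract_limit_on_cong) auto
  then show "fract_limit_on V' (restrict f V)"
    using An_limit[OF assms(1) V'(1)] V' assms(2) by blast
qed

subsection \<open>Absolute values of analytic functions\<close>

lemma continuous_on_fract_seminorm:
  assumes V: "V \<subseteq> affine_line v" and \<phi>: "\<And>x. x \<in> V \<Longrightarrow> \<phi> \<in> regular_at x"
  shows "continuous_on V (\<lambda>x. fract_seminorm x \<phi>)"
  unfolding continuous_on_def
proof
  fix x assume x: "x \<in> V"
  then interpret x: point x using V point by blast
  obtain p q where pq: "x q \<noteq> 0" "\<phi> = Fract p q" "fract_seminorm x \<phi> = x p / x q"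
    using \<phi>[OF x] by (rule x.regularE)
  have lim: "((\<lambda>y :: 'a point. y p) \<longlongrightarrow> x p) (at x within V)" for p
    using continuous_on_eval[of V p] x by (simp add: continuous_on_def)
  have "((\<lambda>y. y p / y q) \<longlongrightarrow> x p / x q) (at x within V)"
    using pq by (intro tendsto_divide lim)
  moreover have "\<forall>\<^sub>F y in at x within V. y p / y q = fract_seminorm y \<phi>"
  proof -
    have "\<forall>\<^sub>F y in at x within V. y q \<noteq> 0"
      using lim[of q] pq(1) by (rule tendsto_imp_eventually_ne)
    moreover have "\<forall>\<^sub>F y in at x within V. y \<in> V"
      by (auto simp: eventually_at_filter)
    ultimately show ?thesis
    proof eventually_elim
      case (elim y)
      then interpret y: point y using V point by blast
      show ?case
        using y.fract_seminorm_Fract[OF elim(1)] by (simp add: pq)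
    qed
  qed
  ultimately show "((\<lambda>x. fract_seminorm x \<phi>) \<longlongrightarrow> fract_seminorm x \<phi>) (at x within V)"
    unfolding pq(3) by (rule Lim_transform_eventually)
qed

text \<open>
  The functions \<open>\<bar>\<phi>\<bar>\<close> for rational \<open>\<phi>\<close> are quotients of evaluations, hence continuous, and \<open>\<bar>f\<bar>\<close>
  is a uniform limit of such functions.
\<close>

lemma continuous_on_abs:
  assumes V: "V \<subseteq> affine_line v" and f: "\<And>x. x \<in> V \<Longrightarrow> f x \<in> carrier (residue_field x)"
    and lim: "fract_limit_on V f"
  shows "continuous_on V (\<lambda>x. residue_abs x (f x))"
proof -
  have "\<exists>\<phi>. \<forall>x\<in>V. \<phi> \<in> regular_at x \<and> residue_abs x (f x \<ominus>\<^bsub>residue_field x\<^esub> fract_value x \<phi>) < 1 / Suc n" for n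
    using lim unfolding fract_limit_on_def by (simp del: of_nat_Suc)
  then obtain \<phi> where reg: "\<And>n x. x \<in> V \<Longrightarrow> \<phi> n \<in> regular_at x"
    and \<phi>: "\<And>n x. x \<in> V \<Longrightarrow> residue_abs x (f x \<ominus>\<^bsub>residue_field x\<^esub> fract_value x (\<phi> n)) < 1 / Suc n"
    by metis
  have "uniform_limit V (\<lambda>n x. fract_seminorm x (\<phi> n)) (\<lambda>x. residue_abs x (f x)) sequentially"
  proof (rule uniform_limitI)
    fix e :: real assume "0 < e"
    have "\<forall>\<^sub>F n in sequentially. 1 / real (Suc n) < e"
      using LIMSEQ_Suc[OF lim_1_over_n] \<open>0 < e\<close> by (rule order_tendstoD)
    then show "\<forall>\<^sub>F n in sequentially. \<forall>x\<in>V. dist (fract_seminorm x (\<phi> n)) (residue_abs x (f x)) < e"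
    proof eventually_elim
      case (elim n)
      show ?case
      proof
        fix x assume x: "x \<in> V"
        then interpret x: point x using V point by blast
        show "dist (fract_seminorm x (\<phi> n)) (residue_abs x (f x)) < e"
          using x.absH_abs_diff_le[OF f[OF x] x.val_closed[OF reg[OF x]], of n] \<phi>[OF x, of n] elim
          by (simp add: dist_real_def x.absH_val[OF reg[OF x]])
      qed
    qed
  qed
  then show ?thesis
    using continuous_on_fract_seminorm[OF V reg] by (intro uniform_limit_theorem) auto
qed

lemma An_bounded:
  assumes "affinoid v V" "f \<in> carrier (An W)" "V \<subseteq> W"
  obtains C where "0 < C" "\<And>x. x \<in> V \<Longrightarrow> residue_abs x (f x) \<le> C"
proof -
  have "continuous_on V (\<lambda>x. residue_abs x (f x))"
    using assms An_value An_limit affinoid_subset_affine by (intro continuous_on_abs) blast+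
  then have "compact ((\<lambda>x. residue_abs x (f x)) ` V)"
    using compact_affinoid[OF assms(1)] by (rule compact_continuous_image)
  then have "bounded ((\<lambda>x. residue_abs x (f x)) ` V)"
    by (rule compact_imp_bounded)
  then obtain C where "0 < C" "\<And>x. x \<in> V \<Longrightarrow> norm (residue_abs x (f x)) \<le> C"
    by (auto simp: bounded_pos)
  then show ?thesis using that by (metis abs_le_D1 real_norm_def)
qed

lemma An_bounded_below:
  assumes V: "affinoid v V" and f: "f \<in> carrier (An W)" and VW: "V \<subseteq> W"
    and nz: "\<And>x. x \<in> V \<Longrightarrow> f x \<noteq> \<zero>\<^bsub>residue_field x\<^esub>"
  obtains c where "0 < c" "\<And>x. x \<in> V \<Longrightarrow> c \<le> residue_abs x (f x)"
proof (cases "V = {}")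
  case True
  then show ?thesis using that[of 1] by simp
next
  case False
  have "continuous_on V (\<lambda>x. residue_abs x (f x))"
    using assms An_value An_limit affinoid_subset_affine by (intro continuous_on_abs) blast+
  then obtain y where y: "y \<in> V" "\<And>x. x \<in> V \<Longrightarrow> residue_abs y (f y) \<le> residue_abs x (f x)"
    using continuous_attains_inf[OF compact_affinoid[OF V] False] by blast
  interpret y: point y using y affinoid_subset_affine[OF V] point by blast
  have "f y \<in> carrier (residue_field y)"
    using An_value f VW y(1) by blast
  then have "0 < residue_abs y (f y)"
    using y.absH_eq_0_iff y.absH_nonneg nz[OF y(1)] by (simp add: less_le)
  then show ?thesis using that y(2) by blast
qed

subsection \<open>The ring of analytic functions\<close>

lemma fract_limit_add:
  assumes V: "V \<subseteq> affine_line v"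
    and f: "\<And>x. x \<in> V \<Longrightarrow> f x \<in> carrier (residue_field x)" "fract_limit_on V f"
    and g: "\<And>x. x \<in> V \<Longrightarrow> g x \<in> carrier (residue_field x)" "fract_limit_on V g"
  shows "fract_limit_on V (\<lambda>x. f x \<oplus>\<^bsub>residue_field x\<^esub> g x)"
  unfolding fract_limit_on_def
proof (intro allI impI)
  fix e :: real assume e: "0 < e"
  obtain \<phi> where \<phi>: "\<And>x. x \<in> V \<Longrightarrow> \<phi> \<in> regular_at x"
    "\<And>x. x \<in> V \<Longrightarrow> residue_abs x (f x \<ominus>\<^bsub>residue_field x\<^esub> fract_value x \<phi>) < e"
    using fract_limit_onD[OF f(2) e] by blast
  obtain \<psi> where \<psi>: "\<And>x. x \<in> V \<Longrightarrow> \<psi> \<in> regular_at x"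
    "\<And>x. x \<in> V \<Longrightarrow> residue_abs x (g x \<ominus>\<^bsub>residue_field x\<^esub> fract_value x \<psi>) < e"
    using fract_limit_onD[OF g(2) e] by blast
  have "\<phi> + \<psi> \<in> regular_at x \<and>
      residue_abs x (f x \<oplus>\<^bsub>residue_field x\<^esub> g x \<ominus>\<^bsub>residue_field x\<^esub> fract_value x (\<phi> + \<psi>)) < e"
    if x: "x \<in> V" for x
  proof -
    interpret x: point x using V x point by blast
    show ?thesis
      using x.absH_add_diff_le[OF f(1)[OF x] g(1)[OF x] x.val_closed[OF \<phi>(1)[OF x]] x.val_closed[OF \<psi>(1)[OF x]]]
        \<phi>(2)[OF x] \<psi>(2)[OF x]
      by (simp add: x.val_add \<phi>(1)[OF x] \<psi>(1)[OF x] x.regular_add)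
  qed
  then show "\<exists>\<phi>. \<forall>x\<in>V. \<phi> \<in> regular_at x \<and>
      residue_abs x (f x \<oplus>\<^bsub>residue_field x\<^esub> g x \<ominus>\<^bsub>residue_field x\<^esub> fract_value x \<phi>) < e"
    by blast
qed

lemma fract_limit_minus:
  assumes V: "V \<subseteq> affine_line v"
    and f: "\<And>x. x \<in> V \<Longrightarrow> f x \<in> carrier (residue_field x)" "fract_limit_on V f"
  shows "fract_limit_on V (\<lambda>x. \<ominus>\<^bsub>residue_field x\<^esub> f x)"
  unfolding fract_limit_on_def
proof (intro allI impI)
  fix e :: real assume e: "0 < e"
  obtain \<phi> where \<phi>: "\<And>x. x \<in> V \<Longrightarrow> \<phi> \<in> regular_at x"
    "\<And>x. x \<in> V \<Longrightarrow> residue_abs x (f x \<ominus>\<^bsub>residue_field x\<^esub> fract_value x \<phi>) < e"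
    using fract_limit_onD[OF f(2) e] by blast
  have "- \<phi> \<in> regular_at x \<and>
      residue_abs x (\<ominus>\<^bsub>residue_field x\<^esub> f x \<ominus>\<^bsub>residue_field x\<^esub> fract_value x (- \<phi>)) < e"
    if x: "x \<in> V" for x
  proof -
    interpret x: point x using V x point by blast
    show ?thesis
      using x.absH_minus_diff[OF f(1)[OF x] x.val_closed[OF \<phi>(1)[OF x]]] \<phi>(2)[OF x]
      by (simp add: x.val_minus \<phi>(1)[OF x] x.regular_minus)
  qed
  then show "\<exists>\<phi>. \<forall>x\<in>V. \<phi> \<in> regular_at x \<and>
      residue_abs x (\<ominus>\<^bsub>residue_field x\<^esub> f x \<ominus>\<^bsub>residue_field x\<^esub> fract_value x \<phi>) < e"
    by blast
qed

lemma fract_limit_mult: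
  assumes V: "V \<subseteq> affine_line v"
    and f: "\<And>x. x \<in> V \<Longrightarrow> f x \<in> carrier (residue_field x)" "fract_limit_on V f"
    and g: "\<And>x. x \<in> V \<Longrightarrow> g x \<in> carrier (residue_field x)" "fract_limit_on V g"
    and bounds: "0 < A" "0 < B" "\<And>x. x \<in> V \<Longrightarrow> residue_abs x (f x) \<le> A" "\<And>x. x \<in> V \<Longrightarrow> residue_abs x (g x) \<le> B"
  shows "fract_limit_on V (\<lambda>x. f x \<otimes>\<^bsub>residue_field x\<^esub> g x)"
  unfolding fract_limit_on_def
proof (intro allI impI)
  fix e :: real assume e: "0 < e"
  let ?e = "e / B"
  have e': "0 < ?e" "0 < min B (e / A)"
    using e bounds by auto
  obtain \<phi> where \<phi>: "\<And>x. x \<in> V \<Longrightarrow> \<phi> \<in> regular_at x"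
    "\<And>x. x \<in> V \<Longrightarrow> residue_abs x (f x \<ominus>\<^bsub>residue_field x\<^esub> fract_value x \<phi>) < ?e"
    using fract_limit_onD[OF f(2) e'(1)] by blast
  \<comment> \<open>the bound by \<open>B\<close> makes \<open>\<psi>\<close> bounded by \<open>B\<close> as well; then the error splits into
    \<open>\<bar>f\<bar> \<bar>g - \<psi>\<bar> \<le> A (e/A)\<close> and \<open>\<bar>f - \<phi>\<bar> \<bar>\<psi>\<bar> \<le> (e/B) B\<close>\<close>
  obtain \<psi> where \<psi>: "\<And>x. x \<in> V \<Longrightarrow> \<psi> \<in> regular_at x"
    "\<And>x. x \<in> V \<Longrightarrow> residue_abs x (g x \<ominus>\<^bsub>residue_field x\<^esub> fract_value x \<psi>) < min B (e / A)"
    using fract_limit_onD[OF g(2) e'(2)] by blast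
  have "\<phi> * \<psi> \<in> regular_at x \<and>
      residue_abs x (f x \<otimes>\<^bsub>residue_field x\<^esub> g x \<ominus>\<^bsub>residue_field x\<^esub> fract_value x (\<phi> * \<psi>)) < e"
    if x: "x \<in> V" for x
  proof -
    interpret x: point x using V x point by blast
    let ?a = "f x" and ?b = "g x" and ?c = "fract_value x \<phi>" and ?d = "fract_value x \<psi>"
    note cl = f(1)[OF x] g(1)[OF x] x.val_closed[OF \<phi>(1)[OF x]] x.val_closed[OF \<psi>(1)[OF x]]
    have dB: "residue_abs x ?d \<le> B"
      using x.absH_le_max_diff[OF cl(4,2)] x.absH_diff_commute[OF cl(4,2)] \<psi>(2)[OF x] bounds(4)[OF x]
      by (auto simp: le_max_iff_disj)
    have "residue_abs x ?a * residue_abs x (?b \<ominus>\<^bsub>residue_field x\<^esub> ?d) \<le> A * residue_abs x (?b \<ominus>\<^bsub>residue_field x\<^esub> ?d)"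
      using bounds(3)[OF x] cl by (intro mult_right_mono x.absH_nonneg) auto
    also have "\<dots> < A * (e / A)"
      using \<psi>(2)[OF x] bounds by (intro mult_strict_left_mono) auto
    finally have 1: "residue_abs x ?a * residue_abs x (?b \<ominus>\<^bsub>residue_field x\<^esub> ?d) < e"
      using bounds by simp
    have "residue_abs x (?a \<ominus>\<^bsub>residue_field x\<^esub> ?c) * residue_abs x ?d \<le> residue_abs x (?a \<ominus>\<^bsub>residue_field x\<^esub> ?c) * B"
      using dB cl by (intro mult_left_mono x.absH_nonneg) auto
    also have "\<dots> < e / B * B"
      using \<phi>(2)[OF x] bounds by (intro mult_strict_right_mono) auto
    finally have 2: "residue_abs x (?a \<ominus>\<^bsub>residue_field x\<^esub> ?c) * residue_abs x ?d < e"
      using bounds by simp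
    have "residue_abs x (?a \<otimes>\<^bsub>residue_field x\<^esub> ?b \<ominus>\<^bsub>residue_field x\<^esub> ?c \<otimes>\<^bsub>residue_field x\<^esub> ?d) < e"
      using x.absH_mult_diff_le[OF cl(1,2,3,4)] 1 2 by simp
    then show ?thesis
      by (simp add: x.val_mult \<phi>(1)[OF x] \<psi>(1)[OF x] x.regular_mult)
  qed
  then show "\<exists>\<phi>. \<forall>x\<in>V. \<phi> \<in> regular_at x \<and>
      residue_abs x (f x \<otimes>\<^bsub>residue_field x\<^esub> g x \<ominus>\<^bsub>residue_field x\<^esub> fract_value x \<phi>) < e"
    by blast
qed

lemma An_fract:
  assumes "W \<subseteq> affine_line v" "\<And>x. x \<in> W \<Longrightarrow> \<phi> \<in> regular_at x"
  shows "(\<lambda>x\<in>W. fract_value x \<phi>) \<in> carrier (An W)"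
  unfolding An_carrier
proof (intro conjI allI impI; (elim conjE)?)
  show "(\<lambda>x\<in>W. fract_value x \<phi>) \<in> (\<Pi>\<^sub>E x\<in>W. carrier (residue_field x))"
    using assms point.val_closed[OF point] by auto
  fix V assume V: "affinoid v V" "V \<subseteq> W"
  show "fract_limit_on V (\<lambda>x\<in>W. fract_value x \<phi>)"
    unfolding fract_limit_on_def
  proof (intro allI impI exI[of _ \<phi>] ballI)
    fix e :: real and x assume e: "0 < e" and x: "x \<in> V"
    then interpret x: point x using V assms(1) point by blast
    have "\<phi> \<in> regular_at x" using assms x V by blast
    then show "\<phi> \<in> regular_at x \<and>
        residue_abs x ((\<lambda>x\<in>W. fract_value x \<phi>) x \<ominus>\<^bsub>residue_field x\<^esub> fract_value x \<phi>) < e"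
      using e x V by (simp add: subsetD a_minus_def x.H.r_neg x.val_closed x.absH_0)
  qed
qed

lemma An_zero_closed: "W \<subseteq> affine_line v \<Longrightarrow> \<zero>\<^bsub>An W\<^esub> \<in> carrier (An W)"
proof -
  assume W: "W \<subseteq> affine_line v"
  have "\<zero>\<^bsub>An W\<^esub> = (\<lambda>x\<in>W. fract_value x 0)"
    unfolding An_simps using W point.val_0[OF point] by (intro restrict_ext) (auto simp: subset_iff)
  then show ?thesis
    using An_fract[OF W, of 0] W point.regular_0[OF point] by auto
qed

lemma An_one_closed: "W \<subseteq> affine_line v \<Longrightarrow> \<one>\<^bsub>An W\<^esub> \<in> carrier (An W)"
proof -
  assume W: "W \<subseteq> affine_line v"
  have "\<one>\<^bsub>An W\<^esub> = (\<lambda>x\<in>W. fract_value x 1)"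
    unfolding An_simps using W point.val_1[OF point] by (intro restrict_ext) (auto simp: subset_iff)
  then show ?thesis
    using An_fract[OF W, of 1] W point.regular_1[OF point] by auto
qed

lemma point_cring: "x \<in> affine_line v \<Longrightarrow> cring (residue_field x)"
  by (rule point.cring_residue_field[OF point])

lemma point_ring: "x \<in> affine_line v \<Longrightarrow> ring (residue_field x)"
  using point_cring cring.axioms(1) by blast

lemma
  assumes W: "W \<subseteq> affine_line v" and f: "f \<in> carrier (An W)" and g: "g \<in> carrier (An W)"
  shows An_add_closed: "f \<oplus>\<^bsub>An W\<^esub> g \<in> carrier (An W)"
    and An_mult_closed: "f \<otimes>\<^bsub>An W\<^esub> g \<in> carrier (An W)"
    and An_minus_closed: "(\<lambda>x\<in>W. \<ominus>\<^bsub>residue_field x\<^esub> f x) \<in> carrier (An W)"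
proof -
  have cr: "cring (residue_field x)" "f x \<in> carrier (residue_field x)" "g x \<in> carrier (residue_field x)"
    if "x \<in> W" for x
    using that W f g An_value point_cring by blast+
  have lim: "fract_limit_on V (f \<oplus>\<^bsub>An W\<^esub> g)" "fract_limit_on V (f \<otimes>\<^bsub>An W\<^esub> g)"
    "fract_limit_on V (\<lambda>x\<in>W. \<ominus>\<^bsub>residue_field x\<^esub> f x)" if V: "affinoid v V" "V \<subseteq> W" for V
  proof -
    have VA: "V \<subseteq> affine_line v" using V W by blast
    have fV: "f x \<in> carrier (residue_field x)" and gV: "g x \<in> carrier (residue_field x)" if "x \<in> V" for x
      using that V cr by blast+
    note fl = An_limit[OF f V] and gl = An_limit[OF g V]
    obtain A where A: "0 < A" "\<And>x. x \<in> V \<Longrightarrow> residue_abs x (f x) \<le> A"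
      using An_bounded[OF V(1) f V(2)] by blast
    obtain B where B: "0 < B" "\<And>x. x \<in> V \<Longrightarrow> residue_abs x (g x) \<le> B"
      using An_bounded[OF V(1) g V(2)] by blast
    have "fract_limit_on V (\<lambda>x. f x \<oplus>\<^bsub>residue_field x\<^esub> g x)"
      using fV gV by (intro fract_limit_add VA fl gl)
    moreover have "fract_limit_on V (\<lambda>x. f x \<otimes>\<^bsub>residue_field x\<^esub> g x)"
      using fV gV A B by (intro fract_limit_mult[OF VA _ fl _ gl, of A B])
    moreover have "fract_limit_on V (\<lambda>x. \<ominus>\<^bsub>residue_field x\<^esub> f x)"
      using fV by (intro fract_limit_minus VA fl)
    moreover have "fract_limit_on V (restrict h W) = fract_limit_on V h" for h
      using V by (intro fract_limit_on_cong) auto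
    ultimately show "fract_limit_on V (f \<oplus>\<^bsub>An W\<^esub> g)" "fract_limit_on V (f \<otimes>\<^bsub>An W\<^esub> g)"
      "fract_limit_on V (\<lambda>x\<in>W. \<ominus>\<^bsub>residue_field x\<^esub> f x)"
      by (simp_all add: An_simps)
  qed
  have "f x \<oplus>\<^bsub>residue_field x\<^esub> g x \<in> carrier (residue_field x)"
    "f x \<otimes>\<^bsub>residue_field x\<^esub> g x \<in> carrier (residue_field x)"
    "\<ominus>\<^bsub>residue_field x\<^esub> f x \<in> carrier (residue_field x)" if x: "x \<in> W" for x
  proof -
    interpret cring "residue_field x" using cr(1)[OF x] .
    show "f x \<oplus>\<^bsub>residue_field x\<^esub> g x \<in> carrier (residue_field x)"
      "f x \<otimes>\<^bsub>residue_field x\<^esub> g x \<in> carrier (residue_field x)"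
      "\<ominus>\<^bsub>residue_field x\<^esub> f x \<in> carrier (residue_field x)"
      using cr(2,3)[OF x] by auto
  qed
  then show "f \<oplus>\<^bsub>An W\<^esub> g \<in> carrier (An W)" "f \<otimes>\<^bsub>An W\<^esub> g \<in> carrier (An W)"
    "(\<lambda>x\<in>W. \<ominus>\<^bsub>residue_field x\<^esub> f x) \<in> carrier (An W)"
    unfolding An_carrier using lim by (auto simp: An_simps)
qed

lemma cring_An:
  assumes W: "W \<subseteq> affine_line v"
  shows "cring (An W)"
proof -
  have cr: "cring (residue_field x)" if "x \<in> W" for x
    using that W point_cring by blast
  note rules = cring.cring_simprules[OF cr] monoid.r_one[OF ring.is_monoid[OF cring.axioms(1)[OF cr]]]
  have val: "f x \<in> carrier (residue_field x)" if "f \<in> carrier (An W)" "x \<in> W" for f x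
    using that An_value by blast
  note cl = An_add_closed[OF W] An_mult_closed[OF W] An_zero_closed[OF W] An_one_closed[OF W]
  have add_assoc: "f \<oplus>\<^bsub>An W\<^esub> g \<oplus>\<^bsub>An W\<^esub> h = f \<oplus>\<^bsub>An W\<^esub> (g \<oplus>\<^bsub>An W\<^esub> h)"
    and mult_assoc: "f \<otimes>\<^bsub>An W\<^esub> g \<otimes>\<^bsub>An W\<^esub> h = f \<otimes>\<^bsub>An W\<^esub> (g \<otimes>\<^bsub>An W\<^esub> h)"
    and distr: "(f \<oplus>\<^bsub>An W\<^esub> g) \<otimes>\<^bsub>An W\<^esub> h = f \<otimes>\<^bsub>An W\<^esub> h \<oplus>\<^bsub>An W\<^esub> g \<otimes>\<^bsub>An W\<^esub> h"
    if "f \<in> carrier (An W)" "g \<in> carrier (An W)" "h \<in> carrier (An W)" for f g h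
    using that by (intro An_eqI[of _ W] cl; simp add: An_simps rules val)+
  have add_comm: "f \<oplus>\<^bsub>An W\<^esub> g = g \<oplus>\<^bsub>An W\<^esub> f" and mult_comm: "f \<otimes>\<^bsub>An W\<^esub> g = g \<otimes>\<^bsub>An W\<^esub> f"
    if "f \<in> carrier (An W)" "g \<in> carrier (An W)" for f g
    using that by (intro An_eqI[of _ W] cl; simp add: An_simps rules val)+
  have zero_add: "\<zero>\<^bsub>An W\<^esub> \<oplus>\<^bsub>An W\<^esub> f = f" and one_mult: "\<one>\<^bsub>An W\<^esub> \<otimes>\<^bsub>An W\<^esub> f = f"
    if "f \<in> carrier (An W)" for f
    using that by (intro An_eqI[of _ W] cl; simp add: An_simps rules val)+
  have neg: "\<exists>g\<in>carrier (An W). g \<oplus>\<^bsub>An W\<^esub> f = \<zero>\<^bsub>An W\<^esub>" if f: "f \<in> carrier (An W)" for f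
  proof
    show "(\<lambda>x\<in>W. \<ominus>\<^bsub>residue_field x\<^esub> f x) \<oplus>\<^bsub>An W\<^esub> f = \<zero>\<^bsub>An W\<^esub>"
      unfolding An_simps by (rule restrict_ext) (simp add: rules val f)
  qed (rule An_minus_closed[OF W f f])
  show ?thesis
  proof (rule cringI)
    show "abelian_group (An W)"
      by (rule abelian_groupI; (rule add_assoc | rule add_comm | rule zero_add | rule neg | rule cl)?; assumption?)
    show "comm_monoid (An W)"
      by (rule comm_monoidI; (rule mult_assoc | rule mult_comm | rule one_mult | rule cl)?; assumption?)
  qed (rule distr)
qed

text \<open>
  On an affinoid domain \<open>\<bar>f\<bar>\<close> is bounded below by compactness. Hence the reciprocals of rational
  functions approximating \<open>f\<close> converge uniformly to the pointwise inverse of \<open>f\<close>.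
\<close>

lemma An_Units:
  assumes W: "W \<subseteq> affine_line v" and f: "f \<in> carrier (An W)"
    and nz: "\<And>x. x \<in> W \<Longrightarrow> f x \<noteq> \<zero>\<^bsub>residue_field x\<^esub>"
  shows "f \<in> Units (An W)"
proof -
  have fx: "f x \<in> carrier (residue_field x)" "point x" if "x \<in> W" for x
    using that f An_value W point by blast+
  have "\<exists>b\<in>carrier (residue_field x). f x \<otimes>\<^bsub>residue_field x\<^esub> b = \<one>\<^bsub>residue_field x\<^esub>" if "x \<in> W" for x
    using point.H_inverse[OF fx(2) fx(1) nz] that by blast
  then obtain g where g: "\<And>x. x \<in> W \<Longrightarrow> g x \<in> carrier (residue_field x)"
    "\<And>x. x \<in> W \<Longrightarrow> f x \<otimes>\<^bsub>residue_field x\<^esub> g x = \<one>\<^bsub>residue_field x\<^esub>"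
    by metis
  have "restrict g W \<in> carrier (An W)"
    unfolding An_carrier
  proof (intro conjI allI impI; (elim conjE)?)
    show "restrict g W \<in> (\<Pi>\<^sub>E x\<in>W. carrier (residue_field x))"
      using g by auto
    fix V assume V: "affinoid v V" "V \<subseteq> W"
    obtain c where c: "0 < c" "\<And>x. x \<in> V \<Longrightarrow> c \<le> residue_abs x (f x)"
      using An_bounded_below[OF V(1) f V(2)] nz V(2) by blast
    show "fract_limit_on V (restrict g W)"
      unfolding fract_limit_on_def
    proof (intro allI impI)
      fix e :: real assume e: "0 < e"
      \<comment> \<open>an error below \<open>c\<close> gives \<open>\<phi>\<close> the same norm as \<open>f\<close>, and
        \<open>\<bar>1/f - 1/\<phi>\<bar> = \<bar>\<phi> - f\<bar> / \<bar>f\<bar>^2 \<le> \<bar>\<phi> - f\<bar> / c^2\<close>\<close>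
      have "0 < min c (e * c * c)" using e c by simp
      then obtain \<phi> where \<phi>: "\<And>x. x \<in> V \<Longrightarrow> \<phi> \<in> regular_at x"
        "\<And>x. x \<in> V \<Longrightarrow> residue_abs x (f x \<ominus>\<^bsub>residue_field x\<^esub> fract_value x \<phi>) < min c (e * c * c)"
        using fract_limit_onD[OF An_limit[OF f V]] by blast
      have "inverse \<phi> \<in> regular_at x \<and>
          residue_abs x (restrict g W x \<ominus>\<^bsub>residue_field x\<^esub> fract_value x (inverse \<phi>)) < e" if x: "x \<in> V" for x
      proof -
        have xW: "x \<in> W" using x V by blast
        interpret x: point x using fx(2)[OF xW] .
        let ?\<phi> = "fract_value x \<phi>" and ?\<psi> = "fract_value x (inverse \<phi>)"
        note reg = \<phi>(1)[OF x]
        have "residue_abs x ?\<phi> = residue_abs x (f x)"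
          using x.absH_eq_of_diff_less[OF fx(1)[OF xW] x.val_closed[OF reg]] \<phi>(2)[OF x] c(2)[OF x] by simp
        then have nrm: "x.nrm \<phi> = residue_abs x (f x)" by (simp add: x.absH_val reg)
        then have nz': "x.nrm \<phi> \<noteq> 0" using c(1) c(2)[OF x] by simp
        note inv = x.regular_inverse[OF reg nz'] x.regular_nonzero[OF reg nz'] x.nrm_inverse[OF reg nz']
        have one: "?\<phi> \<otimes>\<^bsub>residue_field x\<^esub> ?\<psi> = \<one>\<^bsub>residue_field x\<^esub>"
          using inv reg by (simp add: x.val_1 flip: x.val_mult)
        note cl = fx(1)[OF xW] g(1)[OF xW] x.val_closed[OF reg] x.val_closed[OF inv(1)]
        have "(g x \<ominus>\<^bsub>residue_field x\<^esub> ?\<psi>) \<otimes>\<^bsub>residue_field x\<^esub> (f x \<otimes>\<^bsub>residue_field x\<^esub> ?\<phi>)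
            = ?\<phi> \<ominus>\<^bsub>residue_field x\<^esub> f x"
        proof -
          have "(g x \<ominus>\<^bsub>residue_field x\<^esub> ?\<psi>) \<otimes>\<^bsub>residue_field x\<^esub> (f x \<otimes>\<^bsub>residue_field x\<^esub> ?\<phi>)
              = (f x \<otimes>\<^bsub>residue_field x\<^esub> g x) \<otimes>\<^bsub>residue_field x\<^esub> ?\<phi>
                \<ominus>\<^bsub>residue_field x\<^esub> f x \<otimes>\<^bsub>residue_field x\<^esub> (?\<phi> \<otimes>\<^bsub>residue_field x\<^esub> ?\<psi>)"
            using cl by (simp add: a_minus_def x.H.l_distr x.H.r_distr x.H.l_minus x.H.r_minus x.H.m_ac)
          then show ?thesis
            using cl by (simp add: g(2)[OF xW] one)
        qed
        then have "residue_abs x (g x \<ominus>\<^bsub>residue_field x\<^esub> ?\<psi>) * (residue_abs x (f x) * residue_abs x (f x))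
            = residue_abs x (?\<phi> \<ominus>\<^bsub>residue_field x\<^esub> f x)"
          using cl nrm by (metis x.absH_mult x.H.minus_closed x.H.m_closed x.absH_val[OF reg])
        also have "\<dots> < e * (c * c)"
          using \<phi>(2)[OF x] x.absH_diff_commute[OF cl(1,3)] by (simp add: mult.assoc)
        also have "\<dots> \<le> e * (residue_abs x (f x) * residue_abs x (f x))"
          using e c(1) c(2)[OF x] by (intro mult_left_mono mult_mono) auto
        finally have "residue_abs x (g x \<ominus>\<^bsub>residue_field x\<^esub> ?\<psi>) < e"
          using c(1) c(2)[OF x] mult_less_cancel_right_pos by (smt (verit) mult_pos_pos)
        then show ?thesis
          using inv xW by simp
      qed
      then show "\<exists>\<phi>. \<forall>x\<in>V. \<phi> \<in> regular_at x \<and>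
          residue_abs x (restrict g W x \<ominus>\<^bsub>residue_field x\<^esub> fract_value x \<phi>) < e"
        by blast
    qed
  qed
  moreover have "f \<otimes>\<^bsub>An W\<^esub> restrict g W = \<one>\<^bsub>An W\<^esub>"
    by (auto simp: An_simps g intro!: restrict_ext)
  moreover have "restrict g W \<otimes>\<^bsub>An W\<^esub> f = f \<otimes>\<^bsub>An W\<^esub> restrict g W"
    using calculation(1) f comm_monoid.m_comm[OF cring.axioms(2)[OF cring_An[OF W]]] by blast
  ultimately show ?thesis
    using f by (auto simp: Units_def)
qed

subsection \<open>Non-vanishing at nearby points\<close>

text \<open>
  Approximate \<open>f\<close> by a rational function with an error below \<open>\<bar>f(x)\<bar>\<close>. This rational function has
  the norm \<open>\<bar>f(x)\<bar>\<close> at \<open>x\<close>, and this norm is constant along the path for small \<open>s\<close>; so \<open>f\<close> keeps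
  this norm as well.
\<close>

lemma An_nonzero_move:
  assumes V: "affinoid v V" and f: "f \<in> carrier (An V)" and x: "x \<in> V"
    and nz: "f x \<noteq> \<zero>\<^bsub>residue_field x\<^esub>"
  shows "\<exists>s0>0. \<forall>s. 0 < s \<and> s \<le> s0 \<longrightarrow> move x s \<in> V \<and> f (move x s) \<noteq> \<zero>\<^bsub>residue_field (move x s)\<^esub>"
proof -
  have xa: "x \<in> affine_line v" using x affinoid_subset_affine[OF V] by blast
  interpret x: point x using xa by (rule point)
  have pos: "0 < residue_abs x (f x)"
    using x.absH_eq_0_iff x.absH_nonneg An_value[OF f x] nz by (simp add: less_le)
  obtain \<phi> where \<phi>: "\<And>x. x \<in> V \<Longrightarrow> \<phi> \<in> regular_at x"
    "\<And>y. y \<in> V \<Longrightarrow> residue_abs y (f y \<ominus>\<^bsub>residue_field y\<^esub> fract_value y \<phi>) < residue_abs x (f x)"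
    using fract_limit_onD[OF An_limit[OF f V subset_refl] pos] by blast
  have eq: "residue_abs x (fract_value x \<phi>) = residue_abs x (f x)"
    using x.absH_eq_of_diff_less[OF An_value[OF f x] x.val_closed[OF \<phi>(1)[OF x]]] \<phi>(2)[OF x] by simp
  obtain p q where pq: "x q \<noteq> 0" "\<phi> = Fract p q" "x.nrm \<phi> = x p / x q"
    using \<phi>(1)[OF x] by (rule x.regularE)
  have xp: "x p \<noteq> 0" and nrm: "x.nrm \<phi> = residue_abs x (f x)"
    using pq pos eq x.absH_val[OF \<phi>(1)[OF x]] by auto
  obtain s1 where s1: "0 < s1" "\<And>s. 0 < s \<Longrightarrow> s \<le> s1 \<Longrightarrow> move x s \<in> V"
    using move_in_affinoid[OF V x] by blast
  obtain s2 where s2: "0 < s2" "\<And>s. 0 < s \<Longrightarrow> s \<le> s2 \<Longrightarrow> move x s p = x p"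
    using move_small_eq[OF xa xp] by blast
  obtain s3 where s3: "0 < s3" "\<And>s. 0 < s \<Longrightarrow> s \<le> s3 \<Longrightarrow> move x s q = x q"
    using move_small_eq[OF xa pq(1)] by blast
  have "move x s \<in> V \<and> f (move x s) \<noteq> \<zero>\<^bsub>residue_field (move x s)\<^esub>"
    if s: "0 < s" "s \<le> min s1 (min s2 s3)" for s
  proof -
    let ?y = "move x s"
    have y: "?y \<in> V" using s1 s by simp
    interpret y: point ?y using y affinoid_subset_affine[OF V] point by blast
    have "?y q \<noteq> 0" "?y p = x p" "?y q = x q" using s2(2) s3(2) s pq(1) by auto
    then have "y.nrm \<phi> = residue_abs x (f x)"
      using y.fract_seminorm_Fract[of q p] nrm pq by simp
    then have "residue_abs ?y (f ?y) = residue_abs x (f x)"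
      using y.absH_eq_of_diff_less'[OF An_value[OF f y] y.val_closed[OF \<phi>(1)[OF y]]] \<phi>(2)[OF y]
        y.absH_val[OF \<phi>(1)[OF y]] by simp
    then show ?thesis
      using y pos y.absH_0 by auto
  qed
  then show ?thesis
    using s1(1) s2(1) s3(1) by (intro exI[of _ "min s1 (min s2 s3)"]) auto
qed

text \<open>
  A function of this kind on a closed disc is a convergent power series.
\<close>

definition poly_limit :: "'a point set \<Rightarrow> 'a sect \<Rightarrow> (nat \<Rightarrow> 'a poly) \<Rightarrow> bool" where
  "poly_limit V h P \<longleftrightarrow> (\<forall>e>0. \<exists>N. \<forall>n\<ge>N. \<forall>x\<in>V.
     residue_abs x (h x \<ominus>\<^bsub>residue_field x\<^esub> fract_value x (Fract (P n) 1)) < e)"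

lemma Fract_1_regular: "x \<in> affine_line v \<Longrightarrow> Fract p 1 \<in> regular_at x"
  and Fract_1_nrm: "x \<in> affine_line v \<Longrightarrow> fract_seminorm x (Fract p 1) = x p"
  using point.Fract_regular[OF point, of x 1 p] point.fract_seminorm_Fract[OF point, of x 1 p]
    mult_seminorm.one[OF affine_line_seminorm, of x] by auto

text \<open>
  The polynomials which approximate \<open>h\<close> have the same norm at the Gauss point of radius \<open>r\<close> from
  some index on, and they differ there by less than this norm. So \<open>move_lower_bound\<close> bounds all of
  them below at \<open>move x s\<close> by one positive constant.
\<close>

lemma poly_limit_nonzero_move:
  assumes r: "0 < r" and h: "h \<in> carrier (An (closed_disc v r))" and P: "poly_limit (closed_disc v r) h P"
    and nz: "h (gauss v r) \<noteq> \<zero>\<^bsub>residue_field (gauss v r)\<^esub>"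
    and x: "x \<in> closed_disc v r" and s: "0 < s" "s \<le> r"
  shows "h (move x s) \<noteq> \<zero>\<^bsub>residue_field (move x s)\<^esub>"
proof -
  let ?D = "closed_disc v r" and ?\<eta> = "gauss v r" and ?y = "move x s"
  have xa: "x \<in> affine_line v" "x T \<le> r" using x by (auto simp: closed_disc_def)
  have \<eta>: "?\<eta> \<in> ?D" "?\<eta> \<in> affine_line v" using r by (simp_all add: closed_disc_def gauss_in_affine_line gauss_T)
  have ya: "?y \<in> affine_line v" using xa s by (simp add: move_in_affine_line)
  then have y: "?y \<in> ?D" using xa s by (simp add: closed_disc_def move_T)
  interpret \<eta>: point ?\<eta> using \<eta>(2) by (rule point)
  interpret y: point ?y using ya by (rule point)
  define M where "M = residue_abs ?\<eta> (h ?\<eta>)"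
  have M: "0 < M"
    unfolding M_def using \<eta>.absH_eq_0_iff \<eta>.absH_nonneg An_value[OF h \<eta>(1)] nz by (simp add: less_le)
  obtain m where m: "\<And>n x. m \<le> n \<Longrightarrow> x \<in> ?D \<Longrightarrow>
      residue_abs x (h x \<ominus>\<^bsub>residue_field x\<^esub> fract_value x (Fract (P n) 1)) < M"
    using P M unfolding poly_limit_def by blast
  note regs = Fract_1_regular[OF \<eta>(2)] Fract_1_regular[OF ya]
  have \<eta>P: "?\<eta> (P n) = M" if "m \<le> n" for n
    using \<eta>.absH_eq_of_diff_less[OF An_value[OF h \<eta>(1)] \<eta>.val_closed[OF regs(1)], of "P n"] m[OF that \<eta>(1)]
    by (simp add: M_def \<eta>.absH_val regs Fract_1_nrm[OF \<eta>(2)])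
  have close: "?\<eta> (P n - P m) < M" if "m \<le> n" for n
  proof -
    have "?\<eta> (P n - P m) = residue_abs ?\<eta> (fract_value ?\<eta> (Fract (P n) 1) \<ominus>\<^bsub>residue_field ?\<eta>\<^esub> fract_value ?\<eta> (Fract (P m) 1))"
      using regs by (simp add: \<eta>.absH_val Fract_1_nrm[OF \<eta>(2)] flip: \<eta>.val_diff)
    also have "\<dots> \<le> max (residue_abs ?\<eta> (fract_value ?\<eta> (Fract (P n) 1) \<ominus>\<^bsub>residue_field ?\<eta>\<^esub> h ?\<eta>))
        (residue_abs ?\<eta> (h ?\<eta> \<ominus>\<^bsub>residue_field ?\<eta>\<^esub> fract_value ?\<eta> (Fract (P m) 1)))"
      using An_value[OF h \<eta>(1)] \<eta>.val_closed[OF regs(1)] by (intro \<eta>.absH_triangle)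
    also have "\<dots> < M"
      using m[OF that \<eta>(1)] m[OF order_refl \<eta>(1)]
        \<eta>.absH_diff_commute[OF An_value[OF h \<eta>(1)] \<eta>.val_closed[OF regs(1)], of "P n"] by simp
    finally show ?thesis .
  qed
  define c where "c = M * (s / r) ^ degree (P m)"
  have c: "0 < c" using M s r by (simp add: c_def)
  have yP: "c \<le> ?y (P n)" if "m \<le> n" for n
    using move_lower_bound[OF xa(1) s xa(2), of "P n" "P m" "degree (P m)"] close[OF that] \<eta>P[OF that]
    by (simp add: c_def)
  obtain N where N: "\<And>n x. N \<le> n \<Longrightarrow> x \<in> ?D \<Longrightarrow>
      residue_abs x (h x \<ominus>\<^bsub>residue_field x\<^esub> fract_value x (Fract (P n) 1)) < c"
    using P c unfolding poly_limit_def by blast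
  let ?n = "max m N"
  have "residue_abs ?y (h ?y) = residue_abs ?y (fract_value ?y (Fract (P ?n) 1))"
    using y.absH_eq_of_diff_less'[OF An_value[OF h y] y.val_closed[OF regs(2)], of "P ?n"]
      N[OF max.cobounded2 y, of m] yP[of ?n]
    by (simp add: y.absH_val regs Fract_1_nrm[OF ya])
  also have "\<dots> = ?y (P ?n)"
    by (simp add: y.absH_val regs Fract_1_nrm[OF ya])
  finally have "0 < residue_abs ?y (h ?y)"
    using yP[of ?n] c by simp
  then show ?thesis
    using y.absH_0 by auto
qed

text \<open>
  If \<open>h c = 0\<close> but \<open>c(x) \<noteq> 0\<close>, then \<open>c\<close> does not vanish at the points \<open>move x s\<close> for small \<open>s\<close>,
  where \<open>h\<close> does not vanish either; this is impossible in a field.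
\<close>

lemma regular_of_poly_limit:
  assumes r: "0 < r" and h: "h \<in> carrier (An (closed_disc v r))" and P: "poly_limit (closed_disc v r) h P"
    and nz: "h (gauss v r) \<noteq> \<zero>\<^bsub>residue_field (gauss v r)\<^esub>"
  shows "regular_element v (closed_disc v r) h"
  unfolding regular_element_def
proof (intro conjI allI impI h; elim conjE)
  fix V c
  assume V: "affinoid v V" "V \<subseteq> closed_disc v r" and c: "c \<in> carrier (An V)"
    and 0: "restrict h V \<otimes>\<^bsub>An V\<^esub> c = \<zero>\<^bsub>An V\<^esub>"
  have VA: "V \<subseteq> affine_line v" using V(1) by (rule affinoid_subset_affine)
  have "c x = \<zero>\<^bsub>residue_field x\<^esub>" if x: "x \<in> V" for x
  proof (rule ccontr)
    assume "c x \<noteq> \<zero>\<^bsub>residue_field x\<^esub>"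
    then obtain s0 where s0: "0 < s0"
      "\<And>s. 0 < s \<Longrightarrow> s \<le> s0 \<Longrightarrow> move x s \<in> V \<and> c (move x s) \<noteq> \<zero>\<^bsub>residue_field (move x s)\<^esub>"
      using An_nonzero_move[OF V(1) c x] by blast
    define s where "s = min s0 r"
    let ?y = "move x s"
    have s: "0 < s" "s \<le> r" "s \<le> s0" using s0 r by (auto simp: s_def)
    have y: "?y \<in> V" "c ?y \<noteq> \<zero>\<^bsub>residue_field ?y\<^esub>" using s0(2) s by auto
    interpret y: point ?y using y VA point by blast
    have "h ?y \<noteq> \<zero>\<^bsub>residue_field ?y\<^esub>"
      using x V s by (intro poly_limit_nonzero_move[OF r h P nz]) auto
    moreover have "h ?y \<otimes>\<^bsub>residue_field ?y\<^esub> c ?y = \<zero>\<^bsub>residue_field ?y\<^esub>"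
      using fun_cong[OF 0, of ?y] y by (simp add: An_simps)
    moreover have "h ?y \<in> carrier (residue_field ?y)" "c ?y \<in> carrier (residue_field ?y)"
      using An_value[OF h] An_value[OF c] y V by auto
    ultimately show False
      using y.mult_eq_zero_iff_H y(2) by blast
  qed
  then show "c = \<zero>\<^bsub>An V\<^esub>"
    using c An_zero_closed[OF VA] by (intro An_eqI) (auto simp: An_simps)
qed

end

section \<open>Laurent expansions\<close>

subsection \<open>Rational functions without poles on an annulus\<close>

lemma (in mult_seminorm) gauss_const_mult_pow: "0 < s \<Longrightarrow> gauss N s ([:0, 1:] ^ n * p) = s ^ n * gauss N s p"
proof -
  assume s: "0 < s"
  interpret g: mult_seminorm "gauss N s" using s by (rule mult_seminorm_gauss)
  have "gauss N s [:0, 1:] = s" using gauss_monom_1[OF s, of 0] s by (simp add: zero)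
  then show ?thesis by (simp only: g.mult g.power)
qed

context valued_field
begin

lemma gauss_in_annulus: "0 < s \<Longrightarrow> r1 \<le> s \<Longrightarrow> s \<le> r2 \<Longrightarrow> gauss v s \<in> annulus r1 r2"
  by (simp add: annulus_def gauss_in_affine_line gauss_T)

lemma annulus_affine: "annulus r1 r2 \<subseteq> affine_line v"
  by (auto simp: annulus_def)

text \<open>
  The conclusion says that \<open>u = (T^m + h q) / T^m\<close> has norm at most \<open>\<delta> < 1\<close> on the annulus, that
  is, that \<open>-h / T^m\<close> inverts \<open>q\<close> up to an error of norm at most \<open>\<delta>\<close>. If this fails, 1 has
  distance at least 1 from all multiples of \<open>q\<close>, so the quotient seminorm modulo \<open>q\<close> on Laurent
  polynomials has the value 1 at 1. A multiplicative seminorm below it is a point of the annulus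
  at which \<open>q\<close> vanishes.
\<close>

lemma annulus_contraction:
  assumes r: "0 < r1" "r1 \<le> r2" and q: "\<forall>x\<in>annulus r1 r2. x q \<noteq> 0"
  shows "\<exists>m h \<delta>. 0 \<le> \<delta> \<and> \<delta> < 1 \<and> (\<forall>x\<in>annulus r1 r2. x (T ^ m + h * q) \<le> \<delta> * x T ^ m)"
proof -
  have r2: "0 < r2" using r by simp
  interpret g1: mult_seminorm "gauss v r1" using r(1) by (rule mult_seminorm_gauss)
  interpret g2: mult_seminorm "gauss v r2" using r2 by (rule mult_seminorm_gauss)
  \<comment> \<open>the norm on the annulus of the Laurent polynomial \<open>g + (h / T^m) q\<close>: the supremum over an
    annulus is the larger one of the two Gauss norms of extremal radius\<close>
  define E where "E g m h = max (gauss v r1 (T ^ m * g + h * q) / r1 ^ m) (gauss v r2 (T ^ m * g + h * q) / r2 ^ m)" for g m h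
  have E_nonneg: "0 \<le> E g m h" for g m h
    using r r2 by (simp add: E_def g1.nonneg le_max_iff_disj)
  have E_less_iff: "E g m h < s \<longleftrightarrow> gauss v r1 (T ^ m * g + h * q) < s * r1 ^ m \<and> gauss v r2 (T ^ m * g + h * q) < s * r2 ^ m" for g m h s
    using r r2 by (simp add: E_def pos_divide_less_eq)
  have E_le_iff: "E g m h \<le> s \<longleftrightarrow> gauss v r1 (T ^ m * g + h * q) \<le> s * r1 ^ m \<and> gauss v r2 (T ^ m * g + h * q) \<le> s * r2 ^ m" for g m h s
    using r r2 by (simp add: E_def pos_divide_le_eq)
  have "\<exists>m h. E 1 m h < 1"
  proof (rule ccontr)
    assume "\<not> ?thesis"
    then have E1: "1 \<le> E 1 m h" for m h by (meson not_le)
    \<comment> \<open>the quotient seminorm modulo \<open>q\<close>\<close>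
    define N where "N g = Inf (range (\<lambda>(m, h). E g m h))" for g
    have N_le: "N g \<le> E g m h" for g m h
      unfolding N_def by (rule Inf_le_nonneg) (auto simp: E_nonneg intro: range_eqI[of _ _ "(m, h)"])
    have N_less: "\<exists>m h. E g m h < s" if less: "N g < s" for g s
    proof -
      obtain y where "y \<in> range (\<lambda>(m, h). E g m h)" "y < s"
        by (rule Inf_less_obtain[OF less[unfolded N_def]]) (auto simp: E_nonneg)
      then show ?thesis by auto
    qed
    have N_nonneg: "0 \<le> N g" for g
      unfolding N_def by (rule cInf_greatest) (auto simp: E_nonneg)
    interpret N: ring_seminorm N
    proof
      fix a b
      show "0 \<le> N a" by (rule N_nonneg)
      have "E 0 0 0 = 0" by (simp add: E_def g1.zero g2.zero)
      then show "N 0 = 0" using N_le[of 0 0 0] N_nonneg[of 0] by simp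
      have "E 1 0 0 = 1" by (simp add: E_def g1.one g2.one)
      then have "N 1 \<le> 1" using N_le[of 1 0 0] by simp
      moreover have "1 \<le> N 1"
        unfolding N_def using E1 by (intro cInf_greatest) auto
      ultimately show "N 1 = 1" by simp
      show "N (a + b) \<le> max (N a) (N b)"
      proof (rule dense_ge)
        fix s assume "max (N a) (N b) < s"
        then obtain m h m' h' where mh: "E a m h < s" "E b m' h' < s"
          using N_less by (metis max_less_iff_conj)
        have eq: "T ^ (m + m') * (a + b) + (T ^ m' * h + T ^ m * h') * q
            = T ^ m' * (T ^ m * a + h * q) + T ^ m * (T ^ m' * b + h' * q)"
          by (simp add: algebra_simps power_add)
        have bound: "gauss v r (T ^ (m + m') * (a + b) + (T ^ m' * h + T ^ m * h') * q) < s * r ^ (m + m')"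
          if r: "0 < r" and l: "gauss v r (T ^ m * a + h * q) < s * r ^ m" "gauss v r (T ^ m' * b + h' * q) < s * r ^ m'" for r
        proof -
          have "gauss v r (T ^ (m + m') * (a + b) + (T ^ m' * h + T ^ m * h') * q)
              \<le> max (gauss v r (T ^ m' * (T ^ m * a + h * q))) (gauss v r (T ^ m * (T ^ m' * b + h' * q)))"
            unfolding eq by (rule gauss_add_le[OF r])
          also have "\<dots> = max (r ^ m' * gauss v r (T ^ m * a + h * q)) (r ^ m * gauss v r (T ^ m' * b + h' * q))"
            by (simp only: gauss_const_mult_pow[OF r])
          also have "\<dots> < s * r ^ (m + m')"
            using mult_strict_left_mono[OF l(1), of "r ^ m'"] mult_strict_left_mono[OF l(2), of "r ^ m"] r
            by (simp add: power_add mult_ac)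
          finally show ?thesis .
        qed
        have "E (a + b) (m + m') (T ^ m' * h + T ^ m * h') < s"
          using mh r r2 unfolding E_less_iff by (blast intro: bound)
        then show "N (a + b) \<le> s"
          using N_le[of "a + b"] by (meson less_imp_le order_trans)
      qed
      show "N (a * b) \<le> N a * N b"
      proof (rule le_mult_if_le_above)
        fix s s' assume "N a < s" "N b < s'"
        then obtain m h m' h' where mh: "E a m h < s" "E b m' h' < s'"
          using N_less by metis
        have s: "0 \<le> s" "0 \<le> s'" using mh E_nonneg[of a m h] E_nonneg[of b m' h'] by linarith+
        let ?H = "T ^ m * a * h' + T ^ m' * b * h + h * h' * q"
        have eq: "T ^ (m + m') * (a * b) + ?H * q = (T ^ m * a + h * q) * (T ^ m' * b + h' * q)"
          by (simp add: algebra_simps power_add)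
        have bound: "gauss v r (T ^ (m + m') * (a * b) + ?H * q) \<le> (s * s') * r ^ (m + m')"
          if r: "0 < r" and l: "gauss v r (T ^ m * a + h * q) < s * r ^ m" "gauss v r (T ^ m' * b + h' * q) < s' * r ^ m'" for r
        proof -
          have "gauss v r (T ^ (m + m') * (a * b) + ?H * q) = gauss v r (T ^ m * a + h * q) * gauss v r (T ^ m' * b + h' * q)"
            unfolding eq by (rule gauss_mult[OF r])
          also have "\<dots> \<le> (s * r ^ m) * (s' * r ^ m')"
            using l s r by (intro mult_mono gauss_nonneg) auto
          finally show ?thesis by (simp add: power_add mult_ac)
        qed
        have "E (a * b) (m + m') ?H \<le> s * s'"
          using mh r r2 unfolding E_less_iff E_le_iff by (blast intro: bound)
        then show "N (a * b) \<le> s * s'"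
          using N_le[of "a * b"] by (meson order_trans)
      qed (rule N_nonneg)+
    qed
    \<comment> \<open>on the annulus \<open>1/T\<close> has norm \<open>1/r1\<close>; this yields \<open>r1 \<le> x T\<close> below\<close>
    have scale: "r1 * N g \<le> N (T * g)" for g
    proof (rule dense_ge)
      fix s assume "N (T * g) < s"
      then obtain m h where mh: "E (T * g) m h < s" using N_less by blast
      have "0 \<le> s" using mh E_nonneg[of "T * g" m h] by linarith
      have eq: "T ^ Suc m * g + h * q = T ^ m * (T * g) + h * q"
        by (simp add: mult_ac)
      have bound: "gauss v r (T ^ Suc m * g + h * q) \<le> (s / r1) * r ^ Suc m"
        if r': "r1 \<le> r" and l: "gauss v r (T ^ m * (T * g) + h * q) < s * r ^ m" for r
      proof -
        have "s * r ^ m \<le> s * r ^ m * (r / r1)"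
          using mult_left_mono[of 1 "r / r1" "s * r ^ m"] r' r \<open>0 \<le> s\<close> by simp
        also have "\<dots> = (s / r1) * r ^ Suc m" by simp
        finally show ?thesis unfolding eq using l by simp
      qed
      have "E g (Suc m) h \<le> s / r1"
        using mh r unfolding E_less_iff E_le_iff by (blast intro: bound)
      then have "N g \<le> s / r1"
        using N_le[of g] by (meson order_trans)
      then show "r1 * N g \<le> s" using r by (simp add: field_simps)
    qed
    obtain x where x: "mult_seminorm x" "\<And>a. x a \<le> N a" "\<And>a. r1 * x a \<le> x (T * a)"
      using N.exists_mult_seminorm_below[OF r(1) scale] by blast
    interpret x: mult_seminorm x by (rule x(1))
    have x_const_le: "x [:c:] \<le> v c" for c
      using x(2)[of "[:c:]"] N_le[of "[:c:]" 0 0]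
      by (simp add: E_def gauss_const[OF r(1)] gauss_const[OF r2])
    have x_const: "x [:c:] = v c" for c
    proof (cases "c = 0")
      case True
      then show ?thesis using x_const_le[of 0] x.nonneg[of "[:0:]"] by (simp add: zero)
    next
      case False
      have "x [:c:] * x [:inverse c:] = 1"
        using False x.one by (simp add: one_pCons flip: x.mult)
      moreover have "x [:c:] * x [:inverse c:] \<le> x [:c:] * inverse (v c)"
        using x_const_le[of "inverse c"] by (intro mult_left_mono x.nonneg) (simp add: v_inverse)
      ultimately have "v c \<le> x [:c:]"
        using False v_pos_iff[of c] by (simp add: field_simps)
      then show ?thesis using x_const_le[of c] by simp
    qed
    have "x \<in> affine_line v" using x(1) x_const by (rule affine_lineI)
    moreover have "x T \<le> r2"
      using x(2)[of T] N_le[of T 0 0] r by (simp add: E_def gauss_T r2)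
    moreover have "r1 \<le> x T"
      using x(3)[of 1] by (simp add: x.one)
    ultimately have "x \<in> annulus r1 r2" by (simp add: annulus_def)
    moreover have "x q \<le> 0"
      using x(2)[of q] N_le[of q 0 "-1"] by (simp add: E_def g1.zero g2.zero)
    ultimately show False
      using q x.nonneg[of q] by fastforce
  qed
  then obtain m h where mh: "E 1 m h < 1" by blast
  let ?\<delta> = "E 1 m h" and ?p = "T ^ m + h * q"
  have \<delta>: "gauss v r1 ?p \<le> ?\<delta> * r1 ^ m" "gauss v r2 ?p \<le> ?\<delta> * r2 ^ m"
    using E_le_iff[of 1 m h ?\<delta>] by simp_all
  \<comment> \<open>the radius \<open>r2\<close> controls the terms of index at least \<open>m\<close>, and \<open>r1\<close> those of smaller index\<close>
  have "x ?p \<le> ?\<delta> * x T ^ m" if x: "x \<in> annulus r1 r2" for x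
  proof -
    have xa: "x \<in> affine_line v" and xT: "r1 \<le> x T" "x T \<le> r2" using x by (auto simp: annulus_def)
    have pos: "0 < x T" using xT r by simp
    show ?thesis
    proof (rule poly_bound[OF xa])
      fix i
      show "v (coeff ?p i) * x T ^ i \<le> ?\<delta> * x T ^ m"
      proof (cases "m \<le> i")
        case True
        then obtain k where k: "i = m + k" using le_Suc_ex by blast
        have "v (coeff ?p i) * r2 ^ k * r2 ^ m \<le> ?\<delta> * r2 ^ m"
          using coeff_le_gauss[OF r2, of ?p i] \<delta>(2) by (simp add: k power_add mult_ac)
        then have "v (coeff ?p i) * r2 ^ k \<le> ?\<delta>"
          using r2 by simp
        moreover have "v (coeff ?p i) * x T ^ k \<le> v (coeff ?p i) * r2 ^ k"
          using xT pos by (intro mult_left_mono power_mono nonneg) auto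
        ultimately have "v (coeff ?p i) * x T ^ k \<le> ?\<delta>" by simp
        then have "v (coeff ?p i) * x T ^ k * x T ^ m \<le> ?\<delta> * x T ^ m"
          using pos by (intro mult_right_mono) auto
        then show ?thesis by (simp add: k power_add mult_ac)
      next
        case False
        then obtain k where k: "m = i + k" by (metis le_Suc_ex nat_le_linear)
        have "v (coeff ?p i) * r1 ^ i \<le> (?\<delta> * r1 ^ k) * r1 ^ i"
          using coeff_le_gauss[OF r(1), of ?p i] \<delta>(1) by (simp add: k power_add mult_ac)
        then have "v (coeff ?p i) \<le> ?\<delta> * r1 ^ k"
          using r by simp
        also have "\<dots> \<le> ?\<delta> * x T ^ k"
          using xT r by (intro mult_left_mono power_mono E_nonneg) auto
        finally have "v (coeff ?p i) * x T ^ i \<le> ?\<delta> * x T ^ k * x T ^ i"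
          using pos by (intro mult_right_mono) auto
        then show ?thesis by (simp add: k power_add mult_ac)
      qed
    qed (use E_nonneg pos in simp)
  qed
  then show ?thesis using mh E_nonneg by blast
qed

text \<open>
  The definition of regularity provides a denominator for each point separately. A denominator of
  least degree divides all others, so it serves for all points.
\<close>

lemma common_denominator:
  assumes W: "W \<subseteq> affine_line v" "W \<noteq> {}" and reg: "\<forall>x\<in>W. \<phi> \<in> regular_at x"
  shows "\<exists>p q. \<phi> = Fract p q \<and> (\<forall>x\<in>W. x q \<noteq> 0)"
proof -
  define S where "S = {(p, q). q \<noteq> 0 \<and> \<phi> = Fract p q}"
  obtain p0 q0 where "(p0, q0) \<in> S"
    unfolding S_def by (cases \<phi>) auto
  then obtain p q where pq: "(p, q) \<in> S" and min: "\<And>p' q'. (p', q') \<in> S \<Longrightarrow> degree q \<le> degree q'"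
    using ex_has_least_nat[of "\<lambda>z. z \<in> S" "(p0, q0)" "\<lambda>z. degree (snd z)"] by (metis prod.collapse snd_conv)
  have q0: "q \<noteq> 0" "\<phi> = Fract p q" using pq by (auto simp: S_def)
  have "x q \<noteq> 0" if x: "x \<in> W" for x
  proof -
    interpret x: point x using x W point by blast
    obtain p' q' where p': "x q' \<noteq> 0" "\<phi> = Fract p' q'"
      using bspec[OF reg x] by (rule x.regularE)
    have q': "q' \<noteq> 0" by (rule x.nonzero[OF p'(1)])
    have cross: "p * q' = p' * q"
      using q0 p' q' by (simp add: eq_fract)
    let ?a = "q' div q" and ?b = "q' mod q"
    have "?b = 0"
    proof (rule ccontr)
      assume b: "?b \<noteq> 0"
      have "(p' - p * ?a) * q = p * ?b"
      proof -
        have "(p' - p * a) * q = p * b" if "p' * q = p * (a * q + b)" for a b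
          using that by (simp add: algebra_simps)
        moreover have "p' * q = p * (?a * q + ?b)"
          by (simp only: div_mult_mod_eq cross)
        ultimately show ?thesis .
      qed
      then have "Fract (p' - p * ?a) ?b = \<phi>"
        using q0 b by (simp add: eq_fract)
      then have "(p' - p * ?a, ?b) \<in> S"
        using b by (simp add: S_def)
      then have "degree q \<le> degree ?b" by (rule min)
      then show False
        using degree_mod_less[of q q'] q0 b by auto
    qed
    then have "q' = ?a * q"
      using div_mult_mod_eq[of q' q] by simp
    then have "x q' = x ?a * x q"
      by (metis x.mult)
    then show "x q \<noteq> 0" using p' by auto
  qed
  then show ?thesis using q0 by blast
qed

definition laurent_fracts :: "'a poly fract set" where
  "laurent_fracts = {Fract P (T ^ M) | P M. True}"

lemma laurent_fracts_I: "Fract P (T ^ M) \<in> laurent_fracts"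
  by (auto simp: laurent_fracts_def)

lemma laurent_fracts_add:
  assumes "\<phi> \<in> laurent_fracts" "\<psi> \<in> laurent_fracts"
  shows "\<phi> + \<psi> \<in> laurent_fracts"
proof -
  obtain P M Q K where "\<phi> = Fract P (T ^ M)" "\<psi> = Fract Q (T ^ K)"
    using assms by (auto simp: laurent_fracts_def)
  then have "\<phi> + \<psi> = Fract (P * T ^ K + Q * T ^ M) (T ^ (M + K))"
    by (simp add: power_add)
  then show ?thesis by (simp only: laurent_fracts_I)
qed

lemma laurent_fracts_mult:
  assumes "\<phi> \<in> laurent_fracts" "\<psi> \<in> laurent_fracts"
  shows "\<phi> * \<psi> \<in> laurent_fracts"
proof -
  obtain P M Q K where "\<phi> = Fract P (T ^ M)" "\<psi> = Fract Q (T ^ K)"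
    using assms by (auto simp: laurent_fracts_def)
  then have "\<phi> * \<psi> = Fract (P * Q) (T ^ (M + K))"
    by (simp add: power_add)
  then show ?thesis by (simp only: laurent_fracts_I)
qed

lemma laurent_fracts_0_1: "0 \<in> laurent_fracts" "1 \<in> laurent_fracts"
  using laurent_fracts_I[of 0 0] laurent_fracts_I[of 1 0] by (simp_all add: Zero_fract_def One_fract_def)

lemma laurent_fracts_power: "\<phi> \<in> laurent_fracts \<Longrightarrow> \<phi> ^ n \<in> laurent_fracts"
  by (induction n) (auto simp: laurent_fracts_0_1 laurent_fracts_mult)

lemma laurent_fracts_sum: "(\<And>i. i \<in> A \<Longrightarrow> f i \<in> laurent_fracts) \<Longrightarrow> sum f A \<in> laurent_fracts"
  by (induction A rule: infinite_finite_induct) (auto simp: laurent_fracts_0_1 laurent_fracts_add)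

text \<open>
  With \<open>\<phi> = p/q\<close> and \<open>u\<close> as in \<open>annulus_contraction\<close>, \<open>\<phi> (1 - u) = - p h / T^m\<close> is a Laurent
  polynomial. The partial sums of the geometric series for \<open>1 / (1 - u)\<close> then give the Laurent
  polynomials \<open>\<phi> (1 - u^J)\<close>.
\<close>

lemma annulus_approx:
  assumes r: "0 < r1" "r1 \<le> r2" and "\<forall>x\<in>annulus r1 r2. \<phi> \<in> regular_at x" and e: "0 < e"
  shows "\<exists>\<psi>\<in>laurent_fracts. \<forall>x\<in>annulus r1 r2. \<psi> \<in> regular_at x \<and> fract_seminorm x (\<phi> - \<psi>) < e"
proof -
  let ?A = "annulus r1 r2"
  have reg: "\<phi> \<in> regular_at x" if "x \<in> ?A" for x
    using assms(3) that by blast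
  have aff: "affinoid v ?A" using r by (intro affinoid_annulus) auto
  have "gauss v r1 \<in> ?A" using r by (intro gauss_in_annulus) auto
  then have "?A \<noteq> {}" by blast
  define den where "den p q \<longleftrightarrow> \<phi> = Fract p q \<and> (\<forall>x\<in>?A. x q \<noteq> 0)" for p q
  have "\<exists>p q. den p q"
    unfolding den_def by (rule common_denominator[OF annulus_affine \<open>?A \<noteq> {}\<close> assms(3)])
  then obtain p q where "den p q" by blast
  note pq = conjunct1[OF this[unfolded den_def]] conjunct2[OF this[unfolded den_def]]
  define con where "con m h \<delta> \<longleftrightarrow> 0 \<le> \<delta> \<and> \<delta> < 1 \<and> (\<forall>x\<in>?A. x (T ^ m + h * q) \<le> \<delta> * x T ^ m)" for m h \<delta>
  have "\<exists>m h \<delta>. con m h \<delta>"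
    unfolding con_def by (rule annulus_contraction[OF r pq(2)])
  then obtain m h \<delta> where con: "con m h \<delta>" by blast
  note \<delta> = conjunct1[OF con[unfolded con_def]] conjunct2[OF con[unfolded con_def], THEN conjunct1]
    conjunct2[OF con[unfolded con_def], THEN conjunct2]
  obtain C where C: "0 < C" "\<And>x. x \<in> ?A \<Longrightarrow> fract_seminorm x \<phi> \<le> C"
  proof -
    obtain C where "0 < C" "\<And>x. x \<in> ?A \<Longrightarrow> residue_abs x ((\<lambda>x\<in>?A. fract_value x \<phi>) x) \<le> C"
      using An_bounded[OF aff An_fract[OF annulus_affine reg] subset_refl] by blast
    moreover have "residue_abs x ((\<lambda>x\<in>?A. fract_value x \<phi>) x) = fract_seminorm x \<phi>" if x: "x \<in> ?A" for x
      using x point.absH_val[OF point reg, of x] annulus_affine[of r1 r2] by (simp add: subset_iff)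
    ultimately show ?thesis using that by simp
  qed
  have "(\<lambda>J. C * \<delta> ^ J) \<longlonglongrightarrow> C * 0"
    using \<delta> by (intro tendsto_intros LIMSEQ_power_zero) auto
  then have "\<forall>\<^sub>F J in sequentially. C * \<delta> ^ J < e"
    using e by (intro order_tendstoD) auto
  then obtain J where J: "C * \<delta> ^ J < e"
    using eventually_happens'[OF sequentially_bot] by blast
  define u where "u = Fract (T ^ m + h * q) (T ^ m)"
  define \<psi> where "\<psi> = Fract (- (p * h)) (T ^ m) * (\<Sum>j<J. u ^ j)"
  have "q \<noteq> 0"
    using bspec[OF pq(2) \<open>gauss v r1 \<in> ?A\<close>] mult_seminorm.zero[OF mult_seminorm_gauss[OF r(1)]] by auto
  have diff: "\<phi> - \<psi> = \<phi> * u ^ J"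
  proof -
    have "1 - u ^ J = (1 - u) * (\<Sum>j<J. u ^ j)"
      by (rule one_diff_power_eq)
    moreover have "\<phi> * (1 - u) = Fract (- (p * h)) (T ^ m)"
    proof -
      have one: "1 = Fract (T ^ m) (T ^ m)"
        unfolding One_fract_def by (subst eq_fract(1)) auto
      have "1 - u = Fract (T ^ m * T ^ m - (T ^ m + h * q) * T ^ m) (T ^ m * T ^ m)"
        unfolding one u_def by (rule diff_fract) auto
      then show ?thesis
        unfolding pq(1) using \<open>q \<noteq> 0\<close>
        by (simp only: mult_fract, subst eq_fract(1)) (auto simp: algebra_simps)
    qed
    ultimately have "\<phi> * (1 - u ^ J) = \<psi>"
      unfolding \<psi>_def by (metis mult.assoc)
    then show ?thesis by (metis add_diff_cancel_left' diff_add_cancel mult.right_neutral right_diff_distrib)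
  qed
  have "\<psi> \<in> laurent_fracts"
    unfolding \<psi>_def u_def
    by (intro laurent_fracts_mult laurent_fracts_sum laurent_fracts_power laurent_fracts_I)
  moreover have "\<psi> \<in> regular_at x \<and> fract_seminorm x (\<phi> - \<psi>) < e" if x: "x \<in> ?A" for x
  proof -
    have xa: "x \<in> affine_line v" and xT: "0 < x T" using x r by (auto simp: annulus_def)
    interpret x: point x using xa by (rule point)
    have Tm: "x (T ^ m) \<noteq> 0" using xT by (simp add: x.power)
    have ureg: "u \<in> regular_at x" unfolding u_def by (rule x.Fract_regular[OF Tm])
    have "x.nrm u \<le> \<delta>"
      unfolding u_def x.fract_seminorm_Fract[OF Tm] using bspec[OF \<delta>(3) x] xT
      by (simp add: x.power pos_divide_le_eq)
    then have "x.nrm u ^ J \<le> \<delta> ^ J"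
      using x.nrm_nonneg[OF ureg] by (intro power_mono)
    then have "x.nrm \<phi> * x.nrm u ^ J \<le> C * \<delta> ^ J"
      using C x.nrm_nonneg[OF reg[OF x]] x.nrm_nonneg[OF ureg] x by (intro mult_mono zero_le_power) simp_all
    then have "x.nrm (\<phi> - \<psi>) < e"
      unfolding diff using J x.nrm_mult[OF reg[OF x] x.regular_power[OF ureg]] x.nrm_power[OF ureg] by simp
    moreover have "\<psi> \<in> regular_at x"
      unfolding \<psi>_def using Tm ureg by (intro x.regular_mult x.regular_sum x.regular_power x.Fract_regular)
    ultimately show ?thesis by simp
  qed
  ultimately show ?thesis by blast
qed

subsection \<open>Laurent sums\<close>

abbreviation "T1 \<equiv> Fract T 1"

lemma T1_neq_0: "T1 \<noteq> 0"
  unfolding Zero_fract_def by (subst eq_fract(1)) auto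

lemma T1_power: "T1 ^ j = Fract (T ^ j) 1"
  by (induction j) (simp_all add: One_fract_def)

lemma Fract_monom: "Fract (monom c j) 1 = Fract [:c:] 1 * T1 ^ j"
  by (simp add: T1_power monom_altdef)

lemma Fract_sum: "Fract (sum f A) 1 = (\<Sum>i\<in>A. Fract (f i) (1 :: 'a poly))"
proof (induction A rule: infinite_finite_induct)
  case (insert i A)
  have "Fract (sum f (insert i A)) 1 = Fract (f i) 1 + Fract (sum f A) (1 :: 'a poly)"
    using insert.hyps by simp
  then show ?case using insert by simp
qed (simp_all add: Zero_fract_def)

lemma laurent_sum_times_power:
  assumes a: "\<And>i. - int n \<le> i \<Longrightarrow> i < - int N \<Longrightarrow> a i = 0" and n: "N \<le> n"
  shows "laurent_sum a n * T1 ^ N = Fract (\<Sum>j\<le>n + N. monom (a (int j - int N)) j) 1"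
proof -
  let ?t = "\<lambda>i. Fract [:a i:] 1 * T1 powi i"
  have "laurent_sum a n = (\<Sum>i = - int N..int n. ?t i)"
    unfolding laurent_sum_def
  proof (rule sum.mono_neutral_right)
    show "\<forall>i\<in>{- int n..int n} - {- int N..int n}. ?t i = 0"
    proof
      fix i assume "i \<in> {- int n..int n} - {- int N..int n}"
      then have "a i = 0" using a[of i] by (cases "i < - int N") auto
      then have "Fract [:a i:] 1 = 0" by (simp add: Zero_fract_def)
      then show "?t i = 0" by simp
    qed
  qed (use n in auto)
  also have "\<dots> = (\<Sum>j\<le>n + N. ?t (int j - int N))"
    by (rule sum.reindex_bij_witness[of _ "\<lambda>j. int j - int N" "\<lambda>i. nat (i + int N)"]) auto
  finally have "laurent_sum a n * T1 ^ N = (\<Sum>j\<le>n + N. ?t (int j - int N) * T1 ^ N)"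
    by (simp add: sum_distrib_right)
  also have "\<dots> = (\<Sum>j\<le>n + N. Fract (monom (a (int j - int N)) j) 1)"
  proof (rule sum.cong[OF refl])
    fix j
    have "T1 powi (int j - int N) * T1 ^ N = T1 ^ j"
      using T1_neq_0 by (simp add: power_int_diff)
    then show "?t (int j - int N) * T1 ^ N = Fract (monom (a (int j - int N)) j) 1"
      by (simp add: Fract_monom mult.assoc)
  qed
  finally show ?thesis by (simp only: Fract_sum)
qed

lemma laurent_sum_extend:
  fixes l :: "int \<Rightarrow> 'a"
  assumes "\<And>i. \<bar>i\<bar> > int d \<Longrightarrow> l i = 0" "d \<le> n"
  shows "laurent_sum l n = laurent_sum l d"
  unfolding laurent_sum_def
proof (rule sum.mono_neutral_right)
  show "\<forall>i\<in>{- int n..int n} - {- int d..int d}. Fract [:l i:] 1 * T1 powi i = 0"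
  proof
    fix i assume "i \<in> {- int n..int n} - {- int d..int d}"
    then have "l i = 0" by (intro assms) auto
    then have "Fract [:l i:] 1 = 0" by (simp add: Zero_fract_def)
    then show "Fract [:l i:] 1 * T1 powi i = 0" by simp
  qed
qed (use assms(2) in auto)

lemma laurent_sum_diff: "laurent_sum (a :: int \<Rightarrow> 'a) n - laurent_sum b n = laurent_sum (\<lambda>i. a i - b i) n"
proof -
  have "Fract [:a i - b i:] 1 = Fract [:a i:] 1 - Fract [:b i:] 1" for i
    by simp
  then show ?thesis
    by (simp add: laurent_sum_def sum_subtractf left_diff_distrib del: diff_fract)
qed

lemma laurent_fract_eq_sum:
  assumes "\<phi> \<in> laurent_fracts"
  obtains l d where "\<phi> = laurent_sum l d" "\<And>i. \<bar>i\<bar> > int d \<Longrightarrow> l i = 0"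
proof -
  obtain P M where PM: "\<phi> = Fract P (T ^ M)" using assms by (auto simp: laurent_fracts_def)
  define l where "l i = (if 0 \<le> i + int M then coeff P (nat (i + int M)) else 0)" for i
  define d where "d = M + degree P"
  have l0: "l i = 0" if "\<bar>i\<bar> > int d" for i
    using that by (auto simp: l_def d_def intro!: coeff_eq_0)
  have "laurent_sum l d * T1 ^ M = Fract (\<Sum>j\<le>d + M. monom (l (int j - int M)) j) 1"
    by (rule laurent_sum_times_power) (auto simp: l_def d_def)
  also have "(\<Sum>j\<le>d + M. monom (l (int j - int M)) j) = (\<Sum>j\<le>d + M. monom (coeff P j) j)"
    by (simp add: l_def)
  also have "\<dots> = P"
    by (rule poly_as_sum_of_monoms') (simp add: d_def)
  finally have "laurent_sum l d * T1 ^ M = Fract P 1" .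
  then have "laurent_sum l d = Fract P 1 / T1 ^ M"
    using T1_neq_0 by (simp add: nonzero_eq_divide_eq)
  then have "\<phi> = laurent_sum l d"
    by (simp add: PM T1_power)
  then show ?thesis using that l0 by blast
qed

lemma
  assumes x: "x \<in> affine_line v" and T: "0 < x T"
  shows laurent_term_regular: "Fract [:c:] 1 * T1 powi i \<in> regular_at x"
    and laurent_term_nrm: "fract_seminorm x (Fract [:c:] 1 * T1 powi i) = v c * x T powi i"
proof -
  interpret x: point x using x by (rule point)
  have T1: "T1 \<in> regular_at x" "x.nrm T1 = x T"
    using x by (simp_all add: Fract_1_regular Fract_1_nrm)
  have inv: "inverse T1 \<in> regular_at x" "x.nrm (inverse T1) = inverse (x T)"
    using T1 T x.regular_inverse[of T1] x.nrm_inverse[of T1] by simp_all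
  have pow: "T1 powi i \<in> regular_at x" "x.nrm (T1 powi i) = x T powi i"
    unfolding power_int_def using T1 inv x.regular_power x.nrm_power by simp_all
  show "Fract [:c:] 1 * T1 powi i \<in> regular_at x"
    using pow x by (intro x.regular_mult Fract_1_regular)
  show "fract_seminorm x (Fract [:c:] 1 * T1 powi i) = v c * x T powi i"
    using pow x by (simp add: x.nrm_mult Fract_1_regular Fract_1_nrm affine_line_const)
qed

lemma laurent_sum_regular:
  assumes x: "x \<in> affine_line v" and T: "0 < x T"
  shows "laurent_sum a n \<in> regular_at x"
  unfolding laurent_sum_def by (intro point.regular_sum[OF point[OF x]] laurent_term_regular assms)

lemma laurent_sum_nrm_le:
  assumes x: "x \<in> affine_line v" and T: "0 < x T"
    and B: "0 \<le> B" "\<And>i. \<bar>i\<bar> \<le> int n \<Longrightarrow> v (a i) * x T powi i \<le> B"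
  shows "fract_seminorm x (laurent_sum a n) \<le> B"
  unfolding laurent_sum_def
proof (rule point.nrm_sum_le[OF point[OF x] laurent_term_regular[OF x T] B(1)])
  fix i assume "i \<in> {- int n..int n}"
  then show "fract_seminorm x (Fract [:a i:] 1 * T1 powi i) \<le> B"
    using B(2)[of i] by (simp add: laurent_term_nrm[OF x T] abs_le_iff)
qed

text \<open>
  After multiplication by \<open>T^n\<close> the claim is the definition of the Gauss norm of a polynomial.
\<close>

lemma laurent_sum_gauss_ge:
  assumes s: "0 < s" and i: "\<bar>i\<bar> \<le> int n"
  shows "v (a i) * s powi i \<le> fract_seminorm (gauss v s) (laurent_sum a n)"
proof -
  let ?\<eta> = "gauss v s"
  have \<eta>: "?\<eta> \<in> affine_line v" "?\<eta> T = s" using s by (simp_all add: gauss_in_affine_line gauss_T)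
  interpret \<eta>: point ?\<eta> using \<eta>(1) by (rule point)
  define Q where "Q = (\<Sum>j\<le>n + n. monom (a (int j - int n)) j)"
  have "laurent_sum a n * T1 ^ n = Fract Q 1"
    unfolding Q_def by (rule laurent_sum_times_power) auto
  then have "\<eta>.nrm (laurent_sum a n * T1 ^ n) = ?\<eta> Q"
    by (simp add: Fract_1_nrm[OF \<eta>(1)])
  moreover have "\<eta>.nrm (laurent_sum a n * T1 ^ n) = \<eta>.nrm (laurent_sum a n) * s ^ n"
    using \<eta> s by (simp add: \<eta>.nrm_mult laurent_sum_regular \<eta>.regular_power Fract_1_regular \<eta>.nrm_power Fract_1_nrm)
  ultimately have eq: "\<eta>.nrm (laurent_sum a n) * s ^ n = ?\<eta> Q" by simp
  let ?j = "nat (i + int n)"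
  have j: "?j \<le> n + n" "int ?j - int n = i" "int ?j = i + int n" using i by auto
  have "coeff Q ?j = a i"
  proof -
    have "coeff Q ?j = (\<Sum>k\<le>n + n. if k = ?j then a (int k - int n) else 0)"
      by (auto simp: Q_def coeff_sum intro!: sum.cong)
    also have "\<dots> = a i" using j by (simp del: of_nat_nat)
    finally show ?thesis .
  qed
  then have "v (a i) * s ^ ?j \<le> \<eta>.nrm (laurent_sum a n) * s ^ n"
    unfolding eq using coeff_le_gauss[OF s, of Q ?j] by simp
  moreover have "s ^ ?j = s powi i * s ^ n"
    using s j(3) by (metis power_int_add power_int_of_nat less_irrefl)
  ultimately show ?thesis using s by (simp add: mult.assoc[symmetric])
qed

subsection \<open>Existence of the Laurent expansion\<close>

text \<open>
  On each annulus of the exhaustion, \<open>f\<close> is close to a Laurent polynomial. At a Gauss point the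
  coefficients of the difference of two such Laurent polynomials are bounded by its norm
  (\<open>laurent_sum_gauss_ge\<close>), so the coefficients of given index form a Cauchy sequence, whose limit
  is the coefficient of \<open>f\<close>.
\<close>

lemma laurent_expansion_exists:
  assumes f: "f \<in> carrier (An U)" and U: "U \<subseteq> affine_line v"
    and A: "\<And>n. 0 < \<alpha> n" "\<And>n. \<alpha> n \<le> \<beta> n" "\<And>n. annulus (\<alpha> n) (\<beta> n) \<subseteq> U"
    and ex: "\<And>x. x \<in> U \<Longrightarrow> \<forall>\<^sub>F n in sequentially. x \<in> annulus (\<alpha> n) (\<beta> n)"
  obtains a where "laurent_expansion U f a"
proof (cases "U = {}")
  case True
  then show ?thesis using that by (simp add: laurent_expansion_def)
next
  case False
  have "\<exists>l d. (\<forall>i. \<bar>i\<bar> > int d \<longrightarrow> l i = 0) \<and> (\<forall>x\<in>annulus (\<alpha> n) (\<beta> n).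
      residue_abs x (f x \<ominus>\<^bsub>residue_field x\<^esub> fract_value x (laurent_sum l d)) < 1 / Suc n)" for n
  proof -
    let ?A = "annulus (\<alpha> n) (\<beta> n)"
    have aff: "affinoid v ?A" using A(1)[of n] A(2)[of n] by (intro affinoid_annulus) auto
    have e: "0 < 1 / real (Suc n)" by simp
    obtain \<phi> where \<phi>: "\<And>x. x \<in> ?A \<Longrightarrow> \<phi> \<in> regular_at x"
      "\<And>x. x \<in> ?A \<Longrightarrow> residue_abs x (f x \<ominus>\<^bsub>residue_field x\<^esub> fract_value x \<phi>) < 1 / Suc n"
      using fract_limit_onD[OF An_limit[OF f aff A(3)] e] by blast
    obtain \<psi> where \<psi>: "\<psi> \<in> laurent_fracts"
      "\<And>x. x \<in> ?A \<Longrightarrow> \<psi> \<in> regular_at x \<and> fract_seminorm x (\<phi> - \<psi>) < 1 / Suc n"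
      using annulus_approx[OF A(1)[of n] A(2)[of n] _ e, of \<phi>] \<phi>(1) by blast
    obtain l d where l: "\<psi> = laurent_sum l d" "\<And>i. \<bar>i\<bar> > int d \<Longrightarrow> l i = 0"
      using laurent_fract_eq_sum[OF \<psi>(1)] by blast
    have "residue_abs x (f x \<ominus>\<^bsub>residue_field x\<^esub> fract_value x \<psi>) < 1 / Suc n" if x: "x \<in> ?A" for x
    proof -
      have xU: "x \<in> U" using A(3) x by blast
      interpret x: point x using xU U point by blast
      note reg = \<phi>(1)[OF x] conjunct1[OF \<psi>(2)[OF x]]
      have "residue_abs x (f x \<ominus>\<^bsub>residue_field x\<^esub> fract_value x \<psi>)
          \<le> max (residue_abs x (f x \<ominus>\<^bsub>residue_field x\<^esub> fract_value x \<phi>))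
              (residue_abs x (fract_value x \<phi> \<ominus>\<^bsub>residue_field x\<^esub> fract_value x \<psi>))"
        using An_value[OF f xU] reg by (intro x.absH_triangle x.val_closed)
      also have "\<dots> < 1 / Suc n"
        using \<phi>(2)[OF x] \<psi>(2)[OF x] reg by (simp add: x.absH_val x.regular_diff flip: x.val_diff)
      finally show ?thesis .
    qed
    then show ?thesis using l by blast
  qed
  then obtain l d where l0: "\<And>n i. \<bar>i\<bar> > int (d n) \<Longrightarrow> l n i = 0"
    and l: "\<And>n x. x \<in> annulus (\<alpha> n) (\<beta> n) \<Longrightarrow>
      residue_abs x (f x \<ominus>\<^bsub>residue_field x\<^esub> fract_value x (laurent_sum (l n) (d n))) < 1 / Suc n"
    by metis
  have UT: "0 < x T" if "x \<in> U" for x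
  proof -
    have "\<exists>n. x \<in> annulus (\<alpha> n) (\<beta> n)"
      using ex[OF that] eventually_happens'[OF sequentially_bot] by blast
    then show ?thesis using A(1) by (force simp: annulus_def intro: less_le_trans)
  qed
  have coeffs: "v (l n i - l m i) * s powi i < 1 / Suc n"
    if s: "gauss v s \<in> annulus (\<alpha> n) (\<beta> n)" "gauss v s \<in> annulus (\<alpha> m) (\<beta> m)" "0 < s" and nm: "n \<le> m" for n m i s
  proof -
    let ?\<eta> = "gauss v s"
    have \<eta>: "?\<eta> \<in> affine_line v" "?\<eta> T = s" "?\<eta> \<in> U"
      using s A(3) by (auto simp: gauss_in_affine_line gauss_T)
    interpret \<eta>: point ?\<eta> using \<eta>(1) by (rule point)
    let ?D = "max (nat \<bar>i\<bar>) (max (d n) (d m))"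
    have ext: "laurent_sum (l n) ?D = laurent_sum (l n) (d n)" "laurent_sum (l m) ?D = laurent_sum (l m) (d m)"
      using l0 by (intro laurent_sum_extend; force)+
    have reg: "laurent_sum b k \<in> regular_at ?\<eta>" for b k
      using \<eta> s by (intro laurent_sum_regular) auto
    have "v (l n i - l m i) * s powi i \<le> \<eta>.nrm (laurent_sum (\<lambda>i. l n i - l m i) ?D)"
      by (rule laurent_sum_gauss_ge[OF s(3)]) simp
    also have "laurent_sum (\<lambda>i. l n i - l m i) ?D = laurent_sum (l n) (d n) - laurent_sum (l m) (d m)"
      by (simp add: ext flip: laurent_sum_diff)
    also have "\<eta>.nrm \<dots> = \<eta>.absH (\<eta>.val (laurent_sum (l n) (d n)) \<ominus>\<^bsub>\<eta>.H\<^esub> \<eta>.val (laurent_sum (l m) (d m)))"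
      using reg by (simp add: \<eta>.absH_val \<eta>.regular_diff flip: \<eta>.val_diff)
    also have "\<dots> \<le> max (\<eta>.absH (\<eta>.val (laurent_sum (l n) (d n)) \<ominus>\<^bsub>\<eta>.H\<^esub> f ?\<eta>))
        (\<eta>.absH (f ?\<eta> \<ominus>\<^bsub>\<eta>.H\<^esub> \<eta>.val (laurent_sum (l m) (d m))))"
      using An_value[OF f \<eta>(3)] reg by (intro \<eta>.absH_triangle \<eta>.val_closed)
    also have "\<dots> < 1 / Suc n"
    proof -
      have "1 / real (Suc m) \<le> 1 / Suc n" using nm by (simp add: frac_le)
      then show ?thesis
        using l[OF s(1)] l[OF s(2)] \<eta>.absH_diff_commute[OF An_value[OF f \<eta>(3)] \<eta>.val_closed[OF reg]] by simp
    qed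
    finally show ?thesis .
  qed
  have gauss_ev: "\<exists>n0. \<forall>n\<ge>n0. x \<in> annulus (\<alpha> n) (\<beta> n) \<and> gauss v (x T) \<in> annulus (\<alpha> n) (\<beta> n)" if x: "x \<in> U" for x
  proof -
    obtain n0 where "\<forall>n\<ge>n0. x \<in> annulus (\<alpha> n) (\<beta> n)"
      using ex[OF x] by (auto simp: eventually_sequentially)
    then show ?thesis
      using UT[OF x] by (auto simp: annulus_def gauss_in_affine_line gauss_T)
  qed
  have inv_small: "\<exists>n\<ge>n0. 1 / real (Suc n) < e" if "0 < e" for e n0
  proof -
    have "\<forall>\<^sub>F n in sequentially. 1 / real (Suc n) < e"
      using LIMSEQ_Suc[OF lim_1_over_n] that by (rule order_tendstoD)
    then have "\<forall>\<^sub>F n in sequentially. 1 / real (Suc n) < e \<and> n0 \<le> n"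
      using eventually_ge_at_top by (rule eventually_conj)
    then show ?thesis
      using eventually_happens'[OF sequentially_bot] by blast
  qed
  have "\<exists>a. (\<lambda>n. v (l n i - a)) \<longlonglongrightarrow> 0" for i
  proof -
    obtain x where x: "x \<in> U" using False by blast
    let ?s = "x T"
    have s: "0 < ?s powi i" using UT[OF x] by simp
    obtain n0 where n0: "\<forall>n\<ge>n0. gauss v ?s \<in> annulus (\<alpha> n) (\<beta> n)"
      using gauss_ev[OF x] by blast
    have "\<exists>N. \<forall>m\<ge>N. \<forall>n\<ge>N. v (l m i - l n i) < e" if e: "0 < e" for e
    proof -
      have "0 < e * ?s powi i" using e s by simp
      then obtain N where N: "n0 \<le> N" "1 / real (Suc N) < e * ?s powi i"
        using inv_small by blast
      have less: "v (l N i - l m i) < e" if "N \<le> m" for m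
      proof -
        have "v (l N i - l m i) * ?s powi i < e * ?s powi i"
          by (rule less_trans[OF coeffs N(2)]) (use n0 N that UT[OF x] in auto)
        then show ?thesis using s by simp
      qed
      have "v (l m i - l n i) < e" if "N \<le> m" "N \<le> n" for m n
        using triangle[of "l m i" "l n i" "l N i"] less[OF that(1)] less[OF that(2)] diff_commute[of "l m i" "l N i"] by simp
      then show ?thesis by blast
    qed
    then show ?thesis using v_complete[of "\<lambda>n. l n i"] by blast
  qed
  then obtain a where a: "\<And>i. (\<lambda>n. v (l n i - a i)) \<longlonglongrightarrow> 0" by metis
  have "(\<lambda>k. residue_abs x (f x \<ominus>\<^bsub>residue_field x\<^esub> fract_value x (laurent_sum a k))) \<longlonglongrightarrow> 0" if x: "x \<in> U" for x
  proof (rule tendstoI)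
    fix e :: real assume e: "0 < e"
    have xa: "x \<in> affine_line v" using x U by blast
    interpret x: point x using xa by (rule point)
    let ?s = "x T"
    have s: "0 < ?s powi i" "0 < ?s" for i using UT[OF x] by simp_all
    obtain n0 where n0: "\<forall>n\<ge>n0. x \<in> annulus (\<alpha> n) (\<beta> n) \<and> gauss v ?s \<in> annulus (\<alpha> n) (\<beta> n)"
      using gauss_ev[OF x] by blast
    obtain n where n: "n0 \<le> n" "1 / real (Suc n) < e" using inv_small[OF e] by blast
    \<comment> \<open>let \<open>m\<close> tend to infinity in \<open>coeffs\<close>\<close>
    have bound: "v (a i - l n i) * ?s powi i \<le> 1 / Suc n" for i
    proof -
      have "0 < 1 / real (Suc n) / ?s powi i" using s by simp
      then have "\<forall>\<^sub>F m in sequentially. v (l m i - a i) < 1 / Suc n / ?s powi i"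
        using a by (rule order_tendstoD(2)[rotated])
      then have "\<forall>\<^sub>F m in sequentially. v (l m i - a i) < 1 / Suc n / ?s powi i \<and> n \<le> m"
        using eventually_ge_at_top by (rule eventually_conj)
      then obtain m where m: "v (l m i - a i) < 1 / Suc n / ?s powi i" "n \<le> m"
        using eventually_happens'[OF sequentially_bot] by blast
      have "v (l n i - l m i) * ?s powi i < 1 / Suc n"
        by (rule coeffs) (use n0 n m s in auto)
      then have "v (l n i - l m i) < 1 / Suc n / ?s powi i"
        by (simp only: pos_less_divide_eq[OF s(1)])
      then have "v (a i - l n i) < 1 / Suc n / ?s powi i"
        using triangle[of "l n i" "a i" "l m i"] m(1) diff_commute[of "a i" "l n i"] by simp
      then show ?thesis
        unfolding pos_less_divide_eq[OF s(1)] by (rule less_imp_le)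
    qed
    have "dist (residue_abs x (f x \<ominus>\<^bsub>residue_field x\<^esub> fract_value x (laurent_sum a k))) 0 < e" if k: "d n \<le> k" for k
    proof -
      have reg: "laurent_sum b j \<in> regular_at x" for b j
        using xa s by (intro laurent_sum_regular)
      have ext: "laurent_sum (l n) (d n) = laurent_sum (l n) k"
        using l0 k laurent_sum_extend[of "d n" "l n" k] by simp
      have "x.nrm (laurent_sum (l n) k - laurent_sum a k) \<le> 1 / Suc n"
        unfolding laurent_sum_diff using bound diff_commute by (intro laurent_sum_nrm_le xa s) simp_all
      then have 2: "x.absH (x.val (laurent_sum (l n) (d n)) \<ominus>\<^bsub>x.H\<^esub> x.val (laurent_sum a k)) \<le> 1 / Suc n"
        using reg by (simp add: ext x.absH_val x.regular_diff flip: x.val_diff)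
      have "x.absH (f x \<ominus>\<^bsub>x.H\<^esub> x.val (laurent_sum a k)) \<le> max (x.absH (f x \<ominus>\<^bsub>x.H\<^esub> x.val (laurent_sum (l n) (d n))))
          (x.absH (x.val (laurent_sum (l n) (d n)) \<ominus>\<^bsub>x.H\<^esub> x.val (laurent_sum a k)))"
        using An_value[OF f x] reg by (intro x.absH_triangle x.val_closed)
      also have "\<dots> < e"
        using 2 l[of x n] n0 n by auto
      finally show ?thesis
        using x.absH_nonneg[of "f x \<ominus>\<^bsub>x.H\<^esub> x.val (laurent_sum a k)"] An_value[OF f x] x.val_closed[OF reg] by simp
    qed
    then show "\<forall>\<^sub>F k in sequentially. dist (residue_abs x (f x \<ominus>\<^bsub>residue_field x\<^esub> fract_value x (laurent_sum a k))) 0 < e"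
      by (auto simp: eventually_sequentially)
  qed
  then have "laurent_expansion U f a" by (simp add: laurent_expansion_def)
  then show ?thesis by (rule that)
qed

lemma laurent_abs_tendsto:
  assumes f: "f \<in> carrier (An U)" and a: "laurent_expansion U f a"
    and x: "x \<in> U" "x \<in> affine_line v" "0 < x T"
  shows "(\<lambda>n. fract_seminorm x (laurent_sum a n)) \<longlonglongrightarrow> residue_abs x (f x)"
proof -
  interpret x: point x using x(2) by (rule point)
  have reg: "laurent_sum a n \<in> regular_at x" for n
    using x by (intro laurent_sum_regular)
  have lim: "(\<lambda>n. x.absH (f x \<ominus>\<^bsub>x.H\<^esub> x.val (laurent_sum a n))) \<longlonglongrightarrow> 0"
    using a x(1) by (simp add: laurent_expansion_def)
  have "(\<lambda>n. x.nrm (laurent_sum a n) - x.absH (f x)) \<longlonglongrightarrow> 0"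
  proof (rule Lim_null_comparison[OF _ lim], rule always_eventually, rule allI)
    fix n
    show "norm (x.nrm (laurent_sum a n) - x.absH (f x)) \<le> x.absH (f x \<ominus>\<^bsub>x.H\<^esub> x.val (laurent_sum a n))"
      using x.absH_abs_diff_le[OF An_value[OF f x(1)] x.val_closed[OF reg], of n] by (simp add: x.absH_val[OF reg])
  qed
  then show ?thesis by (simp add: LIM_zero_iff)
qed

text \<open>
  Cauchy's inequality: it holds for the partial sums, whose norms converge to that of \<open>f\<close>.
\<close>

lemma laurent_coeff_le:
  assumes f: "f \<in> carrier (An U)" and a: "laurent_expansion U f a" and s: "0 < s" "gauss v s \<in> U"
  shows "v (a i) * s powi i \<le> residue_abs (gauss v s) (f (gauss v s))"
proof (rule LIMSEQ_le_const)
  show "(\<lambda>n. fract_seminorm (gauss v s) (laurent_sum a n)) \<longlonglongrightarrow> residue_abs (gauss v s) (f (gauss v s))"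
    using s by (intro laurent_abs_tendsto[OF f a]) (simp_all add: gauss_in_affine_line gauss_T)
  show "\<exists>N. \<forall>n\<ge>N. v (a i) * s powi i \<le> fract_seminorm (gauss v s) (laurent_sum a n)"
    using s by (intro exI[of _ "nat \<bar>i\<bar>"] allI impI laurent_sum_gauss_ge) auto
qed

lemma laurent_all_zero:
  assumes f: "f \<in> carrier (An U)" and a: "laurent_expansion U f a" and a0: "\<And>i. a i = 0"
    and x: "x \<in> U" "x \<in> affine_line v" "0 < x T"
  shows "f x = \<zero>\<^bsub>residue_field x\<^esub>"
proof -
  interpret x: point x using x(2) by (rule point)
  have "laurent_sum a n = 0" for n
    unfolding laurent_sum_def a0 by (simp add: fract_collapse)
  then have "residue_abs x (f x) = 0"
    using laurent_abs_tendsto[OF f a x] by (simp add: x.nrm_0 LIMSEQ_const_iff)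
  then show ?thesis
    using x.absH_eq_0_iff[OF An_value[OF f x(1)]] by simp
qed

end

section \<open>Punctured discs\<close>

context valued_field
begin

definition disc :: "'a point set \<Rightarrow> bool" where
  "disc D \<longleftrightarrow> (\<exists>R>0. D = closed_disc v R \<or> D = open_disc v R)"

lemma disc_closed_disc: "0 < r \<Longrightarrow> disc (closed_disc v r)"
  by (auto simp: disc_def)

lemma disc_affine: "disc D \<Longrightarrow> D \<subseteq> affine_line v"
  by (auto simp: disc_def closed_disc_def open_disc_def)

lemma disc_origin: "disc D \<Longrightarrow> origin v \<in> D"
  by (auto simp: disc_def closed_disc_def open_disc_def origin_in_affine_line origin_T)

lemma disc_punctured_iff: "disc D \<Longrightarrow> x \<in> D - {origin v} \<longleftrightarrow> x \<in> D \<and> 0 < x T"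
  using disc_affine[of D] eq_origin_iff[of x] mult_seminorm.nonneg[OF affine_line_seminorm, of x T]
  by (auto simp: less_le)

text \<open>
  Closed discs, too, are exhausted by a sequence, a constant one; so discs of both kinds can be
  treated alike.
\<close>

lemma disc_exhaustion:
  assumes "disc D"
  shows "\<exists>\<rho> :: nat \<Rightarrow> real. (\<forall>n. 0 < \<rho> n \<and> closed_disc v (\<rho> n) \<subseteq> D) \<and>
    (\<forall>x\<in>D. \<forall>\<^sub>F n in sequentially. x \<in> closed_disc v (\<rho> n))"
proof -
  obtain R where R: "0 < R" and D: "D = closed_disc v R \<or> D = open_disc v R"
    using assms by (auto simp: disc_def)
  show ?thesis
  proof (cases "D = closed_disc v R")
    case True
    then show ?thesis
      using R by (intro exI[of _ "\<lambda>n. R"]) simp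
  next
    case False
    then have D: "D = open_disc v R" using D by blast
    let ?\<rho> = "\<lambda>n. R - R / real (Suc (Suc n))"
    have "R / real (Suc (Suc n)) < R" for n
      using R by (simp add: field_simps add_pos_nonneg)
    then have pos: "0 < ?\<rho> n" and less: "?\<rho> n < R" for n
      using R by simp_all
    have "?\<rho> \<longlonglongrightarrow> R - 0"
      by (intro tendsto_diff tendsto_const LIMSEQ_Suc[OF LIMSEQ_Suc[OF lim_const_over_n]])
    then have lim: "?\<rho> \<longlonglongrightarrow> R" by simp
    show ?thesis
    proof (intro exI[of _ ?\<rho>] conjI allI ballI)
      show "0 < ?\<rho> n" for n by (rule pos)
      show "closed_disc v (?\<rho> n) \<subseteq> D" for n
        using less[of n] by (auto simp: D closed_disc_def open_disc_def)
      fix x assume "x \<in> D"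
      then have xT: "x T < R" and xa: "x \<in> affine_line v" by (simp_all add: D open_disc_def)
      have "\<forall>\<^sub>F n in sequentially. x T < ?\<rho> n"
        by (rule order_tendstoD(1)[OF lim xT])
      then show "\<forall>\<^sub>F n in sequentially. x \<in> closed_disc v (?\<rho> n)"
        by eventually_elim (simp add: closed_disc_def xa)
    qed
  qed
qed

lemma disc_closed_subdisc:
  assumes "disc D"
  obtains e where "0 < e" "closed_disc v e \<subseteq> D"
proof -
  obtain R where R: "0 < R" "D = closed_disc v R \<or> D = open_disc v R"
    using assms by (auto simp: disc_def)
  then have "closed_disc v (R / 2) \<subseteq> D"
    by (auto simp: closed_disc_def open_disc_def)
  then show ?thesis using that[of "R / 2"] R(1) by simp
qed

text \<open>
  By compactness \<open>\<bar>T\<bar>\<close> attains its maximum on \<open>V\<close>.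
\<close>

lemma affinoid_in_closed_disc:
  assumes D: "disc D" and V: "affinoid v V" "V \<subseteq> D"
  obtains r where "0 < r" "closed_disc v r \<subseteq> D" "V \<subseteq> closed_disc v r"
proof (cases "V = {}")
  case True
  obtain e where "0 < e" "closed_disc v e \<subseteq> D"
    using disc_closed_subdisc[OF D] by blast
  then show ?thesis using that True by blast
next
  case False
  define F where "F y = y T" for y :: "'a point"
  have "continuous_on V F"
    unfolding F_def[abs_def] by (rule continuous_on_eval)
  then obtain y where y: "y \<in> V" "\<And>x. x \<in> V \<Longrightarrow> F x \<le> F y"
    using continuous_attains_sup[OF compact_affinoid[OF V(1)] False] by blast
  obtain \<rho> :: "nat \<Rightarrow> real" where *: "(\<forall>n. 0 < \<rho> n \<and> closed_disc v (\<rho> n) \<subseteq> D) \<and>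
      (\<forall>x\<in>D. \<forall>\<^sub>F n in sequentially. x \<in> closed_disc v (\<rho> n))"
    using disc_exhaustion[OF D] ..
  then have \<rho>: "\<And>n. 0 < \<rho> n" "\<And>n. closed_disc v (\<rho> n) \<subseteq> D"
    "\<And>x. x \<in> D \<Longrightarrow> \<forall>\<^sub>F n in sequentially. x \<in> closed_disc v (\<rho> n)"
    by simp_all
  have "y \<in> D" using y V by blast
  then have "\<exists>n. y \<in> closed_disc v (\<rho> n)"
    using \<rho>(3) eventually_happens'[OF sequentially_bot] by blast
  then obtain n where n: "y T \<le> \<rho> n"
    by (auto simp: closed_disc_def)
  have "V \<subseteq> closed_disc v (\<rho> n)"
  proof
    fix x assume x: "x \<in> V"
    then have "x T \<le> \<rho> n" using y(2)[OF x] n by (simp add: F_def)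
    then show "x \<in> closed_disc v (\<rho> n)"
      using x affinoid_subset_affine[OF V(1)] by (auto simp: closed_disc_def)
  qed
  then show ?thesis using that \<rho> by blast
qed

lemma disc_covering:
  assumes D: "disc D"
  shows "G_covering v D {closed_disc v r | r. 0 < r \<and> closed_disc v r \<subseteq> D}"
  unfolding G_covering_def
proof (intro conjI ballI)
  let ?C = "{closed_disc v r | r. 0 < r \<and> closed_disc v r \<subseteq> D}"
  show "affinoid v V" "V \<subseteq> D" if "V \<in> ?C" for V
    using that by (blast intro: affinoid_closed_disc)+
  fix x assume x: "x \<in> D"
  have xa: "x \<in> affine_line v" using x disc_affine[OF D] by blast
  obtain R where R: "0 < R" and DR: "D = closed_disc v R \<or> D = open_disc v R"
    using D by (auto simp: disc_def)
  obtain r N where r: "0 < r" "closed_disc v r \<subseteq> D" "x \<in> closed_disc v r"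
    and N: "open N" "x \<in> N" "N \<inter> D \<subseteq> closed_disc v r"
  proof (cases "D = closed_disc v R")
    case True
    then show ?thesis using R x by (intro that[of R UNIV]) simp_all
  next
    case False
    then have D': "D = open_disc v R" using DR by blast
    have "max (x T) 0 < R" using x R by (simp add: D' open_disc_def)
    then obtain r where r: "max (x T) 0 < r" "r < R" using dense by blast
    have "open {y :: 'a point. y T < r}"
      by (intro open_Collect_less continuous_on_eval continuous_on_const)
    then show ?thesis
      using r xa by (intro that[of r "{y. y T < r}"]) (auto simp: D' open_disc_def closed_disc_def)
  qed
  then show "\<exists>F. finite F \<and> F \<subseteq> ?C \<and> x \<in> \<Inter> F \<and> (\<exists>N. open N \<and> x \<in> N \<and> N \<inter> D \<subseteq> \<Union> F)"
  proof (intro exI conjI)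
    show "finite {closed_disc v r}" "x \<in> \<Inter> {closed_disc v r}" using r(3) by simp_all
    show "{closed_disc v r} \<subseteq> ?C" using r(1,2) by blast
    show "open N" "x \<in> N" "N \<inter> D \<subseteq> \<Union> {closed_disc v r}" using N by simp_all
  qed
qed

lemma G_covering_obtain:
  assumes "G_covering v W C" "x \<in> W"
  obtains V where "V \<in> C" "x \<in> V"
proof -
  obtain F N where F: "F \<subseteq> C" "x \<in> \<Inter> F" "x \<in> N" "N \<inter> W \<subseteq> \<Union> F"
    using assms unfolding G_covering_def by blast
  then obtain V where "V \<in> F" using assms(2) by blast
  then show ?thesis using that F by blast
qed

lemma disc_laurent:
  assumes D: "disc D" and f: "f \<in> carrier (An (D - {origin v}))"
  obtains a where "laurent_expansion (D - {origin v}) f a"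
proof -
  let ?U = "D - {origin v}"
  obtain \<rho> :: "nat \<Rightarrow> real" where *: "(\<forall>n. 0 < \<rho> n \<and> closed_disc v (\<rho> n) \<subseteq> D) \<and>
      (\<forall>x\<in>D. \<forall>\<^sub>F n in sequentially. x \<in> closed_disc v (\<rho> n))"
    using disc_exhaustion[OF D] ..
  then have \<rho>: "\<And>n. 0 < \<rho> n" "\<And>n. closed_disc v (\<rho> n) \<subseteq> D"
    "\<And>x. x \<in> D \<Longrightarrow> \<forall>\<^sub>F n in sequentially. x \<in> closed_disc v (\<rho> n)"
    by simp_all
  define \<alpha> where "\<alpha> n = min (\<rho> n) (1 / real (Suc n))" for n
  have 1: "0 < \<alpha> n" "\<alpha> n \<le> \<rho> n" for n using \<rho>(1)[of n] by (auto simp: \<alpha>_def)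
  have 2: "annulus (\<alpha> n) (\<rho> n) \<subseteq> ?U" for n
    using \<rho>(2)[of n] 1(1)[of n] by (auto simp: annulus_def closed_disc_def origin_T)
  have 3: "\<forall>\<^sub>F n in sequentially. x \<in> annulus (\<alpha> n) (\<rho> n)" if x: "x \<in> ?U" for x
  proof -
    have xD: "x \<in> D" "0 < x T" "x \<in> affine_line v"
      using x disc_punctured_iff[OF D] disc_affine[OF D] by blast+
    have "\<forall>\<^sub>F n in sequentially. 1 / real (Suc n) < x T"
      using LIMSEQ_Suc[OF lim_1_over_n] xD(2) by (rule order_tendstoD)
    with \<rho>(3)[OF xD(1)] show ?thesis
      by eventually_elim (use xD in \<open>auto simp: annulus_def \<alpha>_def closed_disc_def\<close>)
  qed
  have U: "?U \<subseteq> affine_line v" using disc_affine[OF D] by blast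
  show ?thesis
    using laurent_expansion_exists[OF f U 1 2 3] that by blast
qed

lemma gauss_in_disc: "closed_disc v e \<subseteq> D \<Longrightarrow> 0 < s \<Longrightarrow> s \<le> e \<Longrightarrow> gauss v s \<in> D - {origin v}"
  using eq_origin_iff[of "gauss v s"] by (auto simp: closed_disc_def gauss_in_affine_line gauss_T subset_iff)

text \<open>
  By Cauchy's inequality a zero at one Gauss point kills all coefficients. This replaces the
  identity theorem.
\<close>

lemma nonzero_at_gauss:
  assumes D: "disc D" and f: "f \<in> carrier (An (D - {origin v}))"
    and x: "x \<in> D - {origin v}" "f x \<noteq> \<zero>\<^bsub>residue_field x\<^esub>"
    and s: "0 < s" "gauss v s \<in> D - {origin v}"
  shows "f (gauss v s) \<noteq> \<zero>\<^bsub>residue_field (gauss v s)\<^esub>"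
proof
  assume 0: "f (gauss v s) = \<zero>\<^bsub>residue_field (gauss v s)\<^esub>"
  obtain a where a: "laurent_expansion (D - {origin v}) f a"
    using disc_laurent[OF D f] by blast
  have "a i = 0" for i
  proof -
    have "v (a i) * s powi i \<le> 0"
      using laurent_coeff_le[OF f a s, of i] point.absH_0[OF point[OF gauss_in_affine_line[OF s(1)]]] by (simp add: 0)
    moreover have "0 < s powi i" using s by simp
    ultimately have "v (a i) \<le> 0" by (simp add: mult_le_0_iff)
    then show ?thesis using v_eq_0_iff nonneg[of "a i"] by simp
  qed
  moreover have "x \<in> affine_line v" "0 < x T"
    using x(1) disc_punctured_iff[OF D] disc_affine[OF D] by blast+
  ultimately have "f x = \<zero>\<^bsub>residue_field x\<^esub>"
    using laurent_all_zero[OF f a _ x(1)] by blast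
  then show False using x(2) by contradiction
qed

lemma nonzero_laurent_coeff:
  assumes f: "f \<in> carrier (An U)" and a: "laurent_expansion U f a"
    and x: "x \<in> U" "x \<in> affine_line v" "0 < x T" "f x \<noteq> \<zero>\<^bsub>residue_field x\<^esub>"
  obtains i where "a i \<noteq> 0"
  using laurent_all_zero[OF f a _ x(1-3)] x(4) by blast

text \<open>
  Riemann's theorem on removable singularities: \<open>\<bar>a i\<bar> \<le> C s^(-N-i)\<close> by Cauchy's inequality, and
  the exponent is positive.
\<close>

lemma laurent_coeff_zero_of_growth:
  assumes f: "f \<in> carrier (An U)" and a: "laurent_expansion U f a" and e: "0 < e"
    and g: "\<And>s. 0 < s \<Longrightarrow> s \<le> e \<Longrightarrow> gauss v s \<in> U"
    and C: "\<And>s. 0 < s \<Longrightarrow> s \<le> e \<Longrightarrow> residue_abs (gauss v s) (f (gauss v s)) * s ^ N \<le> C"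
    and i: "i < - int N"
  shows "a i = 0"
proof (rule ccontr)
  assume "a i \<noteq> 0"
  then have va: "0 < v (a i)" by (simp add: v_pos_iff)
  define k where "k = nat (- int N - i)"
  have k: "0 < k" "i = - int (N + k)" using i by (auto simp: k_def)
  have bound: "v (a i) \<le> C * s" if s: "0 < s" "s \<le> e" "s \<le> 1" for s
  proof -
    have "s powi i = inverse (s ^ (N + k))"
      unfolding k(2) by (simp only: power_int_minus power_int_of_nat)
    then have "v (a i) * inverse (s ^ (N + k)) \<le> residue_abs (gauss v s) (f (gauss v s))"
      using laurent_coeff_le[OF f a s(1) g[OF s(1,2)], of i] by simp
    then have "v (a i) * inverse (s ^ (N + k)) * s ^ N \<le> C"
      using C[OF s(1,2)] s by (meson mult_right_mono order_trans zero_le_power less_imp_le)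
    moreover have "v (a i) * inverse (s ^ (N + k)) * s ^ N = v (a i) / s ^ k"
      using s by (simp add: power_add field_simps)
    ultimately have "v (a i) / s ^ k \<le> C" by simp
    then have le: "v (a i) \<le> C * s ^ k"
      using s by (simp add: pos_divide_le_eq)
    have "0 < C * s ^ k" using va le by simp
    then have "0 \<le> C" using s by (simp add: zero_less_mult_iff)
    moreover have "s ^ k \<le> s" using s k power_decreasing[of 1 k s] by simp
    ultimately have "C * s ^ k \<le> C * s" by (intro mult_left_mono)
    then show ?thesis using le by simp
  qed
  have Cpos: "0 < C"
  proof -
    have "0 < C * min e 1" using bound[of "min e 1"] va e by simp
    moreover have "0 < min e 1" using e by simp
    ultimately show ?thesis by (rule zero_less_mult_pos2)
  qed
  define s where "s = min (min e 1) (v (a i) / (2 * C))"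
  have s: "0 < s" "s \<le> e" "s \<le> 1" "s \<le> v (a i) / (2 * C)"
    using e va Cpos by (auto simp: s_def)
  have "C * s \<le> v (a i) / 2"
    using s(4) Cpos by (simp add: field_simps)
  then show False
    using bound[OF s(1-3)] va by simp
qed

text \<open>
  A coefficient \<open>c n \<noteq> 0\<close> of \<open>b\<close> bounds the norm of \<open>b\<close> at the Gauss point of radius \<open>s\<close> below by
  \<open>\<bar>c n\<bar> s^n\<close>; so the norm of \<open>f\<close> grows at most like \<open>s^(-n)\<close>.
\<close>

lemma no_essential_singularity_of_growth:
  assumes D: "disc D" and f: "f \<in> carrier (An (D - {origin v}))"
    and e: "0 < e" "closed_disc v e \<subseteq> D"
    and b: "b \<in> carrier (An (closed_disc v e - {origin v}))"
    and x: "x \<in> closed_disc v e - {origin v}" "b x \<noteq> \<zero>\<^bsub>residue_field x\<^esub>"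
    and C: "\<And>s. 0 < s \<Longrightarrow> s \<le> e \<Longrightarrow>
      residue_abs (gauss v s) (f (gauss v s)) * residue_abs (gauss v s) (b (gauss v s)) \<le> C"
  shows "no_essential_singularity (D - {origin v}) f"
proof -
  let ?U = "D - {origin v}" and ?U' = "closed_disc v e - {origin v}"
  have E: "disc (closed_disc v e)" using e by (simp add: disc_closed_disc)
  obtain a where a: "laurent_expansion ?U f a" using disc_laurent[OF D f] by blast
  obtain c where c: "laurent_expansion ?U' b c" using disc_laurent[OF E b] by blast
  have xa: "x \<in> affine_line v" "0 < x T"
    using x(1) disc_punctured_iff[OF E] disc_affine[OF E] by blast+
  obtain n where n: "c n \<noteq> 0"
    using nonzero_laurent_coeff[OF b c x(1) xa x(2)] by blast
  then have cn: "0 < v (c n)" by (simp add: v_pos_iff)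
  \<comment> \<open>for a radius at most 1 a negative exponent may be replaced by 0\<close>
  let ?N = "nat n" and ?e = "min e 1"
  have "a i = 0" if i: "i < - int ?N" for i
  proof (rule laurent_coeff_zero_of_growth[OF f a, of ?e ?N "C / v (c n)"])
    show "0 < ?e" using e by simp
    fix s assume s: "0 < s" "s \<le> ?e"
    then have s': "s \<le> e" "s \<le> 1" by auto
    show g: "gauss v s \<in> ?U" using s s' e by (intro gauss_in_disc)
    have g': "gauss v s \<in> ?U'" using s s' by (intro gauss_in_disc) auto
    interpret g: point "gauss v s" using s by (intro point gauss_in_affine_line)
    have "s ^ ?N \<le> s powi n"
    proof (cases "0 \<le> n")
      case True
      then show ?thesis by (simp add: power_int_def)
    next
      case False
      then have "s powi n = inverse (s ^ nat (- n))" by (simp add: power_int_def power_inverse)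
      moreover have "s ^ nat (- n) \<le> 1" "0 < s ^ nat (- n)" using s s' by (auto intro: power_le_one)
      ultimately show ?thesis using False by (simp add: one_le_inverse)
    qed
    then have "v (c n) * s ^ ?N \<le> v (c n) * s powi n"
      using cn by simp
    also have "\<dots> \<le> g.absH (b (gauss v s))"
      by (rule laurent_coeff_le[OF b c s(1) g'])
    finally have "g.absH (f (gauss v s)) * (v (c n) * s ^ ?N) \<le> g.absH (f (gauss v s)) * g.absH (b (gauss v s))"
      using g.absH_nonneg[OF An_value[OF f g]] by (rule mult_left_mono)
    also have "\<dots> \<le> C" by (rule C[OF s(1) s'(1)])
    finally show "g.absH (f (gauss v s)) * s ^ ?N \<le> C / v (c n)"
      using cn by (simp add: field_simps)
  qed (rule i)
  then show ?thesis
    unfolding no_essential_singularity_def using a by blast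
qed

text \<open>
  The expansion of \<open>h\<close> has no negative terms because \<open>h\<close> is bounded. Its first non-zero term is of
  order \<open>\<bar>T\<bar>^n\<close>, all later terms together are of order \<open>\<bar>T\<bar>^(n+1)\<close>, so the first one dominates
  near the origin.
\<close>

lemma isolated_zero:
  assumes V: "affinoid v V" and h: "h \<in> carrier (An V)" and e: "0 < e" "closed_disc v e \<subseteq> V"
    and x: "x \<in> closed_disc v e - {origin v}" "h x \<noteq> \<zero>\<^bsub>residue_field x\<^esub>"
  obtains \<epsilon> where "0 < \<epsilon>" "\<epsilon> \<le> e"
    "\<And>y. y \<in> closed_disc v \<epsilon> - {origin v} \<Longrightarrow> h y \<noteq> \<zero>\<^bsub>residue_field y\<^esub>"
proof -
  let ?E = "closed_disc v e" and ?U = "closed_disc v e - {origin v}"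
  have E: "disc ?E" using e by (simp add: disc_closed_disc)
  let ?b = "restrict h ?U"
  have b: "?b \<in> carrier (An ?U)" using h e by (intro An_restrict) auto
  obtain c where c: "laurent_expansion ?U ?b c" using disc_laurent[OF E b] by blast
  have xa: "x \<in> affine_line v" "0 < x T"
    using x(1) disc_punctured_iff[OF E] disc_affine[OF E] by blast+
  have "?b x \<noteq> \<zero>\<^bsub>residue_field x\<^esub>" using x by simp
  then obtain i0 where i0: "c i0 \<noteq> 0"
    using nonzero_laurent_coeff[OF b c x(1) xa] by blast
  obtain C where C: "0 < C" "\<And>y. y \<in> V \<Longrightarrow> residue_abs y (h y) \<le> C"
    using An_bounded[OF V h subset_refl] by blast
  have gU: "gauss v s \<in> ?U" if "0 < s" "s \<le> e" for s
    using that by (intro gauss_in_disc) auto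
  have gC: "residue_abs (gauss v s) (?b (gauss v s)) \<le> C" if "0 < s" "s \<le> e" for s
    using gU[OF that] C(2)[of "gauss v s"] e by auto
  have neg: "c i = 0" if "i < 0" for i
    using laurent_coeff_zero_of_growth[OF b c e(1) gU, of 0 C i] gC that by simp
  define n where "n = (LEAST n. c (int n) \<noteq> 0)"
  have "c (int (nat i0)) \<noteq> 0" using i0 neg[of i0] by (cases "i0 < 0") auto
  then have n: "c (int n) \<noteq> 0" unfolding n_def by (rule LeastI)
  have below: "c i = 0" if "i < int n" for i
  proof (cases "i < 0")
    case False
    then have "nat i < n" using that by linarith
    then have "c (int (nat i)) = 0" unfolding n_def by (metis not_less_Least)
    then show ?thesis using False by simp
  qed (rule neg)
  have cn: "0 < v (c (int n))" using n by (simp add: v_pos_iff)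
  \<comment> \<open>by Cauchy's inequality at radius \<open>e\<close> the later terms are at most \<open>C (s/e)^(n+1)\<close> at radius
    \<open>s\<close>; this is less than \<open>\<bar>c n\<bar> s^n\<close> for \<open>s \<le> \<epsilon>\<close>\<close>
  define \<epsilon> where "\<epsilon> = min e (v (c (int n)) * e ^ Suc n / (2 * C))"
  have \<epsilon>: "0 < \<epsilon>" "\<epsilon> \<le> e" "C * \<epsilon> < v (c (int n)) * e ^ Suc n"
  proof -
    show "0 < \<epsilon>" "\<epsilon> \<le> e" using e cn C by (auto simp: \<epsilon>_def)
    have "C * \<epsilon> \<le> C * (v (c (int n)) * e ^ Suc n / (2 * C))"
      using C by (intro mult_left_mono) (auto simp: \<epsilon>_def)
    also have "\<dots> = v (c (int n)) * e ^ Suc n / 2" using C by simp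
    also have "\<dots> < v (c (int n)) * e ^ Suc n" using cn e by simp
    finally show "C * \<epsilon> < v (c (int n)) * e ^ Suc n" .
  qed
  have nonzero: "h y \<noteq> \<zero>\<^bsub>residue_field y\<^esub>" if y: "y \<in> affine_line v" "0 < y T" "y T \<le> \<epsilon>" for y
  proof -
    let ?s = "y T"
    interpret y: point y using y(1) by (rule point)
    have yU: "y \<in> ?U"
      using y \<epsilon> eq_origin_iff[OF y(1)] by (simp add: closed_disc_def)
    let ?m = "v (c (int n)) * ?s ^ n"
    define B where "B = C * (?s / e) ^ Suc n"
    have B: "0 \<le> B" "B < ?m"
    proof -
      show "0 \<le> B" using C y e by (simp add: B_def)
      have "C * ?s \<le> C * \<epsilon>"
        using y(3) C by (intro mult_left_mono) auto
      then have "C * ?s < v (c (int n)) * e ^ Suc n"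
        using \<epsilon>(3) by (rule le_less_trans)
      then have "C * ?s * ?s ^ n < v (c (int n)) * e ^ Suc n * ?s ^ n"
        using y by (intro mult_strict_right_mono) auto
      then show "B < ?m"
        using e unfolding B_def power_divide by (simp add: pos_divide_less_eq mult_ac)
    qed
    have tail: "v (c i) * ?s powi i \<le> B" if i: "int n < i" for i
    proof -
      define k where "k = nat (i - int (Suc n))"
      have k: "i = int (Suc n + k)"
        using i by (simp add: k_def)
      have "v (c i) * e powi i \<le> C"
        using laurent_coeff_le[OF b c e(1) gU[OF e(1) order_refl], of i] gC[OF e(1) order_refl] by simp
      then have ci: "v (c i) \<le> C / e ^ (Suc n + k)"
        using e by (simp only: k power_int_of_nat) (simp add: pos_le_divide_eq)
      have "v (c i) * ?s ^ (Suc n + k) \<le> C / e ^ (Suc n + k) * ?s ^ (Suc n + k)"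
        using ci y by (intro mult_right_mono) auto
      also have "\<dots> = C * (?s / e) ^ (Suc n + k)"
        by (simp add: power_divide)
      also have "\<dots> \<le> B"
        unfolding B_def using C y \<epsilon>(2) e by (intro mult_left_mono power_decreasing) auto
      finally show ?thesis by (simp only: k power_int_of_nat)
    qed
    have nrm: "y.nrm (laurent_sum c k) = ?m" if k: "n \<le> k" for k
    proof -
      define single where "single i = (if i = int n then c (int n) else 0)" for i
      have S: "laurent_sum single k = Fract [:c (int n):] 1 * T1 powi int n"
      proof -
        have "laurent_sum single k = (\<Sum>i = - int k..int k. if i = int n then Fract [:c (int n):] 1 * T1 powi int n else 0)"
          unfolding laurent_sum_def by (intro sum.cong refl) (auto simp: single_def fract_collapse)
        then show ?thesis using k by simp
      qed
      have Snrm: "y.nrm (laurent_sum single k) = ?m"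
        unfolding S using laurent_term_nrm[OF y(1,2), of "c (int n)" "int n"] by simp
      have diff: "y.nrm (laurent_sum c k - laurent_sum single k) \<le> B"
        unfolding laurent_sum_diff
      proof (rule laurent_sum_nrm_le[OF y(1,2) B(1)])
        fix i
        consider "i < int n" | "i = int n" | "int n < i" by linarith
        then show "v (c i - single i) * ?s powi i \<le> B"
          using below[of i] tail[of i] B(1) by cases (auto simp: single_def zero)
      qed
      have reg: "laurent_sum b k \<in> regular_at y" for b
        using y by (intro laurent_sum_regular)
      have eq1: "laurent_sum c k = (laurent_sum c k - laurent_sum single k) + laurent_sum single k"
        and eq2: "laurent_sum single k = laurent_sum c k - (laurent_sum c k - laurent_sum single k)"
        by simp_all
      have "y.nrm (laurent_sum c k) \<le> max (y.nrm (laurent_sum c k - laurent_sum single k)) ?m"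
        using y.nrm_add_le[OF y.regular_diff[OF reg[of c] reg[of single]] reg[of single]]
        unfolding Snrm eq1[symmetric] .
      moreover have "?m \<le> max (y.nrm (laurent_sum c k)) (y.nrm (laurent_sum c k - laurent_sum single k))"
        using y.nrm_diff_le[OF reg[of c] y.regular_diff[OF reg[of c] reg[of single]]]
        unfolding eq2[symmetric] Snrm .
      ultimately show ?thesis using B(2) diff by linarith
    qed
    have lim: "(\<lambda>k. y.nrm (laurent_sum c k)) \<longlonglongrightarrow> ?m"
      using nrm by (intro tendsto_eventually) (auto simp: eventually_sequentially)
    then have "y.absH (h y) = ?m"
      using LIMSEQ_unique[OF laurent_abs_tendsto[OF b c yU y(1,2)] lim] yU by simp
    then have "0 < y.absH (h y)"
      using B by simp
    then show ?thesis
      using y.absH_0 by force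
  qed
  show ?thesis
  proof (rule that[OF \<epsilon>(1,2)])
    fix y assume "y \<in> closed_disc v \<epsilon> - {origin v}"
    then show "h y \<noteq> \<zero>\<^bsub>residue_field y\<^esub>"
      using disc_punctured_iff[OF disc_closed_disc[OF \<epsilon>(1)], of y] by (intro nonzero) (auto simp: closed_disc_def)
  qed
qed

section \<open>Coverings in the G-topology\<close>

lemma G_covering_at:
  assumes "G_covering v W C" "x \<in> W"
  obtains F N where "finite F" "F \<subseteq> C" "x \<in> \<Inter> F" "open N" "x \<in> N" "N \<inter> W \<subseteq> \<Union> F"
proof -
  have "\<exists>F. finite F \<and> F \<subseteq> C \<and> x \<in> \<Inter> F \<and> (\<exists>N. open N \<and> x \<in> N \<and> N \<inter> W \<subseteq> \<Union> F)"
    using assms(2) conjunct2[OF assms(1)[unfolded G_covering_def]] by (rule bspec[rotated])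
  then obtain F where F: "finite F \<and> F \<subseteq> C \<and> x \<in> \<Inter> F \<and> (\<exists>N. open N \<and> x \<in> N \<and> N \<inter> W \<subseteq> \<Union> F)" ..
  then have "\<exists>N. open N \<and> x \<in> N \<and> N \<inter> W \<subseteq> \<Union> F" by (elim conjE)
  then obtain N where "open N \<and> x \<in> N \<and> N \<inter> W \<subseteq> \<Union> F" ..
  with F show ?thesis by (intro that[of F N]) simp_all
qed

lemma G_coveringI:
  assumes C: "\<And>V. V \<in> C \<Longrightarrow> affinoid v V" "\<And>V. V \<in> C \<Longrightarrow> V \<subseteq> W"
    and at: "\<And>x. x \<in> W \<Longrightarrow> \<exists>F N. finite F \<and> F \<subseteq> C \<and> x \<in> \<Inter> F \<and> open N \<and> x \<in> N \<and> N \<inter> W \<subseteq> \<Union> F"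
  shows "G_covering v W C"
  unfolding G_covering_def
proof (intro conjI ballI)
  fix x assume "x \<in> W"
  then have "\<exists>F N. finite F \<and> F \<subseteq> C \<and> x \<in> \<Inter> F \<and> open N \<and> x \<in> N \<and> N \<inter> W \<subseteq> \<Union> F"
    by (rule at)
  then obtain F N where F: "finite F \<and> F \<subseteq> C \<and> x \<in> \<Inter> F \<and> open N \<and> x \<in> N \<and> N \<inter> W \<subseteq> \<Union> F"
    by (elim exE)
  show "\<exists>F. finite F \<and> F \<subseteq> C \<and> x \<in> \<Inter> F \<and> (\<exists>N. open N \<and> x \<in> N \<and> N \<inter> W \<subseteq> \<Union> F)"
    by (rule exI[of _ F], intro conjI; (rule exI[of _ N])?) (use F in simp_all)
qed (fact C)+

lemma G_covering_mono:
  assumes C: "G_covering v W C" and sub: "C \<subseteq> C'"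
    and C': "\<And>V. V \<in> C' \<Longrightarrow> affinoid v V" "\<And>V. V \<in> C' \<Longrightarrow> V \<subseteq> W"
  shows "G_covering v W C'"
proof (rule G_coveringI)
  fix x assume x: "x \<in> W"
  obtain F N where F: "finite F" "F \<subseteq> C" "x \<in> \<Inter> F" "open N" "x \<in> N" "N \<inter> W \<subseteq> \<Union> F"
    by (rule G_covering_at[OF C x])
  show "\<exists>F N. finite F \<and> F \<subseteq> C' \<and> x \<in> \<Inter> F \<and> open N \<and> x \<in> N \<and> N \<inter> W \<subseteq> \<Union> F"
    by (rule exI[of _ F], rule exI[of _ N], intro conjI F subset_trans[OF F(2) sub])
qed (fact C')+

lemma G_covering_singleton:
  assumes "affinoid v V"
  shows "G_covering v V {V}"
proof (rule G_coveringI)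
  fix x assume x: "x \<in> V"
  show "\<exists>F N. finite F \<and> F \<subseteq> {V} \<and> x \<in> \<Inter> F \<and> open N \<and> x \<in> N \<and> N \<inter> V \<subseteq> \<Union> F"
    by (rule exI[of _ "{V}"], rule exI[of _ UNIV]) (use x in simp)
qed (use assms in auto)

lemma G_covering_affinoid: "G_covering v W C \<Longrightarrow> V \<in> C \<Longrightarrow> affinoid v V"
  and G_covering_subset: "G_covering v W C \<Longrightarrow> V \<in> C \<Longrightarrow> V \<subseteq> W"
  by (auto simp: G_covering_def)

lemma G_covering_restrict:
  assumes C: "G_covering v V C" and V': "affinoid v V'" "V' \<subseteq> V"
  shows "G_covering v V' ((\<lambda>W. W \<inter> V') ` C)"
proof (rule G_coveringI)
  fix W assume "W \<in> (\<lambda>W. W \<inter> V') ` C"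
  then show "affinoid v W" "W \<subseteq> V'"
    using G_covering_affinoid[OF C] V'(1) affinoid_Int by auto
next
  fix x assume x: "x \<in> V'"
  then have "x \<in> V" using V'(2) by blast
  obtain F N where F: "finite F" "F \<subseteq> C" "x \<in> \<Inter> F" "open N" "x \<in> N" "N \<inter> V \<subseteq> \<Union> F"
    by (rule G_covering_at[OF C \<open>x \<in> V\<close>])
  show "\<exists>F N. finite F \<and> F \<subseteq> (\<lambda>W. W \<inter> V') ` C \<and> x \<in> \<Inter> F \<and> open N \<and> x \<in> N \<and> N \<inter> V' \<subseteq> \<Union> F"
  proof (rule exI[of _ "(\<lambda>W. W \<inter> V') ` F"], rule exI[of _ N], intro conjI)
    show "finite ((\<lambda>W. W \<inter> V') ` F)" using F(1) by simp
    show "(\<lambda>W. W \<inter> V') ` F \<subseteq> (\<lambda>W. W \<inter> V') ` C" using F(2) by (rule image_mono)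
    show "x \<in> \<Inter> ((\<lambda>W. W \<inter> V') ` F)" using F(3) x by simp
    show "N \<inter> V' \<subseteq> \<Union> ((\<lambda>W. W \<inter> V') ` F)" using F(6) V'(2) by auto
  qed (fact F)+
qed

lemma G_covering_trans:
  assumes C: "G_covering v V C" and C': "\<And>W. W \<in> C \<Longrightarrow> G_covering v W (C' W)"
  shows "G_covering v V (\<Union>W\<in>C. C' W)"
proof (rule G_coveringI)
  fix W assume "W \<in> (\<Union>W\<in>C. C' W)"
  then obtain Y where Y: "Y \<in> C" "W \<in> C' Y" by blast
  show "affinoid v W" using G_covering_affinoid[OF C'[OF Y(1)] Y(2)] .
  show "W \<subseteq> V" using G_covering_subset[OF C'[OF Y(1)] Y(2)] G_covering_subset[OF C Y(1)] by (rule subset_trans)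
next
  fix x assume x: "x \<in> V"
  obtain F N where F: "finite F" "F \<subseteq> C" "x \<in> \<Inter> F" "open N" "x \<in> N" "N \<inter> V \<subseteq> \<Union> F"
    by (rule G_covering_at[OF C x])
  define Q where "Q W G M \<longleftrightarrow> finite G \<and> G \<subseteq> C' W \<and> x \<in> \<Inter> G \<and> open M \<and> x \<in> M \<and> M \<inter> W \<subseteq> \<Union> G" for W G M
  have "\<exists>G M. Q W G M" if W: "W \<in> F" for W
  proof -
    have "W \<in> C" "x \<in> W" using W F by auto
    obtain G M where G: "finite G" "G \<subseteq> C' W" "x \<in> \<Inter> G" "open M" "x \<in> M" "M \<inter> W \<subseteq> \<Union> G"
      by (rule G_covering_at[OF C'[OF \<open>W \<in> C\<close>] \<open>x \<in> W\<close>])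
    show ?thesis
      unfolding Q_def by (rule exI[of _ G], rule exI[of _ M], intro conjI G)
  qed
  then obtain G M where Q: "\<And>W. W \<in> F \<Longrightarrow> Q W (G W) (M W)" by metis
  have GM: "\<And>W. W \<in> F \<Longrightarrow> finite (G W)" "\<And>W. W \<in> F \<Longrightarrow> G W \<subseteq> C' W"
    "\<And>W. W \<in> F \<Longrightarrow> x \<in> \<Inter> (G W)" "\<And>W. W \<in> F \<Longrightarrow> open (M W)" "\<And>W. W \<in> F \<Longrightarrow> x \<in> M W"
    "\<And>W. W \<in> F \<Longrightarrow> M W \<inter> W \<subseteq> \<Union> (G W)"
    using Q unfolding Q_def by simp_all
  show "\<exists>F N. finite F \<and> F \<subseteq> (\<Union>W\<in>C. C' W) \<and> x \<in> \<Inter> F \<and> open N \<and> x \<in> N \<and> N \<inter> V \<subseteq> \<Union> F"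
  proof (rule exI[of _ "\<Union>W\<in>F. G W"], rule exI[of _ "N \<inter> (\<Inter>W\<in>F. M W)"], intro conjI)
    show "finite (\<Union>W\<in>F. G W)" using F(1) GM(1) by simp
    show "(\<Union>W\<in>F. G W) \<subseteq> (\<Union>W\<in>C. C' W)" using F(2) GM(2) by (intro UN_mono) auto
    show "x \<in> \<Inter> (\<Union>W\<in>F. G W)" using GM(3) by blast
    show "open (N \<inter> (\<Inter>W\<in>F. M W))" using F(1,4) GM(4) by (intro open_Int open_INT) auto
    show "x \<in> N \<inter> (\<Inter>W\<in>F. M W)" using F(5) GM(5) by simp
    show "N \<inter> (\<Inter>W\<in>F. M W) \<inter> V \<subseteq> \<Union> (\<Union>W\<in>F. G W)"
    proof
      fix y assume y: "y \<in> N \<inter> (\<Inter>W\<in>F. M W) \<inter> V"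
      then obtain W where W: "W \<in> F" "y \<in> W" using F(6) by blast
      then have "y \<in> M W \<inter> W" using y by blast
      then show "y \<in> \<Union> (\<Union>W\<in>F. G W)" using GM(6)[OF W(1)] W(1) by blast
    qed
  qed
qed

lemma G_covering_Int:
  assumes C: "G_covering v V C" and C': "G_covering v V C'"
  shows "G_covering v V (\<Union>W\<in>C. (\<lambda>W'. W' \<inter> W) ` C')"
  using G_covering_affinoid[OF C] G_covering_subset[OF C]
  by (intro G_covering_trans[OF C] G_covering_restrict[OF C'])

section \<open>Meromorphic extension\<close>

declare compatible.simps [simp del]

text \<open>
  \<open>h\<close> extends \<open>T^N f\<close> over the origin. The polynomial approximations are recorded because they are
  what makes \<open>h\<close> a regular element.
\<close>

definition analytic_multiple :: "'a point set \<Rightarrow> 'a sect \<Rightarrow> nat \<Rightarrow> 'a sect \<Rightarrow> bool" where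
  "analytic_multiple D f N h \<longleftrightarrow> h \<in> carrier (An D) \<and>
     (\<exists>P. \<forall>r>0. closed_disc v r \<subseteq> D \<longrightarrow> poly_limit (closed_disc v r) h P) \<and>
     (\<forall>x\<in>D - {origin v}. h x = f x \<otimes>\<^bsub>residue_field x\<^esub> fract_value x (T1 ^ N))"

text \<open>
  The partial sums of the expansion of \<open>f\<close>, multiplied by \<open>T^N\<close>, are polynomials. By the maximum
  principle (\<open>poly_le_gauss\<close>) their convergence at the Gauss point of radius \<open>r\<close> is uniform on the
  whole disc of radius \<open>r\<close>, the origin included.
\<close>

lemma analytic_multiple_exists:
  assumes D: "disc D" and f: "f \<in> carrier (An (D - {origin v}))"
    and ness: "no_essential_singularity (D - {origin v}) f"
  obtains N h where "analytic_multiple D f N h"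
proof -
  let ?U = "D - {origin v}"
  obtain a m where a: "laurent_expansion ?U f a" and m: "\<And>i. i < m \<Longrightarrow> a i = 0"
    using ness unfolding no_essential_singularity_def by blast
  define N where "N = nat (- m)"
  have aN: "a i = 0" if "i < - int N" for i
  proof -
    have "i < m" using that unfolding N_def by linarith
    then show ?thesis by (rule m)
  qed
  define P where "P n = (\<Sum>j\<le>n + N. monom (a (int j - int N)) j)" for n
  have SP: "laurent_sum a n * T1 ^ N = Fract (P n) 1" if "N \<le> n" for n
    unfolding P_def using aN that by (intro laurent_sum_times_power) auto
  have cauchy: "\<exists>n0\<ge>N. \<forall>m\<ge>n0. \<forall>n\<ge>n0. \<forall>x\<in>closed_disc v r. x (P m - P n) < e"
    if r: "0 < r" "closed_disc v r \<subseteq> D" and e: "0 < e" for r e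
  proof -
    let ?\<eta> = "gauss v r"
    have \<eta>: "?\<eta> \<in> ?U" "?\<eta> \<in> affine_line v" "0 < ?\<eta> T"
      using gauss_in_disc[OF r(2,1)] r by (simp_all add: gauss_in_affine_line gauss_T)
    interpret \<eta>: point ?\<eta> using \<eta>(2) by (rule point)
    have reg: "laurent_sum a n \<in> regular_at ?\<eta>" for n using \<eta> by (intro laurent_sum_regular)
    have "(\<lambda>n. \<eta>.absH (f ?\<eta> \<ominus>\<^bsub>\<eta>.H\<^esub> \<eta>.val (laurent_sum a n))) \<longlonglongrightarrow> 0"
      using a \<eta>(1) by (simp add: laurent_expansion_def)
    moreover have "0 < e / r ^ N" using e r by simp
    ultimately have "\<forall>\<^sub>F n in sequentially. \<eta>.absH (f ?\<eta> \<ominus>\<^bsub>\<eta>.H\<^esub> \<eta>.val (laurent_sum a n)) < e / r ^ N"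
      by (rule order_tendstoD)
    then obtain n1 where n1: "\<And>n. n1 \<le> n \<Longrightarrow> \<eta>.absH (f ?\<eta> \<ominus>\<^bsub>\<eta>.H\<^esub> \<eta>.val (laurent_sum a n)) < e / r ^ N"
      by (auto simp: eventually_sequentially)
    have "x (P m - P n) < e" if mn: "max N n1 \<le> m" "max N n1 \<le> n" and x: "x \<in> closed_disc v r" for m n x
    proof -
      have "x (P m - P n) \<le> ?\<eta> (P m - P n)"
        using x r by (intro poly_le_gauss) (auto simp: closed_disc_def)
      also have "\<dots> = \<eta>.nrm (Fract (P m) 1 - Fract (P n) 1)"
        using Fract_1_nrm[OF \<eta>(2), of "P m - P n"] by simp
      also have "Fract (P m) 1 - Fract (P n) 1 = (laurent_sum a m - laurent_sum a n) * T1 ^ N"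
        using mn by (simp add: SP left_diff_distrib)
      also have "\<eta>.nrm \<dots> = \<eta>.nrm (laurent_sum a m - laurent_sum a n) * r ^ N"
        using reg \<eta>(2) r
        by (simp add: \<eta>.nrm_mult \<eta>.regular_diff \<eta>.regular_power Fract_1_regular \<eta>.nrm_power Fract_1_nrm gauss_T)
      also have "\<dots> < e / r ^ N * r ^ N"
      proof (rule mult_strict_right_mono)
        have "\<eta>.nrm (laurent_sum a m - laurent_sum a n)
            = \<eta>.absH (\<eta>.val (laurent_sum a m) \<ominus>\<^bsub>\<eta>.H\<^esub> \<eta>.val (laurent_sum a n))"
          using reg by (simp add: \<eta>.absH_val \<eta>.regular_diff flip: \<eta>.val_diff)
        also have "\<dots> \<le> max (\<eta>.absH (\<eta>.val (laurent_sum a m) \<ominus>\<^bsub>\<eta>.H\<^esub> f ?\<eta>))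
            (\<eta>.absH (f ?\<eta> \<ominus>\<^bsub>\<eta>.H\<^esub> \<eta>.val (laurent_sum a n)))"
          using An_value[OF f \<eta>(1)] reg by (intro \<eta>.absH_triangle \<eta>.val_closed)
        also have "\<dots> < e / r ^ N"
          using n1[of m] n1[of n] mn \<eta>.absH_diff_commute[OF An_value[OF f \<eta>(1)] \<eta>.val_closed[OF reg]] by simp
        finally show "\<eta>.nrm (laurent_sum a m - laurent_sum a n) < e / r ^ N" .
      qed (use r in simp)
      finally show ?thesis using r by simp
    qed
    then show ?thesis by (intro exI[of _ "max N n1"]) auto
  qed
  have in_disc: "\<exists>r>0. closed_disc v r \<subseteq> D \<and> x \<in> closed_disc v r" if "x \<in> D" for x
    using G_covering_obtain[OF disc_covering[OF D] that] by blast
  have CS: "(\<lambda>n. Fract (P n) 1) \<in> carrier (cauchy_ring x)" if x: "x \<in> D" for x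
  proof -
    have xa: "x \<in> affine_line v" using x disc_affine[OF D] by blast
    interpret x: point x using xa by (rule point)
    obtain r where r: "0 < r" "closed_disc v r \<subseteq> D" "x \<in> closed_disc v r" using in_disc[OF x] by blast
    show ?thesis
      unfolding x.CS_iff
    proof (intro conjI allI impI)
      fix e :: real assume "0 < e"
      then obtain n0 where "\<forall>m\<ge>n0. \<forall>n\<ge>n0. \<forall>x\<in>closed_disc v r. x (P m - P n) < e"
        using cauchy[OF r(1,2)] by metis
      then show "\<exists>N. \<forall>m\<ge>N. \<forall>n\<ge>N. x.nrm (Fract (P m) 1 - Fract (P n) 1) < e"
        using r(3) Fract_1_nrm[OF xa] by auto
    qed (rule Fract_1_regular[OF xa])
  qed
  define h where "h = (\<lambda>x\<in>D. point.cls x (\<lambda>n. Fract (P n) 1))"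
  have hx: "h x \<in> carrier (residue_field x)" if x: "x \<in> D" for x
  proof -
    interpret x: point x using x disc_affine[OF D] point by blast
    show ?thesis using x.cls.hom_closed[OF CS[OF x]] x by (simp add: h_def)
  qed
  have lim: "poly_limit (closed_disc v r) h P" if r: "0 < r" "closed_disc v r \<subseteq> D" for r
    unfolding poly_limit_def
  proof (intro allI impI)
    fix e :: real assume e: "0 < e"
    then have "0 < e / 2" by simp
    then obtain n0 where n0: "\<forall>m\<ge>n0. \<forall>n\<ge>n0. \<forall>x\<in>closed_disc v r. x (P m - P n) < e / 2"
      using cauchy[OF r] by metis
    have "residue_abs x (h x \<ominus>\<^bsub>residue_field x\<^esub> fract_value x (Fract (P n) 1)) < e"
      if n: "n0 \<le> n" and x: "x \<in> closed_disc v r" for n x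
    proof -
      have xD: "x \<in> D" using x r by blast
      have xa: "x \<in> affine_line v" using xD disc_affine[OF D] by blast
      interpret x: point x using xa by (rule point)
      have le: "x.nrm (Fract (P m) 1 - Fract (P n) 1) \<le> e / 2" if "n0 \<le> m" for m
        using n0 n that x Fract_1_nrm[OF xa, of "P m - P n"] by fastforce
      have "x.absH (x.cls (\<lambda>n. Fract (P n) 1) \<ominus>\<^bsub>x.H\<^esub> x.val (Fract (P n) 1)) \<le> e / 2"
        by (rule x.cls_limit[OF CS[OF xD], of n0, OF le Fract_1_regular[OF xa]])
      then show ?thesis using e xD by (simp add: h_def)
    qed
    then show "\<exists>N. \<forall>n\<ge>N. \<forall>x\<in>closed_disc v r.
        residue_abs x (h x \<ominus>\<^bsub>residue_field x\<^esub> fract_value x (Fract (P n) 1)) < e"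
      by blast
  qed
  have hAn: "h \<in> carrier (An D)"
    unfolding An_carrier
  proof (intro conjI allI impI; (elim conjE)?)
    show "h \<in> (\<Pi>\<^sub>E x\<in>D. carrier (residue_field x))"
      using hx by (auto simp: h_def)
    fix V assume V: "affinoid v V" "V \<subseteq> D"
    obtain r where r: "0 < r" "closed_disc v r \<subseteq> D" "V \<subseteq> closed_disc v r"
      using affinoid_in_closed_disc[OF D V] by blast
    show "fract_limit_on V h"
      unfolding fract_limit_on_def
    proof (intro allI impI)
      fix e :: real assume "0 < e"
      then obtain n where n: "\<forall>x\<in>closed_disc v r.
          residue_abs x (h x \<ominus>\<^bsub>residue_field x\<^esub> fract_value x (Fract (P n) 1)) < e"
        using lim[OF r(1,2)] unfolding poly_limit_def by blast
      show "\<exists>\<phi>. \<forall>x\<in>V. \<phi> \<in> regular_at x \<and> residue_abs x (h x \<ominus>\<^bsub>residue_field x\<^esub> fract_value x \<phi>) < e"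
        using n r(3) affinoid_subset_affine[OF V(1)] Fract_1_regular by (intro exI[of _ "Fract (P n) 1"]) blast
    qed
  qed
  have "h x = f x \<otimes>\<^bsub>residue_field x\<^esub> fract_value x (T1 ^ N)" if x: "x \<in> ?U" for x
  proof -
    have xD: "x \<in> D" "0 < x T" "x \<in> affine_line v"
      using x disc_punctured_iff[OF D] disc_affine[OF D] by blast+
    interpret x: point x using xD(3) by (rule point)
    obtain r where r: "0 < r" "closed_disc v r \<subseteq> D" "x \<in> closed_disc v r" using in_disc[OF xD(1)] by blast
    have TN: "T1 ^ N \<in> regular_at x" "x.nrm (T1 ^ N) = x T ^ N"
      using xD by (simp_all add: x.regular_power x.nrm_power Fract_1_regular Fract_1_nrm)
    have reg: "laurent_sum a n \<in> regular_at x" for n using xD by (intro laurent_sum_regular)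
    let ?g = "f x \<otimes>\<^bsub>x.H\<^esub> x.val (T1 ^ N)"
    note fx = An_value[OF f x]
    have g: "?g \<in> carrier x.H" using fx TN x.val_closed by simp
    have small: "x.absH (h x \<ominus>\<^bsub>x.H\<^esub> ?g) \<le> e" if e: "0 < e" for e
    proof -
      obtain n1 where n1: "\<And>n. n1 \<le> n \<Longrightarrow> x.absH (h x \<ominus>\<^bsub>x.H\<^esub> x.val (Fract (P n) 1)) < e"
        using lim[OF r(1,2)] e r(3) unfolding poly_limit_def by blast
      have "(\<lambda>n. x.absH (f x \<ominus>\<^bsub>x.H\<^esub> x.val (laurent_sum a n))) \<longlonglongrightarrow> 0"
        using a x by (simp add: laurent_expansion_def)
      moreover have "0 < e / x T ^ N" using e xD by simp
      ultimately have "\<forall>\<^sub>F n in sequentially. x.absH (f x \<ominus>\<^bsub>x.H\<^esub> x.val (laurent_sum a n)) < e / x T ^ N"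
        by (rule order_tendstoD)
      then obtain n2 where n2: "\<And>n. n2 \<le> n \<Longrightarrow> x.absH (f x \<ominus>\<^bsub>x.H\<^esub> x.val (laurent_sum a n)) < e / x T ^ N"
        by (auto simp: eventually_sequentially)
      define n where "n = max N (max n1 n2)"
      have n: "N \<le> n" "n1 \<le> n" "n2 \<le> n" by (auto simp: n_def)
      let ?S = "x.val (laurent_sum a n)" and ?t = "x.val (T1 ^ N)"
      have Pn: "x.val (Fract (P n) 1) = ?S \<otimes>\<^bsub>x.H\<^esub> ?t"
        using reg TN by (simp add: x.val_mult flip: SP[OF n(1)])
      note cl = fx x.val_closed[OF TN(1)] x.val_closed[OF reg[of n]]
      have "?S \<otimes>\<^bsub>x.H\<^esub> ?t \<ominus>\<^bsub>x.H\<^esub> ?g = (?S \<ominus>\<^bsub>x.H\<^esub> f x) \<otimes>\<^bsub>x.H\<^esub> ?t"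
        using cl by (simp add: a_minus_def x.H.l_distr x.H.l_minus)
      then have "x.absH (?S \<otimes>\<^bsub>x.H\<^esub> ?t \<ominus>\<^bsub>x.H\<^esub> ?g) = x.absH (?S \<ominus>\<^bsub>x.H\<^esub> f x) * x T ^ N"
        using cl TN by (simp add: x.absH_mult x.absH_val)
      also have "\<dots> < e / x T ^ N * x T ^ N"
        using n2[OF n(3)] x.absH_diff_commute[OF cl(1,3)] xD by (intro mult_strict_right_mono) auto
      finally have 2: "x.absH (?S \<otimes>\<^bsub>x.H\<^esub> ?t \<ominus>\<^bsub>x.H\<^esub> ?g) < e" using xD by simp
      have "x.absH (h x \<ominus>\<^bsub>x.H\<^esub> ?g) \<le> max (x.absH (h x \<ominus>\<^bsub>x.H\<^esub> ?S \<otimes>\<^bsub>x.H\<^esub> ?t)) (x.absH (?S \<otimes>\<^bsub>x.H\<^esub> ?t \<ominus>\<^bsub>x.H\<^esub> ?g))"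
        using hx[OF xD(1)] g cl by (intro x.absH_triangle) auto
      then show ?thesis using 2 n1[OF n(2)] by (simp add: Pn)
    qed
    have cl: "h x \<ominus>\<^bsub>x.H\<^esub> ?g \<in> carrier x.H" using hx[OF xD(1)] g by simp
    have "x.absH (h x \<ominus>\<^bsub>x.H\<^esub> ?g) \<le> 0"
      using small by (rule dense_ge)
    then have "h x \<ominus>\<^bsub>x.H\<^esub> ?g = \<zero>\<^bsub>x.H\<^esub>"
      using x.absH_eq_0_iff[OF cl] x.absH_nonneg[OF cl] by simp
    then show ?thesis using x.H_diff_eq_0_iff[OF hx[OF xD(1)] g] by simp
  qed
  then have "analytic_multiple D f N h"
    unfolding analytic_multiple_def using hAn lim by (intro conjI exI[of _ P]) simp_all
  then show ?thesis by (rule that)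
qed

lemma T_power_nonzero:
  assumes "x \<in> affine_line v" "0 < x T"
  shows "fract_value x (T1 ^ N) \<in> carrier (residue_field x)" "fract_value x (T1 ^ N) \<noteq> \<zero>\<^bsub>residue_field x\<^esub>"
proof -
  interpret x: point x using assms(1) by (rule point)
  have TN: "T1 ^ N \<in> regular_at x" "x.nrm (T1 ^ N) = x T ^ N"
    using assms by (simp_all add: x.regular_power x.nrm_power Fract_1_regular Fract_1_nrm)
  then show "x.val (T1 ^ N) \<in> carrier x.H"
    by (intro x.val_closed)
  have "x.absH (x.val (T1 ^ N)) \<noteq> 0"
    using TN assms by (simp add: x.absH_val)
  then show "x.val (T1 ^ N) \<noteq> \<zero>\<^bsub>x.H\<^esub>"
    using x.absH_0 by metis
qed

lemma T_power_analytic: "W \<subseteq> affine_line v \<Longrightarrow> (\<lambda>x\<in>W. fract_value x (T1 ^ N)) \<in> carrier (An W)"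
  unfolding T1_power by (rule An_fract) (auto intro: Fract_1_regular)

text \<open>
  Regularity concerns all affinoid domains in the disc, also those containing the origin, where
  \<open>T\<close> vanishes.
\<close>

lemma T_power_regular:
  assumes r: "0 < r"
  shows "regular_element v (closed_disc v r) (\<lambda>x\<in>closed_disc v r. fract_value x (T1 ^ N))"
proof (rule regular_of_poly_limit[OF r T_power_analytic[OF closed_disc_affine]])
  have \<eta>: "gauss v r \<in> closed_disc v r" using r by (simp add: closed_disc_def gauss_in_affine_line gauss_T)
  show "poly_limit (closed_disc v r) (\<lambda>x\<in>closed_disc v r. fract_value x (T1 ^ N)) (\<lambda>n. T ^ N)"
    unfolding poly_limit_def T1_power
  proof (intro allI impI exI[of _ 0] ballI)
    fix e :: real and n :: nat and x assume e: "0 < e" and x: "x \<in> closed_disc v r"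
    have xa: "x \<in> affine_line v" using x by (simp add: closed_disc_def)
    interpret x: point x using xa by (rule point)
    show "x.absH ((\<lambda>x\<in>closed_disc v r. fract_value x (Fract (T ^ N) 1)) x \<ominus>\<^bsub>x.H\<^esub> x.val (Fract (T ^ N) 1)) < e"
      using e x x.val_closed[OF Fract_1_regular[OF xa]] by (simp add: a_minus_def x.H.r_neg x.absH_0)
  qed
  show "(\<lambda>x\<in>closed_disc v r. fract_value x (T1 ^ N)) (gauss v r) \<noteq> \<zero>\<^bsub>residue_field (gauss v r)\<^esub>"
    using \<eta> T_power_nonzero(2)[of "gauss v r" N] r by (simp add: gauss_in_affine_line gauss_T)
qed

lemma regular_element_carrier: "regular_element v V b \<Longrightarrow> b \<in> carrier (An V)"
  unfolding regular_element_def by (rule conjunct1)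

lemma regular_element_cancel:
  assumes "regular_element v V b" "affinoid v V'" "V' \<subseteq> V" "c \<in> carrier (An V')"
    "restrict b V' \<otimes>\<^bsub>An V'\<^esub> c = \<zero>\<^bsub>An V'\<^esub>"
  shows "c = \<zero>\<^bsub>An V'\<^esub>"
  using assms unfolding regular_element_def by blast

lemma regular_element_restrict:
  assumes "regular_element v V b" "V' \<subseteq> V"
  shows "regular_element v V' (restrict b V')"
  unfolding regular_element_def
proof (intro conjI allI impI; (elim conjE)?)
  show "restrict b V' \<in> carrier (An V')"
    by (rule An_restrict[OF regular_element_carrier[OF assms(1)] assms(2)])
  fix W c assume W: "affinoid v W" "W \<subseteq> V'" and c: "c \<in> carrier (An W)"
    and 0: "restrict (restrict b V') W \<otimes>\<^bsub>An W\<^esub> c = \<zero>\<^bsub>An W\<^esub>"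
  have "restrict (restrict b V') W = restrict b W" using W by (simp add: Int_absorb1)
  then show "c = \<zero>\<^bsub>An W\<^esub>"
    using regular_element_cancel[OF assms(1) W(1) _ c] W(2) assms(2) 0 by simp
qed

lemma compatible_iff:
  "compatible v (V, a, b) (V', a', b') \<longleftrightarrow> (\<forall>W. affinoid v W \<and> W \<subseteq> V \<inter> V' \<longrightarrow>
     (\<forall>x\<in>W. a x \<otimes>\<^bsub>residue_field x\<^esub> b' x = a' x \<otimes>\<^bsub>residue_field x\<^esub> b x))"
proof -
  have "(restrict a W \<otimes>\<^bsub>An W\<^esub> restrict b' W = restrict a' W \<otimes>\<^bsub>An W\<^esub> restrict b W) \<longleftrightarrow>
      (\<forall>x\<in>W. a x \<otimes>\<^bsub>residue_field x\<^esub> b' x = a' x \<otimes>\<^bsub>residue_field x\<^esub> b x)" for W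
    unfolding An_simps by (auto simp: restrict_def fun_eq_iff)
  then show ?thesis by (simp add: compatible.simps)
qed

text \<open>
  The meromorphic function is \<open>h / T^N\<close>. It is a section in the required sense because fractions
  which agree with \<open>h / T^N\<close> agree with each other: \<open>T^N\<close> is regular and can be cancelled.
\<close>

lemma extends_of_no_essential_singularity:
  assumes D: "disc D" and f: "f \<in> carrier (An (D - {origin v}))"
    and ness: "no_essential_singularity (D - {origin v}) f"
  shows "extends_meromorphically v D (D - {origin v}) f"
proof -
  let ?U = "D - {origin v}"
  obtain N h where "analytic_multiple D f N h"
    using analytic_multiple_exists[OF D f ness] by blast
  then have h: "h \<in> carrier (An D)"
    and hf: "\<And>x. x \<in> ?U \<Longrightarrow> h x = f x \<otimes>\<^bsub>residue_field x\<^esub> fract_value x (T1 ^ N)"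
    by (auto simp: analytic_multiple_def)
  define t where "t x = fract_value x (T1 ^ N)" for x :: "'a point"
  define \<xi> where "\<xi> r = (closed_disc v r, restrict h (closed_disc v r), restrict t (closed_disc v r))" for r
  define Rad where "Rad = {r. 0 < r \<and> closed_disc v r \<subseteq> D}"
  have DA: "D \<subseteq> affine_line v" using disc_affine[OF D] .
  have t_reg: "regular_element v (closed_disc v r) (restrict t (closed_disc v r))" if "r \<in> Rad" for r
    using T_power_regular[of r N] that by (simp add: Rad_def t_def[abs_def])
  have \<xi>_frac: "\<xi> r \<in> fractions v D" if r: "r \<in> Rad" for r
    using r t_reg[OF r] An_restrict[OF h] affinoid_closed_disc by (auto simp: \<xi>_def fractions_def Rad_def)
  have \<xi>_iff: "compatible v (V, a, b) (\<xi> r) \<longleftrightarrow> (\<forall>W. affinoid v W \<and> W \<subseteq> V \<inter> closed_disc v r \<longrightarrow>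
      (\<forall>x\<in>W. a x \<otimes>\<^bsub>residue_field x\<^esub> t x = h x \<otimes>\<^bsub>residue_field x\<^esub> b x))" for V a b r
    unfolding \<xi>_def compatible_iff by (intro all_cong1 imp_cong refl ball_cong) auto
  \<comment> \<open>a section contains every fraction compatible with it; compatibility is tested on the closed
    discs, which cover\<close>
  define S where "S = {\<zeta> \<in> fractions v D. \<forall>r\<in>Rad. compatible v \<zeta> (\<xi> r)}"
  have \<xi>S: "\<xi> r \<in> S" if r: "r \<in> Rad" for r
  proof -
    have "compatible v (\<xi> r) (\<xi> r')" for r'
      unfolding \<xi>_def compatible_iff by auto
    then show ?thesis
      unfolding S_def using \<xi>_frac[OF r] by blast
  qed
  have inRad: "\<exists>r\<in>Rad. W \<subseteq> closed_disc v r" if W: "affinoid v W" "W \<subseteq> D" for W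
  proof -
    obtain r where "0 < r" "closed_disc v r \<subseteq> D" "W \<subseteq> closed_disc v r"
      using affinoid_in_closed_disc[OF D W] by blast
    then show ?thesis unfolding Rad_def by blast
  qed
  have "S \<in> meromorphic_functions v D"
    unfolding meromorphic_functions_def
  proof (intro CollectI conjI ballI impI)
    show "S \<subseteq> fractions v D" by (auto simp: S_def)
    show "G_covering v D (fst ` S)"
    proof (rule G_covering_mono[OF disc_covering[OF D]])
      show "affinoid v V" "V \<subseteq> D" if "V \<in> fst ` S" for V
        using that by (auto simp: S_def fractions_def)
      show "{closed_disc v r | r. 0 < r \<and> closed_disc v r \<subseteq> D} \<subseteq> fst ` S"
      proof
        fix V assume "V \<in> {closed_disc v r | r. 0 < r \<and> closed_disc v r \<subseteq> D}"
        then obtain r where "r \<in> Rad" "V = closed_disc v r" by (auto simp: Rad_def)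
        then show "V \<in> fst ` S" using imageI[OF \<xi>S, of r fst] by (simp add: \<xi>_def)
      qed
    qed
  next
    fix \<zeta> \<zeta>' assume S: "\<zeta> \<in> S" "\<zeta>' \<in> S"
    obtain V a b where \<zeta>: "\<zeta> = (V, a, b)" by (cases \<zeta>)
    obtain V' a' b' where \<zeta>': "\<zeta>' = (V', a', b')" by (cases \<zeta>')
    have fr: "V \<subseteq> D" "a \<in> carrier (An V)" "b \<in> carrier (An V)" "V' \<subseteq> D" "a' \<in> carrier (An V')" "b' \<in> carrier (An V')"
      using S by (auto simp: \<zeta> \<zeta>' S_def fractions_def regular_element_carrier)
    show "compatible v \<zeta> \<zeta>'"
      unfolding \<zeta> \<zeta>' compatible_iff
    proof (intro allI impI ballI; elim conjE)
      fix W x assume W: "affinoid v W" "W \<subseteq> V \<inter> V'" and x: "x \<in> W"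
      have WA: "W \<subseteq> affine_line v" using affinoid_subset_affine[OF W(1)] .
      obtain r where r: "r \<in> Rad" "W \<subseteq> closed_disc v r" using inRad[OF W(1)] W(2) fr by blast
      interpret W: cring "An W" by (rule cring_An[OF WA])
      let ?a = "restrict a W" and ?b = "restrict b W" and ?a' = "restrict a' W" and ?b' = "restrict b' W"
      have cl: "?a \<in> carrier (An W)" "?b \<in> carrier (An W)" "?a' \<in> carrier (An W)" "?b' \<in> carrier (An W)"
        using fr W by (auto intro: An_restrict)
      let ?t = "restrict (restrict t (closed_disc v r)) W" and ?h = "restrict h W"
      have tW: "?t = restrict t W" using r by (simp add: Int_absorb1)
      have tcl: "?t \<in> carrier (An W)" "?h \<in> carrier (An W)"
        using An_restrict[OF regular_element_carrier[OF t_reg[OF r(1)]] r(2)] An_restrict[OF h, of W] W fr by auto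
      have "compatible v (V, a, b) (\<xi> r)" "compatible v (V', a', b') (\<xi> r)"
        using S r(1) by (auto simp: \<zeta> \<zeta>' S_def)
      then have "\<forall>x\<in>W. a x \<otimes>\<^bsub>residue_field x\<^esub> t x = h x \<otimes>\<^bsub>residue_field x\<^esub> b x"
        "\<forall>x\<in>W. a' x \<otimes>\<^bsub>residue_field x\<^esub> t x = h x \<otimes>\<^bsub>residue_field x\<^esub> b' x"
        using W r(2) unfolding \<xi>_iff by auto
      then have at: "?a \<otimes>\<^bsub>An W\<^esub> ?t = ?h \<otimes>\<^bsub>An W\<^esub> ?b" and at': "?a' \<otimes>\<^bsub>An W\<^esub> ?t = ?h \<otimes>\<^bsub>An W\<^esub> ?b'"
        unfolding tW An_simps by (auto intro!: restrict_ext)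
      let ?d = "?a \<otimes>\<^bsub>An W\<^esub> ?b' \<ominus>\<^bsub>An W\<^esub> ?a' \<otimes>\<^bsub>An W\<^esub> ?b"
      have "?t \<otimes>\<^bsub>An W\<^esub> ?d = (?a \<otimes>\<^bsub>An W\<^esub> ?t) \<otimes>\<^bsub>An W\<^esub> ?b' \<ominus>\<^bsub>An W\<^esub> (?a' \<otimes>\<^bsub>An W\<^esub> ?t) \<otimes>\<^bsub>An W\<^esub> ?b"
        using cl tcl by (simp add: a_minus_def W.r_distr W.r_minus W.m_ac)
      also have "\<dots> = \<zero>\<^bsub>An W\<^esub>"
        unfolding at at' using cl tcl by (simp add: a_minus_def W.m_ac W.r_neg)
      finally have "?t \<otimes>\<^bsub>An W\<^esub> ?d = \<zero>\<^bsub>An W\<^esub>" .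
      moreover have "?d \<in> carrier (An W)" using cl by simp
      ultimately have d0: "?d = \<zero>\<^bsub>An W\<^esub>"
        by (rule regular_element_cancel[OF t_reg[OF r(1)] W(1) r(2), rotated])
      have "?a \<otimes>\<^bsub>An W\<^esub> ?b' = ?d \<oplus>\<^bsub>An W\<^esub> ?a' \<otimes>\<^bsub>An W\<^esub> ?b"
        using cl by (simp add: a_minus_def W.a_assoc W.l_neg)
      then have "?a \<otimes>\<^bsub>An W\<^esub> ?b' = ?a' \<otimes>\<^bsub>An W\<^esub> ?b"
        using cl by (simp add: d0)
      from fun_cong[OF this, of x] show "a x \<otimes>\<^bsub>residue_field x\<^esub> b' x = a' x \<otimes>\<^bsub>residue_field x\<^esub> b x"
        using x by (simp add: An_simps)
    qed
  next
    fix \<zeta> assume \<zeta>: "\<zeta> \<in> fractions v D" "\<forall>\<eta>\<in>S. compatible v \<zeta> \<eta>"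
    have "\<forall>r\<in>Rad. compatible v \<zeta> (\<xi> r)" using \<zeta>(2) \<xi>S by blast
    with \<zeta>(1) show "\<zeta> \<in> S" unfolding S_def by blast
  qed
  moreover have "mero_restrict S ?U = mero_of_analytic v ?U f"
  proof (rule equalityI; rule subsetI)
    fix \<zeta> assume "\<zeta> \<in> mero_restrict S ?U"
    then obtain V a b where \<zeta>: "\<zeta> = (V, a, b)" "\<zeta> \<in> S" "V \<subseteq> ?U" by (auto simp: mero_restrict_def)
    have fr: "affinoid v V" "V \<subseteq> D" "a \<in> carrier (An V)" "regular_element v V b" "b \<in> carrier (An V)"
      using \<zeta> by (auto simp: S_def fractions_def regular_element_carrier)
    have VA: "V \<subseteq> affine_line v" using affinoid_subset_affine[OF fr(1)] .
    obtain r where r: "r \<in> Rad" "V \<subseteq> closed_disc v r" using inRad[OF fr(1,2)] by blast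
    have "compatible v (V, a, b) (\<xi> r)" using \<zeta> r by (auto simp: S_def)
    then have at: "\<And>x. x \<in> V \<Longrightarrow> a x \<otimes>\<^bsub>residue_field x\<^esub> t x = h x \<otimes>\<^bsub>residue_field x\<^esub> b x"
      using fr(1) r(2) unfolding \<xi>_iff by auto
    have "a = restrict f V \<otimes>\<^bsub>An V\<^esub> b"
    proof (rule An_eqI[OF fr(3)])
      show "restrict f V \<otimes>\<^bsub>An V\<^esub> b \<in> carrier (An V)"
        by (intro An_mult_closed VA An_restrict[OF f \<zeta>(3)] fr)
      fix x assume x: "x \<in> V"
      have xU: "x \<in> ?U" using x \<zeta>(3) by blast
      then have xa: "x \<in> affine_line v" "0 < x T" using disc_punctured_iff[OF D] DA by blast+
      interpret x: point x using xa(1) by (rule point)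
      note tx = T_power_nonzero[OF xa, of N, folded t_def]
      note cl = An_value[OF f xU] An_value[OF fr(3) x] An_value[OF fr(5) x]
      have "(a x \<ominus>\<^bsub>x.H\<^esub> f x \<otimes>\<^bsub>x.H\<^esub> b x) \<otimes>\<^bsub>x.H\<^esub> t x = a x \<otimes>\<^bsub>x.H\<^esub> t x \<ominus>\<^bsub>x.H\<^esub> h x \<otimes>\<^bsub>x.H\<^esub> b x"
        using cl tx by (simp add: hf[OF xU, folded t_def] a_minus_def x.H.l_distr x.H.r_distr x.H.l_minus x.H.r_minus x.H.m_ac)
      also have "\<dots> = \<zero>\<^bsub>x.H\<^esub>"
        using cl tx by (simp add: at[OF x] hf[OF xU, folded t_def] a_minus_def x.H.r_neg)
      finally have "a x \<ominus>\<^bsub>x.H\<^esub> f x \<otimes>\<^bsub>x.H\<^esub> b x = \<zero>\<^bsub>x.H\<^esub>"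
        using x.mult_eq_zero_iff_H[of "a x \<ominus>\<^bsub>x.H\<^esub> f x \<otimes>\<^bsub>x.H\<^esub> b x" "t x"] tx cl by simp
      then show "a x = (restrict f V \<otimes>\<^bsub>An V\<^esub> b) x"
        using x cl x.H_diff_eq_0_iff[of "a x" "f x \<otimes>\<^bsub>x.H\<^esub> b x"] by (simp add: An_simps)
    qed
    then show "\<zeta> \<in> mero_of_analytic v ?U f"
      using \<zeta> fr by (auto simp: mero_of_analytic_def fractions_def)
  next
    fix \<zeta> assume "\<zeta> \<in> mero_of_analytic v ?U f"
    then obtain V a b where \<zeta>: "\<zeta> = (V, a, b)" "a = restrict f V \<otimes>\<^bsub>An V\<^esub> b"
      and fr: "affinoid v V" "V \<subseteq> ?U" "a \<in> carrier (An V)" "regular_element v V b"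
      by (auto simp: mero_of_analytic_def fractions_def)
    have "compatible v (V, a, b) (\<xi> r)" for r
      unfolding \<xi>_iff
    proof (intro allI impI ballI; elim conjE)
      fix W x assume W: "W \<subseteq> V \<inter> closed_disc v r" and x: "x \<in> W"
      have xV: "x \<in> V" and xU: "x \<in> ?U" using W x fr by auto
      then have xa: "x \<in> affine_line v" "0 < x T" using disc_punctured_iff[OF D] DA by blast+
      interpret x: point x using xa(1) by (rule point)
      note tx = T_power_nonzero(1)[OF xa, of N, folded t_def]
      have "b x \<in> carrier x.H" using xV by (intro An_value[OF regular_element_carrier[OF fr(4)]])
      then show "a x \<otimes>\<^bsub>x.H\<^esub> t x = h x \<otimes>\<^bsub>x.H\<^esub> b x"
        using tx An_value[OF f xU] xV by (simp add: \<zeta>(2) An_simps hf[OF xU, folded t_def] x.H.m_ac)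
    qed
    then have "\<zeta> \<in> S"
      using \<zeta>(1) fr by (auto simp: S_def fractions_def)
    then show "\<zeta> \<in> mero_restrict S ?U"
      using \<zeta>(1) fr(2) by (auto simp: mero_restrict_def)
  qed
  ultimately show ?thesis
    unfolding extends_meromorphically_def by blast
qed

lemma gauss_in_annulus_self: "0 < s \<Longrightarrow> gauss v s \<in> annulus s s"
  by (rule gauss_in_annulus) auto

lemma annulus_subset_punctured_disc:
  assumes "0 < s" "s \<le> e"
  shows "annulus s s \<subseteq> closed_disc v e - {origin v}"
  using assms by (auto simp: annulus_def closed_disc_def origin_T)

text \<open>
  If \<open>b\<close> vanished on the circle of radius \<open>e\<close>, it would annihilate the function 1 on this affinoid
  domain, which is not zero because of the Gauss point.
\<close>

lemma regular_element_nonzero: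
  assumes b: "regular_element v V b" and e: "0 < e" "closed_disc v e \<subseteq> V"
  obtains x where "x \<in> closed_disc v e - {origin v}" "b x \<noteq> \<zero>\<^bsub>residue_field x\<^esub>"
proof -
  let ?A = "annulus e e"
  have A: "affinoid v ?A" "?A \<subseteq> closed_disc v e - {origin v}" "?A \<subseteq> V" "?A \<subseteq> affine_line v"
    using e affinoid_annulus annulus_subset_punctured_disc[of e e] annulus_affine by auto
  have \<eta>: "gauss v e \<in> ?A" using e by (intro gauss_in_annulus_self)
  interpret \<eta>: point "gauss v e" using \<eta> A(4) point by blast
  have "\<exists>x\<in>?A. b x \<noteq> \<zero>\<^bsub>residue_field x\<^esub>"
  proof (rule ccontr)
    assume "\<not> ?thesis"
    then have 0: "\<And>x. x \<in> ?A \<Longrightarrow> b x = \<zero>\<^bsub>residue_field x\<^esub>" by blast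
    have "restrict b ?A \<otimes>\<^bsub>An ?A\<^esub> \<one>\<^bsub>An ?A\<^esub> = \<zero>\<^bsub>An ?A\<^esub>"
      unfolding An_simps
    proof (rule restrict_ext)
      fix x assume x: "x \<in> ?A"
      then interpret x: point x using A(4) point by blast
      show "restrict b ?A x \<otimes>\<^bsub>x.H\<^esub> (\<lambda>x\<in>?A. \<one>\<^bsub>residue_field x\<^esub>) x = \<zero>\<^bsub>x.H\<^esub>"
        using x by (simp add: 0)
    qed
    then have "\<one>\<^bsub>An ?A\<^esub> = \<zero>\<^bsub>An ?A\<^esub>"
      by (rule regular_element_cancel[OF b A(1,3) An_one_closed[OF A(4)]])
    from fun_cong[OF this, of "gauss v e"] show False
      using \<eta> \<eta>.one_neq_zero_H by (simp add: An_simps)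
  qed
  then show ?thesis using that A(2) by blast
qed

text \<open>
  Near the origin \<open>f\<close> is a fraction \<open>a/b\<close>; then \<open>f b = a\<close> is bounded. The equality \<open>f b = a\<close> at
  the Gauss point of radius \<open>s\<close> comes from the circle of radius \<open>s\<close>: the fraction restricted to it
  still belongs to the section, and the circle lies in the punctured disc, where the section is
  given by \<open>f\<close>.
\<close>

lemma no_essential_singularity_of_extends:
  assumes D: "disc D" and f: "f \<in> carrier (An (D - {origin v}))"
    and ext: "extends_meromorphically v D (D - {origin v}) f"
  shows "no_essential_singularity (D - {origin v}) f"
proof -
  let ?U = "D - {origin v}"
  obtain S where S: "S \<in> meromorphic_functions v D" "mero_restrict S ?U = mero_of_analytic v ?U f"
    using ext unfolding extends_meromorphically_def by blast
  have S1: "S \<subseteq> fractions v D" and S2: "G_covering v D (fst ` S)"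
    and S3: "\<And>\<xi> \<eta>. \<xi> \<in> S \<Longrightarrow> \<eta> \<in> S \<Longrightarrow> compatible v \<xi> \<eta>"
    and S4: "\<And>\<xi>. \<xi> \<in> fractions v D \<Longrightarrow> \<forall>\<eta>\<in>S. compatible v \<xi> \<eta> \<Longrightarrow> \<xi> \<in> S"
    using S(1) unfolding meromorphic_functions_def by blast+
  obtain V where V: "V \<in> fst ` S" "origin v \<in> V"
    using G_covering_obtain[OF S2 disc_origin[OF D]] by blast
  then obtain a b where ab: "(V, a, b) \<in> S" by force
  then have fr: "affinoid v V" "V \<subseteq> D" "a \<in> carrier (An V)" "regular_element v V b"
    using S1 by (auto simp: fractions_def)
  have b: "b \<in> carrier (An V)" using fr(4) by (rule regular_element_carrier)
  obtain e where e: "0 < e" "closed_disc v e \<subseteq> V"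
    using affinoid_contains_disc[OF fr(1) V(2)] by blast
  obtain C where C: "0 < C" "\<And>x. x \<in> V \<Longrightarrow> residue_abs x (a x) \<le> C"
    using An_bounded[OF fr(1,3) subset_refl] by blast
  let ?U' = "closed_disc v e - {origin v}"
  obtain x where x: "x \<in> ?U'" "b x \<noteq> \<zero>\<^bsub>residue_field x\<^esub>"
    using regular_element_nonzero[OF fr(4) e] by blast
  show ?thesis
  proof (rule no_essential_singularity_of_growth[OF D f e(1) _ An_restrict[OF b] x(1)])
    show "closed_disc v e \<subseteq> D" "?U' \<subseteq> V" using e fr(2) by auto
    show "restrict b ?U' x \<noteq> \<zero>\<^bsub>residue_field x\<^esub>" using x by simp
    fix s assume s: "0 < s" "s \<le> e"
    let ?W = "annulus s s" and ?\<eta> = "gauss v s"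
    have W: "affinoid v ?W" "?W \<subseteq> V" "?W \<subseteq> ?U"
      using s e fr(2) affinoid_annulus annulus_subset_punctured_disc[OF s] by auto
    have \<eta>: "?\<eta> \<in> ?W" "?\<eta> \<in> ?U" "?\<eta> \<in> ?U'" "?\<eta> \<in> V"
      using gauss_in_annulus_self[OF s(1)] W annulus_subset_punctured_disc[OF s] by auto
    interpret \<eta>: point ?\<eta> using s by (intro point gauss_in_affine_line)
    have "(?W, restrict a ?W, restrict b ?W) \<in> fractions v D"
      using W fr(2) An_restrict[OF fr(3) W(2)] regular_element_restrict[OF fr(4) W(2)]
      by (auto simp: fractions_def)
    moreover have "compatible v (?W, restrict a ?W, restrict b ?W) \<zeta>" if \<zeta>: "\<zeta> \<in> S" for \<zeta>
    proof -
      obtain V' a' b' where \<zeta>': "\<zeta> = (V', a', b')" by (cases \<zeta>)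
      have "compatible v (V, a, b) (V', a', b')"
        using S3[OF ab \<zeta>] by (simp only: \<zeta>')
      then have *: "\<And>Y x. affinoid v Y \<Longrightarrow> Y \<subseteq> V \<inter> V' \<Longrightarrow> x \<in> Y \<Longrightarrow>
          a x \<otimes>\<^bsub>residue_field x\<^esub> b' x = a' x \<otimes>\<^bsub>residue_field x\<^esub> b x"
        unfolding compatible_iff by blast
      show ?thesis
        unfolding \<zeta>' compatible_iff
      proof (intro allI impI ballI; elim conjE)
        fix Y x assume Y: "affinoid v Y" "Y \<subseteq> ?W \<inter> V'" and x: "x \<in> Y"
        have "a x \<otimes>\<^bsub>residue_field x\<^esub> b' x = a' x \<otimes>\<^bsub>residue_field x\<^esub> b x"
          using Y W(2) x by (intro *[of Y]) auto
        then show "restrict a ?W x \<otimes>\<^bsub>residue_field x\<^esub> b' x = a' x \<otimes>\<^bsub>residue_field x\<^esub> restrict b ?W x"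
          using x Y by (simp add: subset_iff)
      qed
    qed
    ultimately have "(?W, restrict a ?W, restrict b ?W) \<in> S"
      by (intro S4) auto
    then have "(?W, restrict a ?W, restrict b ?W) \<in> mero_of_analytic v ?U f"
      using S(2) W(3) by (auto simp: mero_restrict_def)
    then have "restrict a ?W = restrict f ?W \<otimes>\<^bsub>An ?W\<^esub> restrict b ?W"
      by (auto simp: mero_of_analytic_def)
    from fun_cong[OF this, of ?\<eta>] have "a ?\<eta> = f ?\<eta> \<otimes>\<^bsub>\<eta>.H\<^esub> b ?\<eta>"
      using \<eta>(1) by (simp add: An_simps)
    then have "\<eta>.absH (a ?\<eta>) = \<eta>.absH (f ?\<eta>) * \<eta>.absH (b ?\<eta>)"
      using An_value[OF f \<eta>(2)] An_value[OF b \<eta>(4)] by (simp add: \<eta>.absH_mult)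
    then show "\<eta>.absH (f ?\<eta>) * \<eta>.absH (restrict b ?U' ?\<eta>) \<le> C"
      using C(2)[OF \<eta>(4)] \<eta>(3) by simp
  qed
qed

section \<open>The zero locus\<close>

text \<open>
  The inverse \<open>1/f\<close> is a non-zero analytic function whose product with \<open>f\<close> is bounded.
\<close>

lemma no_essential_singularity_of_invertible:
  assumes D: "disc D" and f: "f \<in> carrier (An (D - {origin v}))"
    and inv: "invertible_near_origin v D f"
  shows "no_essential_singularity (D - {origin v}) f"
proof -
  obtain V where V: "openin (top_of_set D) V" "origin v \<in> V"
    and unit: "restrict f (V - {origin v}) \<in> Units (An (V - {origin v}))"
    using inv unfolding invertible_near_origin_def by blast
  let ?V = "V - {origin v}"
  obtain O' where O': "open O'" "V = D \<inter> O'" using V(1) by (auto simp: openin_open)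
  obtain e1 where e1: "0 < e1" "closed_disc v e1 \<subseteq> O'"
    using open_contains_disc[OF O'(1)] V(2) O'(2) by blast
  obtain e2 where e2: "0 < e2" "closed_disc v e2 \<subseteq> D"
    using disc_closed_subdisc[OF D] by blast
  define e where "e = min e1 e2"
  have e: "0 < e" "closed_disc v e \<subseteq> D" "closed_disc v e \<subseteq> V"
    using e1 e2 closed_disc_mono[of e e1] closed_disc_mono[of e e2] O'(2) by (auto simp: e_def)
  let ?U' = "closed_disc v e - {origin v}"
  obtain g where g: "g \<in> carrier (An ?V)" "restrict f ?V \<otimes>\<^bsub>An ?V\<^esub> g = \<one>\<^bsub>An ?V\<^esub>"
    using unit unfolding Units_def by blast
  have fg: "residue_abs x (f x) * residue_abs x (g x) = 1" if x: "x \<in> ?U'" for x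
  proof -
    have xs: "x \<in> ?V" "x \<in> D - {origin v}" "x \<in> affine_line v" using x e closed_disc_affine by auto
    interpret x: point x using xs(3) by (rule point)
    have "f x \<otimes>\<^bsub>x.H\<^esub> g x = \<one>\<^bsub>x.H\<^esub>"
      using fun_cong[OF g(2), of x] xs(1) by (simp add: An_simps)
    then show ?thesis
      using An_value[OF f xs(2)] An_value[OF g(1) xs(1)] x.absH_1 by (simp flip: x.absH_mult)
  qed
  have \<eta>: "gauss v s \<in> ?U'" if "0 < s" "s \<le> e" for s
    using that by (intro gauss_in_disc) auto
  interpret \<eta>: point "gauss v e" using e by (intro point gauss_in_affine_line)
  show ?thesis
  proof (rule no_essential_singularity_of_growth[OF D f e(1,2) An_restrict[OF g(1)] \<eta>[OF e(1) order_refl]])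
    show "?U' \<subseteq> ?V" using e by auto
    show "restrict g ?U' (gauss v e) \<noteq> \<zero>\<^bsub>\<eta>.H\<^esub>"
      using \<eta>[OF e(1) order_refl] fg[OF \<eta>[OF e(1) order_refl]] \<eta>.absH_0 by auto
    fix s assume s: "0 < s" "s \<le> e"
    show "residue_abs (gauss v s) (f (gauss v s)) * residue_abs (gauss v s) (restrict g ?U' (gauss v s)) \<le> 1"
      using fg[OF \<eta>[OF s]] \<eta>[OF s] by simp
  qed
qed

lemma no_essential_singularity_zero:
  assumes "U \<subseteq> affine_line v" "\<And>x. x \<in> U \<Longrightarrow> f x = \<zero>\<^bsub>residue_field x\<^esub>"
  shows "no_essential_singularity U f"
proof -
  have "laurent_sum (\<lambda>i. 0 :: 'a) n = 0" for n
    unfolding laurent_sum_def by (simp add: fract_collapse)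
  moreover have "residue_abs x (f x \<ominus>\<^bsub>residue_field x\<^esub> fract_value x 0) = 0" if x: "x \<in> U" for x
  proof -
    interpret x: point x using x assms(1) point by blast
    show ?thesis
      by (simp add: assms(2)[OF x] x.val_0 a_minus_def x.H.r_neg x.absH_0)
  qed
  ultimately have "laurent_expansion U f (\<lambda>i. 0)"
    by (simp add: laurent_expansion_def)
  then show ?thesis
    unfolding no_essential_singularity_def by blast
qed

subsection \<open>Linear combinations of sections\<close>

lemma lin_comb_0: "W \<subseteq> affine_line v \<Longrightarrow> lin_comb v W 0 c s = \<zero>\<^bsub>An W\<^esub>"
proof -
  assume "W \<subseteq> affine_line v"
  then interpret cring "An W" by (rule cring_An)
  show ?thesis by (simp add: lin_comb_def)
qed

lemma lin_comb_Suc: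
  assumes W: "W \<subseteq> affine_line v"
    and c: "\<And>j. j < Suc n \<Longrightarrow> c j \<in> carrier (An W)"
    and s: "\<And>j. j < Suc n \<Longrightarrow> restrict (s j) W \<in> carrier (An W)"
  shows "lin_comb v W (Suc n) c s = c n \<otimes>\<^bsub>An W\<^esub> restrict (s n) W \<oplus>\<^bsub>An W\<^esub> lin_comb v W n c s"
proof -
  interpret cring "An W" using W by (rule cring_An)
  show ?thesis
    unfolding lin_comb_def lessThan_Suc using c s by (subst finsum_insert) auto
qed

lemma lin_comb_eval_zero:
  assumes W: "W \<subseteq> affine_line v" and x: "x \<in> W"
    and c: "\<And>j. j < n \<Longrightarrow> c j \<in> carrier (An W)"
    and s: "\<And>j. j < n \<Longrightarrow> restrict (s j) W \<in> carrier (An W)"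
    and 0: "\<And>j. j < n \<Longrightarrow> s j x = \<zero>\<^bsub>residue_field x\<^esub>"
  shows "lin_comb v W n c s x = \<zero>\<^bsub>residue_field x\<^esub>"
  using c s 0
proof (induction n)
  case 0
  then show ?case using x by (simp add: lin_comb_0[OF W]) (simp add: An_simps)
next
  case (Suc n)
  interpret x: point x using W x point by blast
  have "c n x \<in> carrier x.H" using Suc.prems(1)[of n] x by (intro An_value) auto
  moreover have "lin_comb v W n c s x = \<zero>\<^bsub>x.H\<^esub>"
    using Suc.prems by (intro Suc.IH) auto
  moreover have "s n x = \<zero>\<^bsub>x.H\<^esub>" using Suc.prems(3) by simp
  moreover have "lin_comb v W (Suc n) c s = c n \<otimes>\<^bsub>An W\<^esub> restrict (s n) W \<oplus>\<^bsub>An W\<^esub> lin_comb v W n c s"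
    by (rule lin_comb_Suc[OF W]) (fact Suc.prems)+
  ultimately show ?case
    using x by (simp add: An_simps)
qed

subsection \<open>The sheaf of multiples of a function\<close>

text \<open>
  The principal ideal sheaf generated by \<open>h\<close>. Being a multiple is required on the members of a
  covering, so that gluing holds by definition.
\<close>

definition multiples :: "'a sect \<Rightarrow> 'a point set \<Rightarrow> 'a sect set" where
  "multiples h V = {u \<in> carrier (An V). \<exists>C. G_covering v V C \<and>
     (\<forall>W\<in>C. \<exists>w\<in>carrier (An W). \<forall>x\<in>W. u x = h x \<otimes>\<^bsub>residue_field x\<^esub> w x)}"

lemma multiplesI:
  assumes "u \<in> carrier (An V)" "G_covering v V C"
    "\<And>W. W \<in> C \<Longrightarrow> \<exists>w\<in>carrier (An W). \<forall>x\<in>W. u x = h x \<otimes>\<^bsub>residue_field x\<^esub> w x"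
  shows "u \<in> multiples h V"
  unfolding multiples_def using assms by blast

lemma multiplesE:
  assumes "u \<in> multiples h V"
  obtains C where "G_covering v V C"
    "\<And>W. W \<in> C \<Longrightarrow> \<exists>w\<in>carrier (An W). \<forall>x\<in>W. u x = h x \<otimes>\<^bsub>residue_field x\<^esub> w x"
  using assms unfolding multiples_def by blast

lemma multiples_carrier: "u \<in> multiples h V \<Longrightarrow> u \<in> carrier (An V)"
  by (simp add: multiples_def)

lemma multiple_restrict:
  assumes "\<exists>w\<in>carrier (An W). \<forall>x\<in>W. u x = h x \<otimes>\<^bsub>residue_field x\<^esub> w x" "W' \<subseteq> W"
  shows "\<exists>w\<in>carrier (An W'). \<forall>x\<in>W'. u x = h x \<otimes>\<^bsub>residue_field x\<^esub> w x"
proof -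
  obtain w where w: "w \<in> carrier (An W)" "\<forall>x\<in>W. u x = h x \<otimes>\<^bsub>residue_field x\<^esub> w x"
    using assms(1) by blast
  show ?thesis
    using An_restrict[OF w(1) assms(2)] w(2) assms(2) by (intro bexI[of _ "restrict w W'"]) auto
qed

lemma ideal_multiples:
  assumes h: "h \<in> carrier (An D)" and V: "affinoid v V" "V \<subseteq> D"
  shows "ideal (multiples h V) (An V)"
proof -
  have VA: "V \<subseteq> affine_line v" by (rule affinoid_subset_affine[OF V(1)])
  interpret V: cring "An V" using VA by (rule cring_An)
  have hx: "h x \<in> carrier (residue_field x)" "point x" if "x \<in> V" for x
    using that An_value[OF h, of x] V(2) VA point by blast+
  have zero: "\<zero>\<^bsub>An V\<^esub> \<in> multiples h V"
  proof (rule multiplesI[OF An_zero_closed[OF VA] G_covering_singleton[OF V(1)]])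
    fix W assume "W \<in> {V}"
    then have "\<forall>x\<in>W. \<zero>\<^bsub>An V\<^esub> x = h x \<otimes>\<^bsub>residue_field x\<^esub> \<zero>\<^bsub>An W\<^esub> x"
      using ring.ring_simprules(25)[OF point_ring] hx VA by (auto simp: An_simps subset_iff)
    then show "\<exists>w\<in>carrier (An W). \<forall>x\<in>W. \<zero>\<^bsub>An V\<^esub> x = h x \<otimes>\<^bsub>residue_field x\<^esub> w x"
      using \<open>W \<in> {V}\<close> An_zero_closed[OF VA] by blast
  qed
  have add: "u \<oplus>\<^bsub>An V\<^esub> u' \<in> multiples h V" if u: "u \<in> multiples h V" and u': "u' \<in> multiples h V" for u u'
  proof -
    obtain C where C: "G_covering v V C"
      "\<And>W. W \<in> C \<Longrightarrow> \<exists>w\<in>carrier (An W). \<forall>x\<in>W. u x = h x \<otimes>\<^bsub>residue_field x\<^esub> w x"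
      using u by (rule multiplesE) blast
    obtain C' where C': "G_covering v V C'"
      "\<And>W. W \<in> C' \<Longrightarrow> \<exists>w\<in>carrier (An W). \<forall>x\<in>W. u' x = h x \<otimes>\<^bsub>residue_field x\<^esub> w x"
      using u' by (rule multiplesE) blast
    show ?thesis
    proof (rule multiplesI[OF _ G_covering_Int[OF C(1) C'(1)]])
      show "u \<oplus>\<^bsub>An V\<^esub> u' \<in> carrier (An V)"
        using u u' by (intro An_add_closed VA multiples_carrier)
      fix Y assume Y: "Y \<in> (\<Union>W\<in>C. (\<lambda>W'. W' \<inter> W) ` C')"
      then obtain W W' where W: "W \<in> C" "W' \<in> C'" "Y = W' \<inter> W" by blast
      have YV: "Y \<subseteq> V" using W G_covering_subset[OF C(1)] by blast
      then have YA: "Y \<subseteq> affine_line v" using VA by blast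
      obtain w where w: "w \<in> carrier (An Y)" "\<forall>x\<in>Y. u x = h x \<otimes>\<^bsub>residue_field x\<^esub> w x"
        using multiple_restrict[OF C(2)[OF W(1)], of Y] W(3) by blast
      obtain w' where w': "w' \<in> carrier (An Y)" "\<forall>x\<in>Y. u' x = h x \<otimes>\<^bsub>residue_field x\<^esub> w' x"
        using multiple_restrict[OF C'(2)[OF W(2)], of Y] W(3) by blast
      have "(u \<oplus>\<^bsub>An V\<^esub> u') x = h x \<otimes>\<^bsub>residue_field x\<^esub> (w \<oplus>\<^bsub>An Y\<^esub> w') x" if x: "x \<in> Y" for x
      proof -
        have xV: "x \<in> V" using x YV by blast
        interpret x: point x using hx(2)[OF xV] .
        show ?thesis
          using x xV w(2) w'(2) hx(1)[OF xV] An_value[OF w(1) x] An_value[OF w'(1) x]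
          by (simp add: An_simps x.H.r_distr)
      qed
      then show "\<exists>w\<in>carrier (An Y). \<forall>x\<in>Y. (u \<oplus>\<^bsub>An V\<^esub> u') x = h x \<otimes>\<^bsub>residue_field x\<^esub> w x"
        using An_add_closed[OF YA w(1) w'(1)] by blast
    qed
  qed
  have mult: "a \<otimes>\<^bsub>An V\<^esub> u \<in> multiples h V" if a: "a \<in> carrier (An V)" and u: "u \<in> multiples h V" for a u
  proof -
    obtain C where C: "G_covering v V C"
      "\<And>W. W \<in> C \<Longrightarrow> \<exists>w\<in>carrier (An W). \<forall>x\<in>W. u x = h x \<otimes>\<^bsub>residue_field x\<^esub> w x"
      using u by (rule multiplesE) blast
    show ?thesis
    proof (rule multiplesI[OF _ C(1)])
      show "a \<otimes>\<^bsub>An V\<^esub> u \<in> carrier (An V)"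
        by (intro An_mult_closed VA a multiples_carrier[OF u])
      fix W assume W: "W \<in> C"
      have WV: "W \<subseteq> V" using G_covering_subset[OF C(1) W] .
      then have WA: "W \<subseteq> affine_line v" using VA by blast
      obtain w where w: "w \<in> carrier (An W)" "\<forall>x\<in>W. u x = h x \<otimes>\<^bsub>residue_field x\<^esub> w x"
        using C(2)[OF W] by blast
      have aW: "restrict a W \<in> carrier (An W)" using a WV by (rule An_restrict)
      have "(a \<otimes>\<^bsub>An V\<^esub> u) x = h x \<otimes>\<^bsub>residue_field x\<^esub> (restrict a W \<otimes>\<^bsub>An W\<^esub> w) x" if x: "x \<in> W" for x
      proof -
        have xV: "x \<in> V" using x WV by blast
        interpret x: point x using hx(2)[OF xV] .
        show ?thesis
          using x xV w(2) hx(1)[OF xV] An_value[OF w(1) x] An_value[OF a xV]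
          by (simp add: An_simps x.H.m_lcomm)
      qed
      then show "\<exists>w\<in>carrier (An W). \<forall>x\<in>W. (a \<otimes>\<^bsub>An V\<^esub> u) x = h x \<otimes>\<^bsub>residue_field x\<^esub> w x"
        using An_mult_closed[OF WA aW w(1)] by blast
    qed
  qed
  show ?thesis
  proof (rule idealI[OF V.ring_axioms])
    show "subgroup (multiples h V) (add_monoid (An V))"
    proof (rule group.subgroupI)
      show "group (add_monoid (An V))" by (rule V.a_group)
      show "multiples h V \<subseteq> carrier (add_monoid (An V))" using multiples_carrier by auto
      show "multiples h V \<noteq> {}" using zero by blast
      fix u u' assume u: "u \<in> multiples h V" and u': "u' \<in> multiples h V"
      have "\<ominus>\<^bsub>An V\<^esub> u = (\<ominus>\<^bsub>An V\<^esub> \<one>\<^bsub>An V\<^esub>) \<otimes>\<^bsub>An V\<^esub> u"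
        using multiples_carrier[OF u] by (simp add: V.l_minus)
      then have "\<ominus>\<^bsub>An V\<^esub> u \<in> multiples h V"
        using mult[OF V.a_inv_closed[OF V.one_closed] u] by (simp only:)
      then show "inv\<^bsub>add_monoid (An V)\<^esub> u \<in> multiples h V"
        by (simp only: a_inv_def)
      show "u \<otimes>\<^bsub>add_monoid (An V)\<^esub> u' \<in> multiples h V" using add[OF u u'] by simp
    qed
    fix u a assume u: "u \<in> multiples h V" and a: "a \<in> carrier (An V)"
    show "a \<otimes>\<^bsub>An V\<^esub> u \<in> multiples h V" using mult[OF a u] .
    then show "u \<otimes>\<^bsub>An V\<^esub> a \<in> multiples h V" using V.m_comm[OF a multiples_carrier[OF u]] by simp
  qed
qed

lemma multiples_restrict:
  assumes u: "u \<in> multiples h V" and V': "affinoid v V'" "V' \<subseteq> V"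
  shows "restrict u V' \<in> multiples h V'"
proof -
  obtain C where C: "G_covering v V C"
    "\<And>W. W \<in> C \<Longrightarrow> \<exists>w\<in>carrier (An W). \<forall>x\<in>W. u x = h x \<otimes>\<^bsub>residue_field x\<^esub> w x"
    using u by (rule multiplesE) blast
  show ?thesis
  proof (rule multiplesI[OF An_restrict[OF multiples_carrier[OF u] V'(2)] G_covering_restrict[OF C(1) V']])
    fix Y assume "Y \<in> (\<lambda>W. W \<inter> V') ` C"
    then obtain W where W: "W \<in> C" "Y = W \<inter> V'" by blast
    have "\<exists>w\<in>carrier (An Y). \<forall>x\<in>Y. u x = h x \<otimes>\<^bsub>residue_field x\<^esub> w x"
      using multiple_restrict[OF C(2)[OF W(1)], of Y] W(2) by blast
    then show "\<exists>w\<in>carrier (An Y). \<forall>x\<in>Y. restrict u V' x = h x \<otimes>\<^bsub>residue_field x\<^esub> w x"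
      using W(2) by auto
  qed
qed

lemma multiples_local:
  assumes u: "u \<in> carrier (An V)" and C: "G_covering v V C"
    and loc: "\<And>V'. V' \<in> C \<Longrightarrow> restrict u V' \<in> multiples h V'"
  shows "u \<in> multiples h V"
proof -
  have "\<exists>C'. G_covering v V' C' \<and>
      (\<forall>W\<in>C'. \<exists>w\<in>carrier (An W). \<forall>x\<in>W. u x = h x \<otimes>\<^bsub>residue_field x\<^esub> w x)" if V': "V' \<in> C" for V'
  proof -
    obtain C' where C': "G_covering v V' C'"
      "\<And>W. W \<in> C' \<Longrightarrow> \<exists>w\<in>carrier (An W). \<forall>x\<in>W. restrict u V' x = h x \<otimes>\<^bsub>residue_field x\<^esub> w x"
      using loc[OF V'] by (rule multiplesE) blast
    have "\<exists>w\<in>carrier (An W). \<forall>x\<in>W. u x = h x \<otimes>\<^bsub>residue_field x\<^esub> w x" if W: "W \<in> C'" for W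
    proof -
      have "W \<subseteq> V'" using G_covering_subset[OF C'(1) W] .
      then have "\<And>x. x \<in> W \<Longrightarrow> restrict u V' x = u x" by auto
      then show ?thesis using C'(2)[OF W] by simp
    qed
    then show ?thesis using C'(1) by blast
  qed
  then obtain C' where C': "\<And>V'. V' \<in> C \<Longrightarrow> G_covering v V' (C' V')"
    "\<And>V' W. V' \<in> C \<Longrightarrow> W \<in> C' V' \<Longrightarrow> \<exists>w\<in>carrier (An W). \<forall>x\<in>W. u x = h x \<otimes>\<^bsub>residue_field x\<^esub> w x"
    by metis
  show ?thesis
    by (rule multiplesI[OF u G_covering_trans[OF C C'(1)]]) (use C'(2) in blast)+
qed

lemma ideal_sheaf_multiples:
  assumes h: "h \<in> carrier (An D)"
  shows "ideal_sheaf v D (multiples h)"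
  unfolding ideal_sheaf_def
proof (intro conjI allI impI; elim conjE)
  show "ideal (multiples h V) (An V)" if "affinoid v V" "V \<subseteq> D" for V
    using ideal_multiples[OF h that] .
  show "restrict u V' \<in> multiples h V'" if "u \<in> multiples h V" "affinoid v V'" "V' \<subseteq> V" for u V V'
    using multiples_restrict[OF that] .
  show "u \<in> multiples h V" if "u \<in> carrier (An V)" "G_covering v V C" "\<forall>V'\<in>C. restrict u V' \<in> multiples h V'" for u V C
    using multiples_local[OF that(1,2)] that(3) by blast
qed

lemma multiples_self:
  assumes h: "h \<in> carrier (An D)" and V: "affinoid v V" "V \<subseteq> D"
  shows "restrict h V \<in> multiples h V"
proof (rule multiplesI[OF An_restrict[OF h V(2)] G_covering_singleton[OF V(1)]])
  have VA: "V \<subseteq> affine_line v" by (rule affinoid_subset_affine[OF V(1)])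
  fix W assume W: "W \<in> {V}"
  have "restrict h V x = h x \<otimes>\<^bsub>residue_field x\<^esub> \<one>\<^bsub>An V\<^esub> x" if x: "x \<in> V" for x
  proof -
    interpret x: point x using x VA point by blast
    have "h x \<in> carrier x.H" using An_value[OF h] x V(2) by blast
    then show ?thesis using x by (simp add: An_simps)
  qed
  then show "\<exists>w\<in>carrier (An W). \<forall>x\<in>W. restrict h V x = h x \<otimes>\<^bsub>residue_field x\<^esub> w x"
    using W An_one_closed[OF VA] by blast
qed

text \<open>
  One generator \<open>h\<close> and no relations, since \<open>h\<close> is regular.
\<close>

lemma finitely_presented_multiples_regular:
  assumes h: "h \<in> carrier (An D)" and V: "affinoid v V" "V \<subseteq> D" and reg: "regular_element v V (restrict h V)"
  shows "finitely_presented_on v V (multiples h)"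
proof -
  let ?s = "\<lambda>_ :: nat. restrict h V"
  have lc: "lin_comb v W 1 c ?s = c 0 \<otimes>\<^bsub>An W\<^esub> restrict (restrict h V) W"
    if W: "W \<subseteq> V" and c: "c 0 \<in> carrier (An W)" for W and c :: "nat \<Rightarrow> 'a sect"
  proof -
    have WA: "W \<subseteq> affine_line v" using W affinoid_subset_affine[OF V(1)] by blast
    interpret W: cring "An W" using WA by (rule cring_An)
    have hW: "restrict (restrict h V) W \<in> carrier (An W)"
      using An_restrict[OF An_restrict[OF h V(2)] W] .
    have "lin_comb v W (Suc 0) c ?s = c 0 \<otimes>\<^bsub>An W\<^esub> restrict (?s 0) W \<oplus>\<^bsub>An W\<^esub> lin_comb v W 0 c ?s"
      by (rule lin_comb_Suc[OF WA]) (use c hW in auto)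
    then show ?thesis
      unfolding lin_comb_0[OF WA] using c hW W.m_closed[OF c hW] by simp
  qed
  show ?thesis
    unfolding finitely_presented_on_def
  proof (rule exI[of _ 1], rule exI[of _ ?s], rule exI[of _ 0], rule exI[of _ "\<lambda>_ _. undefined"],
      intro conjI allI impI; (elim conjE)?)
    show "restrict h V \<in> multiples h V" by (rule multiples_self[OF h V])
  next
    fix V' u assume V': "affinoid v V'" "V' \<subseteq> V" and u: "u \<in> multiples h V'"
    obtain C where C: "G_covering v V' C"
      "\<And>W. W \<in> C \<Longrightarrow> \<exists>w\<in>carrier (An W). \<forall>x\<in>W. u x = h x \<otimes>\<^bsub>residue_field x\<^esub> w x"
      using u by (rule multiplesE) blast
    have "\<exists>c. (\<forall>j<1. c j \<in> carrier (An W)) \<and> restrict u W = lin_comb v W 1 c ?s" if W: "W \<in> C" for W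
    proof -
      have WV: "W \<subseteq> V'" "W \<subseteq> V" "W \<subseteq> affine_line v"
        using G_covering_subset[OF C(1) W] V'(2) affinoid_subset_affine[OF V(1)] by auto
      obtain w where w: "w \<in> carrier (An W)" "\<forall>x\<in>W. u x = h x \<otimes>\<^bsub>residue_field x\<^esub> w x"
        using C(2)[OF W] by blast
      have "restrict u W = w \<otimes>\<^bsub>An W\<^esub> restrict (restrict h V) W"
        unfolding An_simps
      proof (rule restrict_ext)
        fix x assume x: "x \<in> W"
        interpret x: point x using x WV(3) point by blast
        have "h x \<in> carrier x.H" using An_value[OF h] x WV(2) V(2) by blast
        then show "u x = w x \<otimes>\<^bsub>x.H\<^esub> restrict (restrict h V) W x"
          using w(2) x WV(2) An_value[OF w(1) x] by (auto simp: subset_iff x.H.m_comm)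
      qed
      then have "restrict u W = lin_comb v W 1 (\<lambda>_. w) ?s"
        using lc[OF WV(2), of "\<lambda>_. w"] w(1) by simp
      then show ?thesis using w(1) by (intro exI[of _ "\<lambda>_. w"]) simp
    qed
    then show "\<exists>C. G_covering v V' C \<and> (\<forall>W\<in>C. \<exists>c. (\<forall>j<1. c j \<in> carrier (An W)) \<and> restrict u W = lin_comb v W 1 c ?s)"
      using C(1) by blast
  next
    fix V' and c :: "nat \<Rightarrow> 'a sect"
    assume V': "affinoid v V'" "V' \<subseteq> V" and c: "\<forall>j<1. c j \<in> carrier (An V')"
      and 0: "lin_comb v V' 1 c ?s = \<zero>\<^bsub>An V'\<^esub>"
    have VA: "V' \<subseteq> affine_line v" using affinoid_subset_affine[OF V'(1)] .
    interpret V': cring "An V'" using VA by (rule cring_An)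
    have c0: "c 0 \<in> carrier (An V')" using c by simp
    have hV': "restrict (restrict h V) V' \<in> carrier (An V')"
      using An_restrict[OF An_restrict[OF h V(2)] V'(2)] .
    have "restrict (restrict h V) V' \<otimes>\<^bsub>An V'\<^esub> c 0 = \<zero>\<^bsub>An V'\<^esub>"
      using 0 lc[OF V'(2), of c] c0 V'.m_comm[OF c0 hV'] by simp
    then have "c 0 = \<zero>\<^bsub>An V'\<^esub>"
      by (rule regular_element_cancel[OF reg V' c0])
    then have "\<forall>j<1. restrict (c j) V' = lin_comb v V' 0 d r" for d r
      using An_extensional[OF c0] by (simp add: lin_comb_0[OF VA])
    then have "\<forall>W\<in>{V'}. \<exists>d. (\<forall>i<0. d i \<in> carrier (An W)) \<and>
        (\<forall>j<1. restrict (c j) W = lin_comb v W 0 d (\<lambda>i. undefined))" by simp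
    then show "\<exists>C. G_covering v V' C \<and> (\<forall>W\<in>C. \<exists>d. (\<forall>i<0. d i \<in> carrier (An W)) \<and>
        (\<forall>j<1. restrict (c j) W = lin_comb v W 0 d (\<lambda>i. undefined)))"
      using G_covering_singleton[OF V'(1)] by blast
  qed simp_all
qed

text \<open>
  The zero ideal needs no generators.
\<close>

lemma finitely_presented_multiples_zero:
  assumes V: "affinoid v V" and h: "\<And>x. x \<in> V \<Longrightarrow> h x = \<zero>\<^bsub>residue_field x\<^esub>"
  shows "finitely_presented_on v V (multiples h)"
  unfolding finitely_presented_on_def
proof (rule exI[of _ 0], rule exI[of _ "\<lambda>_. undefined"], rule exI[of _ 0], rule exI[of _ "\<lambda>_ _. undefined"],
    intro conjI allI impI; (elim conjE)?)
  fix V' u assume V': "affinoid v V'" "V' \<subseteq> V" and u: "u \<in> multiples h V'"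
  obtain C where C: "G_covering v V' C"
    "\<And>W. W \<in> C \<Longrightarrow> \<exists>w\<in>carrier (An W). \<forall>x\<in>W. u x = h x \<otimes>\<^bsub>residue_field x\<^esub> w x"
    using u by (rule multiplesE) blast
  have "restrict u W = lin_comb v W 0 c s" if W: "W \<in> C" for W c s
  proof -
    have WV: "W \<subseteq> V" "W \<subseteq> affine_line v"
      using G_covering_subset[OF C(1) W] V'(2) affinoid_subset_affine[OF V(1)] by auto
    obtain w where w: "w \<in> carrier (An W)" "\<forall>x\<in>W. u x = h x \<otimes>\<^bsub>residue_field x\<^esub> w x"
      using C(2)[OF W] by blast
    show ?thesis
      unfolding lin_comb_0[OF WV(2)] An_simps
    proof (rule restrict_ext)
      fix x assume x: "x \<in> W"
      interpret x: point x using x WV(2) point by blast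
      show "u x = \<zero>\<^bsub>x.H\<^esub>"
        using w(2) x h[of x] WV(1) An_value[OF w(1) x] by (auto simp: subset_iff)
    qed
  qed
  then have "\<forall>W\<in>C. \<exists>c. (\<forall>j<0. c j \<in> carrier (An W)) \<and> restrict u W = lin_comb v W 0 c (\<lambda>_. undefined)"
    by simp
  then show "\<exists>C. G_covering v V' C \<and> (\<forall>W\<in>C. \<exists>c. (\<forall>j<0. c j \<in> carrier (An W)) \<and> restrict u W = lin_comb v W 0 c (\<lambda>_. undefined))"
    using C(1) by blast
next
  fix V' and c :: "nat \<Rightarrow> 'a sect" assume V': "affinoid v V'"
  show "\<exists>C. G_covering v V' C \<and> (\<forall>W\<in>C. \<exists>d. (\<forall>i<0. d i \<in> carrier (An W)) \<and>
      (\<forall>j<0. restrict (c j) W = lin_comb v W 0 d (\<lambda>i. undefined)))"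
    using G_covering_singleton[OF V'] by (intro exI[of _ "{V'}"]) simp
qed simp_all

lemma zariski_closed_multiples:
  assumes D: "disc D" and h: "h \<in> carrier (An D)"
    and pres: "\<And>r. 0 < r \<Longrightarrow> closed_disc v r \<subseteq> D \<Longrightarrow> finitely_presented_on v (closed_disc v r) (multiples h)"
  shows "zariski_closed v D {x \<in> D. h x = \<zero>\<^bsub>residue_field x\<^esub>}"
  unfolding zariski_closed_def
proof (rule exI[of _ "multiples h"], rule conjI)
  have "\<forall>V\<in>{closed_disc v r | r. 0 < r \<and> closed_disc v r \<subseteq> D}. finitely_presented_on v V (multiples h)"
    using pres by blast
  then show "coherent_ideal_sheaf v D (multiples h)"
    unfolding coherent_ideal_sheaf_def using ideal_sheaf_multiples[OF h] disc_covering[OF D] by blast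
  show "{x \<in> D. h x = \<zero>\<^bsub>residue_field x\<^esub>}
    = {x \<in> D. \<forall>V u. affinoid v V \<and> V \<subseteq> D \<and> x \<in> V \<and> u \<in> multiples h V \<longrightarrow> x \<in> zero_locus V u}"
  proof (rule equalityI; rule subsetI)
    fix x assume "x \<in> {x \<in> D. h x = \<zero>\<^bsub>residue_field x\<^esub>}"
    then have x: "x \<in> D" "h x = \<zero>\<^bsub>residue_field x\<^esub>" by auto
    interpret x: point x using x(1) disc_affine[OF D] point by blast
    have "x \<in> zero_locus V u" if V: "affinoid v V" "x \<in> V" and u: "u \<in> multiples h V" for V u
    proof -
      obtain C where C: "G_covering v V C"
        "\<And>W. W \<in> C \<Longrightarrow> \<exists>w\<in>carrier (An W). \<forall>x\<in>W. u x = h x \<otimes>\<^bsub>residue_field x\<^esub> w x"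
        using u by (rule multiplesE) blast
      obtain W where W: "W \<in> C" "x \<in> W" using G_covering_obtain[OF C(1) V(2)] by blast
      obtain w where w: "w \<in> carrier (An W)" "\<forall>x\<in>W. u x = h x \<otimes>\<^bsub>residue_field x\<^esub> w x"
        using C(2)[OF W(1)] by blast
      have "u x = \<zero>\<^bsub>x.H\<^esub>"
        using w(2) W(2) x(2) An_value[OF w(1) W(2)] by simp
      then show ?thesis using V(2) by (simp add: zero_locus_def)
    qed
    then show "x \<in> {x \<in> D. \<forall>V u. affinoid v V \<and> V \<subseteq> D \<and> x \<in> V \<and> u \<in> multiples h V \<longrightarrow> x \<in> zero_locus V u}"
      using x(1) by blast
  next
    fix x assume "x \<in> {x \<in> D. \<forall>V u. affinoid v V \<and> V \<subseteq> D \<and> x \<in> V \<and> u \<in> multiples h V \<longrightarrow> x \<in> zero_locus V u}"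
    then have x: "x \<in> D" and all: "\<And>V u. affinoid v V \<Longrightarrow> V \<subseteq> D \<Longrightarrow> x \<in> V \<Longrightarrow> u \<in> multiples h V \<Longrightarrow> x \<in> zero_locus V u"
      by auto
    obtain V where V: "V \<in> {closed_disc v r | r. 0 < r \<and> closed_disc v r \<subseteq> D}" "x \<in> V"
      using G_covering_obtain[OF disc_covering[OF D] x] by blast
    have aff: "affinoid v V" "V \<subseteq> D" using V(1) affinoid_closed_disc by auto
    have "x \<in> zero_locus V (restrict h V)"
      using all[OF aff V(2) multiples_self[OF h aff]] .
    then show "x \<in> {x \<in> D. h x = \<zero>\<^bsub>residue_field x\<^esub>}"
      using x V(2) by (simp add: zero_locus_def)
  qed
qed

text \<open>
  The sheaf of multiples of \<open>h\<close> is coherent when \<open>h\<close> is regular, which holds for the extension of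
  \<open>T^N f\<close> unless \<open>f\<close> is zero; in that case \<open>Z = D\<close>.
\<close>

lemma zariski_of_no_essential_singularity:
  assumes D: "disc D" and f: "f \<in> carrier (An (D - {origin v}))"
    and ness: "no_essential_singularity (D - {origin v}) f"
  shows "\<exists>Z. zariski_closed v D Z \<and> zero_locus (D - {origin v}) f = Z \<inter> (D - {origin v})"
proof (cases "\<forall>x\<in>D - {origin v}. f x = \<zero>\<^bsub>residue_field x\<^esub>")
  case True
  have DA: "D \<subseteq> affine_line v" using disc_affine[OF D] .
  have z: "\<And>x. x \<in> D \<Longrightarrow> \<zero>\<^bsub>An D\<^esub> x = \<zero>\<^bsub>residue_field x\<^esub>" by (simp add: An_simps)
  have "zariski_closed v D {x \<in> D. \<zero>\<^bsub>An D\<^esub> x = \<zero>\<^bsub>residue_field x\<^esub>}"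
    using z by (intro zariski_closed_multiples[OF D An_zero_closed[OF DA]] finitely_presented_multiples_zero
        affinoid_closed_disc) blast+
  moreover have "{x \<in> D. \<zero>\<^bsub>An D\<^esub> x = \<zero>\<^bsub>residue_field x\<^esub>} = D" using z by auto
  ultimately have "zariski_closed v D D" by simp
  moreover have "zero_locus (D - {origin v}) f = D \<inter> (D - {origin v})"
    using True by (auto simp: zero_locus_def)
  ultimately show ?thesis by blast
next
  case False
  let ?U = "D - {origin v}"
  obtain x0 where x0: "x0 \<in> ?U" "f x0 \<noteq> \<zero>\<^bsub>residue_field x0\<^esub>" using False by blast
  obtain N h where "analytic_multiple D f N h"
    using analytic_multiple_exists[OF D f ness] by blast
  then obtain P where h: "h \<in> carrier (An D)"
    and P: "\<forall>r>0. closed_disc v r \<subseteq> D \<longrightarrow> poly_limit (closed_disc v r) h P"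
    and hf: "\<forall>x\<in>?U. h x = f x \<otimes>\<^bsub>residue_field x\<^esub> fract_value x (T1 ^ N)"
    unfolding analytic_multiple_def by blast
  have zero_iff: "h x = \<zero>\<^bsub>residue_field x\<^esub> \<longleftrightarrow> f x = \<zero>\<^bsub>residue_field x\<^esub>" if x: "x \<in> ?U" for x
  proof -
    have xa: "x \<in> affine_line v" "0 < x T" using x disc_punctured_iff[OF D] disc_affine[OF D] by blast+
    interpret x: point x using xa(1) by (rule point)
    show ?thesis
      using x.mult_eq_zero_iff_H[OF An_value[OF f x] T_power_nonzero(1)[OF xa, of N]] T_power_nonzero(2)[OF xa, of N] hf x
      by simp
  qed
  have "finitely_presented_on v (closed_disc v r) (multiples h)" if r: "0 < r" "closed_disc v r \<subseteq> D" for r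
  proof (rule finitely_presented_multiples_regular[OF h affinoid_closed_disc[OF r(1)] r(2)])
    have g: "gauss v r \<in> ?U" "gauss v r \<in> closed_disc v r"
      using gauss_in_disc[OF r(2,1) order_refl] gauss_in_disc[OF subset_refl r(1) order_refl] by auto
    show "regular_element v (closed_disc v r) (restrict h (closed_disc v r))"
    proof (rule regular_of_poly_limit[OF r(1) An_restrict[OF h r(2)]])
      have "poly_limit (closed_disc v r) h P" using P r by blast
      then show "poly_limit (closed_disc v r) (restrict h (closed_disc v r)) P"
        by (simp add: poly_limit_def)
      show "restrict h (closed_disc v r) (gauss v r) \<noteq> \<zero>\<^bsub>residue_field (gauss v r)\<^esub>"
        using zero_iff[OF g(1)] nonzero_at_gauss[OF D f x0 r(1) g(1)] g(2) by simp
    qed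
  qed
  then have "zariski_closed v D {x \<in> D. h x = \<zero>\<^bsub>residue_field x\<^esub>}"
    by (rule zariski_closed_multiples[OF D h])
  moreover have "zero_locus ?U f = {x \<in> D. h x = \<zero>\<^bsub>residue_field x\<^esub>} \<inter> ?U"
    using zero_iff by (auto simp: zero_locus_def)
  ultimately show ?thesis by blast
qed

subsection \<open>Zariski-closed sets near the origin\<close>

lemma finitely_presented_generators:
  assumes "finitely_presented_on v V J"
  obtains n s where "\<forall>j<n. s j \<in> J V"
    "\<forall>V' h. affinoid v V' \<and> V' \<subseteq> V \<and> h \<in> J V' \<longrightarrow>
      (\<exists>C. G_covering v V' C \<and> (\<forall>W\<in>C. \<exists>c. (\<forall>j<n. c j \<in> carrier (An W)) \<and> restrict h W = lin_comb v W n c s))"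
  using assms unfolding finitely_presented_on_def by (elim exE conjE) (rule that)

text \<open>
  The ideal sheaf has finitely many generators over an affinoid neighbourhood of the origin. If
  one of them does not vanish identically near the origin, its zeros are isolated and it excludes
  all points near the origin; if all of them vanish there, every section of the sheaf does.
\<close>

lemma zariski_closed_near_origin:
  assumes D: "disc D" and Z: "zariski_closed v D Z"
  obtains e where "0 < e" "closed_disc v e \<subseteq> D" "closed_disc v e - {origin v} \<subseteq> Z"
  | e where "0 < e" "closed_disc v e \<subseteq> D" "Z \<inter> (closed_disc v e - {origin v}) = {}"
proof -
  obtain J where J: "coherent_ideal_sheaf v D J"
    and ZJ: "Z = {x \<in> D. \<forall>V u. affinoid v V \<and> V \<subseteq> D \<and> x \<in> V \<and> u \<in> J V \<longrightarrow> x \<in> zero_locus V u}"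
    using Z unfolding zariski_closed_def by blast
  have sheaf: "ideal_sheaf v D J" using J by (simp add: coherent_ideal_sheaf_def)
  obtain C where C: "G_covering v D C" "\<forall>V\<in>C. finitely_presented_on v V J"
    using J unfolding coherent_ideal_sheaf_def by blast
  obtain V where V: "V \<in> C" "origin v \<in> V"
    using G_covering_obtain[OF C(1) disc_origin[OF D]] by blast
  have aff: "affinoid v V" "V \<subseteq> D"
    using G_covering_affinoid[OF C(1) V(1)] G_covering_subset[OF C(1) V(1)] by auto
  have JV: "ideal (J V') (An V')" if "affinoid v V'" "V' \<subseteq> D" for V'
    using sheaf that unfolding ideal_sheaf_def by blast
  have Jres: "restrict u V'' \<in> J V''" if "affinoid v V'" "V' \<subseteq> D" "affinoid v V''" "V'' \<subseteq> V'" "u \<in> J V'" for u V' V''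
    using sheaf that unfolding ideal_sheaf_def by blast
  have Jcar: "u \<in> carrier (An V')" if "affinoid v V'" "V' \<subseteq> D" "u \<in> J V'" for u V'
    using ideal.Icarr[OF JV[OF that(1,2)] that(3)] .
  have fp: "finitely_presented_on v V J" using C(2) V(1) by blast
  obtain n :: nat and s where s: "\<forall>j<n. s j \<in> J V"
    and gen: "\<forall>V' h. affinoid v V' \<and> V' \<subseteq> V \<and> h \<in> J V' \<longrightarrow>
        (\<exists>C. G_covering v V' C \<and> (\<forall>W\<in>C. \<exists>c. (\<forall>j<n. c j \<in> carrier (An W)) \<and> restrict h W = lin_comb v W n c s))"
    by (rule finitely_presented_generators[OF fp])
  obtain e where e: "0 < e" "closed_disc v e \<subseteq> V"
    using affinoid_contains_disc[OF aff(1) V(2)] by blast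
  let ?U' = "closed_disc v e - {origin v}"
  have eD: "closed_disc v e \<subseteq> D" using e(2) aff(2) by blast
  show ?thesis
  proof (cases "\<exists>j<n. \<exists>x\<in>?U'. s j x \<noteq> \<zero>\<^bsub>residue_field x\<^esub>")
    case True
    then obtain j x where j: "j < n" "x \<in> ?U'" "s j x \<noteq> \<zero>\<^bsub>residue_field x\<^esub>" by blast
    have sj: "s j \<in> J V" using s j(1) by blast
    obtain \<epsilon> where \<epsilon>: "0 < \<epsilon>" "\<epsilon> \<le> e"
      "\<And>y. y \<in> closed_disc v \<epsilon> - {origin v} \<Longrightarrow> s j y \<noteq> \<zero>\<^bsub>residue_field y\<^esub>"
      using isolated_zero[OF aff(1) Jcar[OF aff sj] e j(2,3)] by blast
    have "Z \<inter> (closed_disc v \<epsilon> - {origin v}) = {}"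
    proof (rule ccontr)
      assume "\<not> ?thesis"
      then obtain y where y: "y \<in> Z" "y \<in> closed_disc v \<epsilon> - {origin v}" by blast
      have "y \<in> V" using y(2) closed_disc_mono[OF \<epsilon>(2)] e(2) by blast
      then have "y \<in> zero_locus V (s j)" using y(1) aff sj unfolding ZJ by blast
      then show False using \<epsilon>(3)[OF y(2)] by (simp add: zero_locus_def)
    qed
    moreover have "closed_disc v \<epsilon> \<subseteq> D" using closed_disc_mono[OF \<epsilon>(2)] eD by blast
    ultimately show ?thesis using that(2) \<epsilon>(1) by blast
  next
    case False
    have "x \<in> Z" if x: "x \<in> ?U'" for x
      unfolding ZJ
    proof (intro CollectI conjI allI impI; (elim conjE)?)
      show "x \<in> D" using x eD by blast
      fix V' u assume V': "affinoid v V'" "V' \<subseteq> D" "x \<in> V'" and u: "u \<in> J V'"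
      let ?Y = "V' \<inter> V"
      have Y: "affinoid v ?Y" "?Y \<subseteq> V" "x \<in> ?Y"
        using affinoid_Int[OF V'(1) aff(1)] x e(2) V'(3) by auto
      have uY: "restrict u ?Y \<in> J ?Y" using Jres[OF V'(1,2) Y(1) _ u] by blast
      obtain C' where C': "G_covering v ?Y C'"
        "\<forall>W\<in>C'. \<exists>c. (\<forall>j<n. c j \<in> carrier (An W)) \<and> restrict (restrict u ?Y) W = lin_comb v W n c s"
        using gen Y(1,2) uY by blast
      obtain W where W: "W \<in> C'" "x \<in> W" using G_covering_obtain[OF C'(1) Y(3)] by blast
      have WY: "W \<subseteq> ?Y" "W \<subseteq> affine_line v"
        using G_covering_subset[OF C'(1) W(1)] affinoid_subset_affine[OF Y(1)] by auto
      obtain c where c: "\<forall>j<n. c j \<in> carrier (An W)" "restrict (restrict u ?Y) W = lin_comb v W n c s"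
        using C'(2) W(1) by blast
      have "lin_comb v W n c s x = \<zero>\<^bsub>residue_field x\<^esub>"
      proof (rule lin_comb_eval_zero[OF WY(2) W(2)])
        fix j assume j: "j < n"
        show "c j \<in> carrier (An W)" using c(1) j by blast
        have "s j \<in> carrier (An V)" using Jcar[OF aff] s j by blast
        then show "restrict (s j) W \<in> carrier (An W)" by (rule An_restrict) (use WY(1) in blast)
        show "s j x = \<zero>\<^bsub>residue_field x\<^esub>" using False j x by blast
      qed
      then have "u x = \<zero>\<^bsub>residue_field x\<^esub>"
        using fun_cong[OF c(2), of x] W(2) Y(3) by simp
      then show "x \<in> zero_locus V' u" using V'(3) by (simp add: zero_locus_def)
    qed
    then show ?thesis using that(1)[OF e(1) eD] by blast
  qed
qed

text \<open>
  If \<open>Z\<close> contains a punctured disc, then \<open>f\<close> vanishes at some Gauss point and so everywhere. If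
  \<open>Z\<close> avoids one, \<open>f\<close> has no zeros on it.
\<close>

lemma zero_or_invertible_of_zariski:
  assumes D: "disc D" and f: "f \<in> carrier (An (D - {origin v}))"
    and Z: "zariski_closed v D Z" and zero: "zero_locus (D - {origin v}) f = Z \<inter> (D - {origin v})"
  shows "(\<forall>x\<in>D - {origin v}. f x = \<zero>\<^bsub>residue_field x\<^esub>) \<or> invertible_near_origin v D f"
proof -
  let ?U = "D - {origin v}"
  consider (inside) e where "0 < e" "closed_disc v e \<subseteq> D" "closed_disc v e - {origin v} \<subseteq> Z"
    | (outside) e where "0 < e" "closed_disc v e \<subseteq> D" "Z \<inter> (closed_disc v e - {origin v}) = {}"
    by (rule zariski_closed_near_origin[OF D Z])
  then show ?thesis
  proof cases
    case inside
    have g: "gauss v e \<in> closed_disc v e - {origin v}" "gauss v e \<in> ?U"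
      using gauss_in_disc[OF subset_refl inside(1) order_refl] gauss_in_disc[OF inside(2,1) order_refl] by auto
    then have "gauss v e \<in> zero_locus ?U f" using zero inside(3) by blast
    then have "f (gauss v e) = \<zero>\<^bsub>residue_field (gauss v e)\<^esub>" by (simp add: zero_locus_def)
    then show ?thesis using nonzero_at_gauss[OF D f _ _ inside(1) g(2)] by blast
  next
    case outside
    let ?V = "D \<inter> {x. x T < e}"
    have "open {x :: 'a point. x T < e}"
      by (intro open_Collect_less continuous_on_eval continuous_on_const)
    then have "openin (top_of_set D) ?V" by (rule openin_open_Int)
    moreover have "origin v \<in> ?V" using disc_origin[OF D] outside(1) by (simp add: origin_T)
    moreover have "restrict f (?V - {origin v}) \<in> Units (An (?V - {origin v}))"
    proof (rule An_Units)
      have sub: "?V - {origin v} \<subseteq> ?U" by blast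
      show "?V - {origin v} \<subseteq> affine_line v" using disc_affine[OF D] by blast
      show "restrict f (?V - {origin v}) \<in> carrier (An (?V - {origin v}))"
        by (rule An_restrict[OF f sub])
      fix x assume x: "x \<in> ?V - {origin v}"
      then have "x \<in> closed_disc v e - {origin v}" using disc_affine[OF D] by (auto simp: closed_disc_def)
      then have "x \<notin> zero_locus ?U f" using outside(3) zero by blast
      then show "restrict f (?V - {origin v}) x \<noteq> \<zero>\<^bsub>residue_field x\<^esub>"
        using x by (auto simp: zero_locus_def)
    qed
    ultimately show ?thesis unfolding invertible_near_origin_def by blast
  qed
qed

end

theorem lemma1p9:
  fixes v :: "'a::field \<Rightarrow> real" and R :: real and D U :: "'a point set" and f :: "'a sect"
  assumes "complete_nonarch_field v"
    and "0 < R"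
    and "D = closed_disc v R \<or> D = open_disc v R"
    and "U = D - {origin v}"
    and "f \<in> carrier (analytic_ring v U)"
  shows "(extends_meromorphically v D U f \<longleftrightarrow>
            (\<exists>Z. zariski_closed v D Z \<and> zero_locus U f = Z \<inter> U)) \<and>
         (extends_meromorphically v D U f \<longleftrightarrow> no_essential_singularity U f) \<and>
         (f \<noteq> \<zero>\<^bsub>analytic_ring v U\<^esub> \<longrightarrow>
            ((\<exists>Z. zariski_closed v D Z \<and> zero_locus U f = Z \<inter> U) \<longleftrightarrow>
               invertible_near_origin v D f))"
proof -
  interpret valued_field v by (rule valued_field.intro[OF assms(1)])
  have D: "disc D" unfolding disc_def using assms(2,3) by blast
  have U: "U \<subseteq> affine_line v" using disc_affine[OF D] assms(4) by blast
  note f = assms(5)[unfolded assms(4)]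
  have f0: "f = \<zero>\<^bsub>An U\<^esub>" if "\<forall>x\<in>U. f x = \<zero>\<^bsub>residue_field x\<^esub>"
    using that assms(5) An_zero_closed[OF U] by (intro An_eqI[of f U]) (simp_all add: An_simps)
  let ?ness = "no_essential_singularity U f" and ?ext = "extends_meromorphically v D U f"
  let ?zar = "\<exists>Z. zariski_closed v D Z \<and> zero_locus U f = Z \<inter> U"
  have 1: "?ext \<longleftrightarrow> ?ness"
    using extends_of_no_essential_singularity[OF D f] no_essential_singularity_of_extends[OF D f] assms(4) by blast
  have 2: "?zar" if ?ness
    using zariski_of_no_essential_singularity[OF D f] that assms(4) by blast
  have 3: "(\<forall>x\<in>U. f x = \<zero>\<^bsub>residue_field x\<^esub>) \<or> invertible_near_origin v D f" if zar: ?zar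
  proof -
    obtain Z where "zariski_closed v D Z" "zero_locus U f = Z \<inter> U" using zar by blast
    then show ?thesis
      using zero_or_invertible_of_zariski[OF D f] assms(4) by blast
  qed
  have 4: "?ness" if "invertible_near_origin v D f"
    using no_essential_singularity_of_invertible[OF D f that] assms(4) by blast
  have 5: "?ness" if "\<forall>x\<in>U. f x = \<zero>\<^bsub>residue_field x\<^esub>"
    using no_essential_singularity_zero[OF U] that by blast
  show ?thesis using 1 2 3 4 5 f0 by blast
qed

end
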